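(* Let $0<\beta<1$ and $q=\frac{d}{d-\beta}$. For $f\in W^{1,1}_{\mathrm{rad}}(\mathbb{R}^d)$ and $x\in\mathbb{R}^d$ let $\mathbf{B}_x^\beta(f)$ be the set of balls $B(x,r)$, $r>0$, with $M_\beta f(x)=\frac{r^\beta}{m(B(x,r))}\int_{B(x,r)}|f|\,dm$. Assume that there is a constant $C=C(\beta,d)$ such that for every $f\in W^{1,1}_{\mathrm{rad}}(\mathbb{R}^d)$ and every $\rho>0$ the following two properties hold: (i) if $H\subset\mathbb{R}^d$ is measurable and for every $x\in H$ there exists $B_x\in\mathbf{B}_x^\beta(f)$ with $B_x\subset B(0,\rho)$, then $$\int_H|\nabla M_\beta f|^q\le C\left(\int_{B(0,2\rho)}|\nabla f|\right)^q;$$ (ii) if $G\subset\mathbb{R}^d$ is measurable and for every $x\in G$ there exists $B_x\in\mathbf{B}_x^\beta(f)$ with $B_x\subset B(0,\rho)^c$, then $$\int_G|\nabla M_\beta f|^q\le C\left(\int_{B(0,\rho/2)^c}|\nabla f|\right)^q.$$ Then the map $f\mapsto|\nabla M_\beta f|$ is continuous from $W^{1,1}_{\mathrm{rad}}(\mathbb{R}^d)$ (with the $W^{1,1}(\mathbb{R}^d)$ norm) to $L^q(\mathbb{R}^d)$.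
   Context: $W^{1,1}_{\mathrm{rad}}(\mathbb{R}^d)$ is the set of radial functions in $W^{1,1}(\mathbb{R}^d)$, $m$ is Lebesgue measure and $B(x,r)$ is the open Euclidean ball. The centered fractional Hardy-Littlewood maximal operator is $M_\beta f(x)=\sup_{r>0}\frac{r^\beta}{m(B(x,r))}\int_{B(x,r)}|f|\,dm$. $\nabla$ denotes the weak gradient, defined almost everywhere. *)

theory Defs
  imports "HOL-Analysis.Analysis"
begin

section \<open>Weak gradients\<close>

primrec C_k :: "nat \<Rightarrow> ('a::euclidean_space \<Rightarrow> real) \<Rightarrow> bool" where
  "C_k 0 \<phi> \<longleftrightarrow> continuous_on UNIV \<phi>"
| "C_k (Suc k) \<phi> \<longleftrightarrow> \<phi> differentiable_on UNIV \<and>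
     (\<forall>e\<in>Basis. C_k k (\<lambda>x. frechet_derivative \<phi> (at x) e))"

definition test_function :: "('a::euclidean_space \<Rightarrow> real) \<Rightarrow> bool" where
  "test_function \<phi> \<longleftrightarrow> (\<forall>k. C_k k \<phi>) \<and> compact (closure {x. \<phi> x \<noteq> 0})"

definition locally_integrable :: "('a::euclidean_space \<Rightarrow> 'b::euclidean_space) \<Rightarrow> bool" where
  "locally_integrable u \<longleftrightarrow> (\<forall>K. compact K \<longrightarrow> set_integrable lebesgue K u)"

definition has_weak_gradient ::
    "('a::euclidean_space \<Rightarrow> real) \<Rightarrow> ('a \<Rightarrow> 'a) \<Rightarrow> bool" (infix "has'_weak'_gradient" 50) where
  "u has_weak_gradient g \<longleftrightarrow> locally_integrable u \<and> locally_integrable g \<and>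
     (\<forall>\<phi>. test_function \<phi> \<longrightarrow> (\<forall>e\<in>Basis.
        (LINT x|lebesgue. u x * frechet_derivative \<phi> (at x) e)
          = - (LINT x|lebesgue. (g x \<bullet> e) * \<phi> x)))"

definition weakly_differentiable :: "('a::euclidean_space \<Rightarrow> real) \<Rightarrow> bool" where
  "weakly_differentiable u \<longleftrightarrow> (\<exists>g. u has_weak_gradient g)"

text \<open>A representative of the weak gradient, which is determined up to null sets; it is
  meaningful only for weakly differentiable functions.\<close>

definition weak_grad :: "('a::euclidean_space \<Rightarrow> real) \<Rightarrow> 'a \<Rightarrow> 'a" where
  "weak_grad u = (SOME g. u has_weak_gradient g)"


section \<open>Function spaces\<close>

text \<open>Elements of the spaces are functions rather than classes modulo null sets; accordingly
  the norms are seminorms, and radiality is only required almost everywhere.\<close>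

definition W11 :: "('a::euclidean_space \<Rightarrow> real) set" where
  "W11 = {f. integrable lebesgue f \<and> (\<exists>g. f has_weak_gradient g \<and> integrable lebesgue g)}"

definition W11_norm :: "('a::euclidean_space \<Rightarrow> real) \<Rightarrow> real" where
  "W11_norm f = (LINT x|lebesgue. \<bar>f x\<bar>) + (LINT x|lebesgue. norm (weak_grad f x))"

definition radial :: "('a::euclidean_space \<Rightarrow> real) \<Rightarrow> bool" where
  "radial f \<longleftrightarrow> (\<exists>h::real \<Rightarrow> real. AE x in lebesgue. f x = h (norm x))"

definition W11_rad :: "('a::euclidean_space \<Rightarrow> real) set" where
  "W11_rad = {f \<in> W11. radial f}"

definition Lp_space :: "real \<Rightarrow> ('a::euclidean_space \<Rightarrow> real) set" where
  "Lp_space p = {h \<in> borel_measurable lebesgue. integrable lebesgue (\<lambda>x. \<bar>h x\<bar> powr p)}"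

definition Lp_norm :: "real \<Rightarrow> ('a::euclidean_space \<Rightarrow> real) \<Rightarrow> real" where
  "Lp_norm p h = (LINT x|lebesgue. \<bar>h x\<bar> powr p) powr (1 / p)"


section \<open>The centered fractional maximal operator\<close>

definition frac_avg :: "real \<Rightarrow> ('a::euclidean_space \<Rightarrow> real) \<Rightarrow> 'a \<Rightarrow> real \<Rightarrow> ennreal" where
  "frac_avg \<beta> f x r =
     ennreal (r powr \<beta> / measure lebesgue (ball x r)) * (\<integral>\<^sup>+y\<in>ball x r. ennreal \<bar>f y\<bar> \<partial>lebesgue)"

definition frac_max :: "real \<Rightarrow> ('a::euclidean_space \<Rightarrow> real) \<Rightarrow> 'a \<Rightarrow> ennreal" where
  "frac_max \<beta> f x = (SUP r\<in>{0<..}. frac_avg \<beta> f x r)"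

definition max_balls :: "real \<Rightarrow> ('a::euclidean_space \<Rightarrow> real) \<Rightarrow> 'a \<Rightarrow> 'a set set" where
  "max_balls \<beta> f x = {ball x r | r. r > 0 \<and> frac_max \<beta> f x = frac_avg \<beta> f x r}"

text \<open>The supremum may be infinite on a null set (for instance at the origin), where the
  real-valued version takes the value 0. Optimal balls are defined through the extended value,
  so there are none at such a point when the function is integrable.\<close>

definition frac_max_real :: "real \<Rightarrow> ('a::euclidean_space \<Rightarrow> real) \<Rightarrow> 'a \<Rightarrow> real" where
  "frac_max_real \<beta> f x = enn2real (frac_max \<beta> f x)"

end

theory Submission
  imports Defs
begin

text \<open>
  Why the theorem holds. For \<open>F = \<bar>f\<bar>\<close> and a fixed radius \<open>r\<close> the fractional mean of \<open>F\<close> over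
  \<open>B(x,r)\<close> is a \<open>C\<^sup>1\<close> function of \<open>x\<close>, and its gradient is the fractional mean of \<open>\<nabla>F\<close>. The
  maximal function is the supremum over \<open>r\<close> of these means, so at a point with an optimal radius
  \<open>r\<close> its gradient ought to be the mean of \<open>\<nabla>F\<close> over the optimal ball. For radii in a compact
  interval this is true almost everywhere and for every optimal radius
  (\<open>envelope_weak_derivative\<close>, \<open>trunc_max_wgrad\<close>); since \<open>\<beta> > 0\<close>, the means of an integrable
  function are dominated by a locally integrable function, and the truncation can be removed
  (\<open>maximal_wgrad\<close>). The same convexity argument that compares one-sided increments gives
  \<open>\<nabla>\<bar>f\<bar> = sgn f \<nabla>f\<close> and \<open>\<nabla>f = 0\<close> almost everywhere on \<open>{f = 0}\<close> (\<open>wgrad_abs\<close>,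
  \<open>wgrad_zero_on_zero_set\<close>), so \<open>f \<mapsto> \<bar>f\<bar>\<close> is continuous in the Sobolev norm.

  Radial symmetry enters through one estimate, \<open>radial_frac_mean_bound\<close>: away from the origin the
  means over small balls of radius \<open>r\<close> are at most a constant times \<open>r\<^sup>\<beta>\<close> and the Sobolev norm.
  Therefore every point other than the origin has an optimal radius, and, for functions near a
  nonzero \<open>f\<close>, the optimal radii at points of a compact set that avoids the origin stay between
  two positive bounds (\<open>radii_bounds\<close>).

  Let \<open>f\<^sub>k \<longlonglongrightarrow> f \<noteq> 0\<close>. Optimal radii for \<open>f\<^sub>k\<close> accumulate only at optimal radii for \<open>f\<close>, hence the
  gradients of the maximal functions converge almost everywhere (\<open>gradient_tendsto\<close>). For \<open>L\<^sup>q\<close>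
  convergence the two hypotheses make the contributions of the points with an optimal ball in a
  small ball about the origin, or outside a large one, small uniformly in \<open>k\<close>. At the remaining
  points the gradients are dominated (\<open>gradient_dominated\<close>): on bounded sets
  the optimal radii are bounded below, hence the gradients are bounded, and at a point \<open>x\<close> far out the optimal radius is at least \<open>\<bar>x\<bar> / 2\<close>, where optimality of the
  radius improves the bound on the gradient to a multiple of \<open>\<bar>x\<bar>\<close> to the power \<open>\<beta> - d - 1\<close>,
  whose \<open>q\<close>-th power is integrable at infinity. Dominated convergence finishes the proof. For
  \<open>f = 0\<close> the first hypothesis alone bounds the gradients in terms of \<open>\<nabla>f\<^sub>k\<close>.
\<close>

section \<open>Test functions\<close>

lemma C_k_add: "C_k k \<phi> \<Longrightarrow> C_k k \<psi> \<Longrightarrow> C_k k (\<lambda>x. \<phi> x + \<psi> x)"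
proof (induction k arbitrary: \<phi> \<psi>)
  case (Suc k)
  have "frechet_derivative (\<lambda>x. \<phi> x + \<psi> x) (at x)
      = (\<lambda>e. frechet_derivative \<phi> (at x) e + frechet_derivative \<psi> (at x) e)" for x
    using Suc.prems
    by (intro frechet_derivative_at[symmetric] has_derivative_add)
       (auto simp: differentiable_on_def frechet_derivative_works[symmetric])
  then show ?case using Suc by (auto intro: differentiable_on_add)
qed (auto intro: continuous_intros)

lemma C_k_decrease: "C_k (Suc k) \<phi> \<Longrightarrow> C_k k \<phi>"
  by (induction k arbitrary: \<phi>) (auto intro: differentiable_imp_continuous_on)

lemma C_k_mult: "C_k k \<phi> \<Longrightarrow> C_k k \<psi> \<Longrightarrow> C_k k (\<lambda>x. \<phi> x * \<psi> x)"
proof (induction k arbitrary: \<phi> \<psi>)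
  case (Suc k)
  have "frechet_derivative (\<lambda>x. \<phi> x * \<psi> x) (at x)
      = (\<lambda>e. \<phi> x * frechet_derivative \<psi> (at x) e + frechet_derivative \<phi> (at x) e * \<psi> x)" for x
    using Suc.prems
    by (intro frechet_derivative_at[symmetric] has_derivative_mult)
       (auto simp: differentiable_on_def frechet_derivative_works[symmetric])
  then show ?case using Suc Suc.prems[THEN C_k_decrease]
    by (auto intro!: differentiable_on_mult C_k_add)
qed (auto intro: continuous_intros)

lemma C_k_const: "C_k k (\<lambda>x. c)"
  by (induction k arbitrary: c) auto

lemma C_k_cmult: "C_k k \<phi> \<Longrightarrow> C_k k (\<lambda>x. c * \<phi> x)"
  by (intro C_k_mult C_k_const)

lemma C_k_prod: "finite I \<Longrightarrow> (\<And>i. i \<in> I \<Longrightarrow> C_k k (\<phi> i)) \<Longrightarrow> C_k k (\<lambda>x. \<Prod>i\<in>I. \<phi> i x)"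
  by (induction I rule: finite_induct) (auto intro: C_k_const C_k_mult)

lemma frechet_derivative_shift:
  assumes "\<phi> differentiable_on UNIV"
  shows "frechet_derivative (\<lambda>x. \<phi> (x - v)) (at x) = frechet_derivative \<phi> (at (x - v))"
proof -
  have "((\<lambda>x. \<phi> (x - v)) has_derivative frechet_derivative \<phi> (at (x - v))) (at x)"
    using assms
    by (intro has_derivative_compose[where f="\<lambda>x. x - v" and f'="\<lambda>x. x" and g=\<phi>, simplified])
       (auto intro!: derivative_eq_intros simp: differentiable_on_def frechet_derivative_works[symmetric])
  then show ?thesis by (rule frechet_derivative_at[symmetric])
qed

lemma C_k_shift: "C_k k \<phi> \<Longrightarrow> C_k k (\<lambda>x. \<phi> (x - v))"
proof (induction k arbitrary: \<phi>)
  case 0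
  then show ?case by (auto intro!: continuous_on_compose2[of UNIV \<phi>] continuous_intros)
next
  case (Suc k)
  have d: "\<phi> differentiable_on UNIV" using Suc.prems by auto
  have "(\<lambda>x. \<phi> (x - v)) differentiable_on UNIV"
    using d by (auto simp: differentiable_on_def
        intro!: differentiable_compose[of \<phi> "\<lambda>x. x - v", unfolded o_def] derivative_intros)
  moreover have "C_k k (\<lambda>x. frechet_derivative \<phi> (at (x - v)) e)" if "e \<in> Basis" for e
    using Suc.prems that Suc.IH[of "\<lambda>x. frechet_derivative \<phi> (at x) e"] by simp
  ultimately show ?case by (simp add: frechet_derivative_shift[OF d])
qed

text \<open>The derivatives of the classical smooth function \<open>exp (- 1 / t)\<close> are linear combinations of
  members of this family, which makes smoothness an induction.\<close>

definition flat :: "nat \<Rightarrow> real \<Rightarrow> real" where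
  "flat m t = (if t > 0 then exp (- 1 / t) / t ^ m else 0)"

lemma flat_le: "\<bar>flat m t\<bar> \<le> fact (m + j) * \<bar>t\<bar> ^ j"
proof (cases "t > 0")
  case True
  have "sum (\<lambda>n. (1/t) ^ n /\<^sub>R fact n) {m+j} \<le> exp (1/t)"
    unfolding exp_def using True by (intro sum_le_suminf summable_exp_generic) auto
  then have "(1/t) ^ (m+j) / fact (m+j) \<le> exp (1/t)"
    by (simp add: divide_inverse mult.commute)
  then have "exp (- 1/t) * ((1/t) ^ (m+j) / fact (m+j)) \<le> exp (-1/t) * exp (1/t)"
    by (intro mult_left_mono) auto
  then have "exp (- 1/t) / t^(m+j) \<le> fact (m+j)"
    using True by (simp add: exp_minus field_simps power_divide)
  then show ?thesis using True by (simp add: flat_def power_add field_simps)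
qed (auto simp: flat_def)

lemma DERIV_flat: "DERIV (flat m) t :> flat (m + 2) t - m * flat (m + 1) t"
proof -
  consider "t > 0" | "t < 0" | "t = 0" by linarith
  then show ?thesis
  proof cases
    case 1
    have "DERIV (\<lambda>t. exp (- 1 / t) / t ^ m) t :> flat (m + 2) t - m * flat (m + 1) t"
      using 1
      by (auto intro!: derivative_eq_intros simp: flat_def field_simps power2_eq_square power_Suc)
         (cases m; simp add: field_simps)
    then show ?thesis
      by (rule has_field_derivative_transform_within_open[where S="{0<..}"])
         (use 1 in \<open>auto simp: flat_def\<close>)
  next
    case 2
    have "DERIV (\<lambda>t. 0) t :> flat (m + 2) t - m * flat (m + 1) t"
      using 2 by (auto simp: flat_def)
    then show ?thesis
      by (rule has_field_derivative_transform_within_open[where S="{..<0}"])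
         (use 2 in \<open>auto simp: flat_def\<close>)
  next
    case 3
    have le: "\<bar>flat m h / h\<bar> \<le> fact (m+2) * \<bar>h\<bar>" for h
      using flat_le[of m h 2]
      by (cases "h = 0") (auto simp del: fact_Suc add_2_eq_Suc' simp: divide_le_eq power2_eq_square abs_mult abs_divide mult.assoc)
    have "((\<lambda>h. fact (m+2) * \<bar>h\<bar>) \<longlongrightarrow> fact (m+2) * \<bar>0\<bar>) (at (0::real))"
      by (intro tendsto_intros)
    then have "((\<lambda>h. flat m h / h) \<longlongrightarrow> 0) (at 0)"
      by (intro Lim_null_comparison[of "\<lambda>h. flat m h / h" "\<lambda>h. fact (m+2) * \<bar>h\<bar>"])
         (use le in auto)
    then show ?thesis using 3 by (simp add: DERIV_def flat_def)
  qed
qed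

lemma C_k_flat: "C_k k (\<lambda>x::'a::euclidean_space. flat m (\<alpha> * (x \<bullet> b) + \<gamma>))"
proof (induction k arbitrary: m)
  case 0
  have "continuous_on UNIV (flat m)"
    using DERIV_flat by (intro DERIV_continuous_on) (auto intro: has_field_derivative_at_within)
  then show ?case by (auto intro!: continuous_on_compose2[of UNIV "flat m"] continuous_intros)
next
  case (Suc k)
  have *: "((\<lambda>x::'a. flat m (\<alpha> * (x \<bullet> b) + \<gamma>)) has_derivative
      (\<lambda>e. (flat (m+2) (\<alpha> * (x \<bullet> b) + \<gamma>) + (- m) * flat (m+1) (\<alpha> * (x \<bullet> b) + \<gamma>)) * (\<alpha> * (e \<bullet> b)))) (at x)"
    for x
    using DERIV_flat[of m "\<alpha> * (x \<bullet> b) + \<gamma>", unfolded has_field_derivative_def]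
    by (intro has_derivative_eq_rhs[OF has_derivative_compose[where g="flat m" and f="\<lambda>x. \<alpha> * (x \<bullet> b) + \<gamma>"]])
       (auto intro!: derivative_eq_intros simp: fun_eq_iff)
  have "(\<lambda>x::'a. flat m (\<alpha> * (x \<bullet> b) + \<gamma>)) differentiable_on UNIV"
    using * by (auto simp: differentiable_on_def differentiable_def)
  then show ?case
    by (simp only: C_k.simps frechet_derivative_at[OF *, symmetric])
      (intro conjI ballI C_k_mult C_k_const C_k_add Suc; simp)
qed

lemma flat_bounds: "0 \<le> flat 0 t" "flat 0 t \<le> 1" "flat 0 t > 0 \<longleftrightarrow> t > 0"
  by (auto simp: flat_def)

lemma test_function_shift:
  assumes "test_function \<phi>" shows "test_function (\<lambda>x. \<phi> (x - v))"
proof -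
  have "{x. \<phi> (x - v) \<noteq> 0} = (+) v ` {x. \<phi> x \<noteq> 0}"
    by (auto simp: image_iff intro!: exI[of _ "_ - v"])
  then have "closure {x. \<phi> (x - v) \<noteq> 0} = (+) v ` closure {x. \<phi> x \<noteq> 0}"
    by (simp add: closure_translation)
  then show ?thesis using assms
    by (auto simp: test_function_def intro: C_k_shift compact_translation)
qed

lemma compact_support_subset:
  fixes \<phi> :: "'a::euclidean_space \<Rightarrow> real"
  assumes "compact K" "\<And>x. \<phi> x \<noteq> 0 \<Longrightarrow> x \<in> K"
  shows "compact (closure {x. \<phi> x \<noteq> 0})"
proof -
  have "closure {x. \<phi> x \<noteq> 0} \<subseteq> K"
    using assms by (intro closure_minimal) (auto intro: compact_imp_closed)
  then show ?thesis using assms(1) by (metis closed_closure compact_Int_closed inf.absorb_iff2)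
qed

lemma test_function_add:
  assumes "test_function \<phi>" "test_function \<psi>" shows "test_function (\<lambda>x. \<phi> x + \<psi> x)"
  unfolding test_function_def
proof (intro conjI allI)
  show "compact (closure {x. \<phi> x + \<psi> x \<noteq> 0})"
  proof (rule compact_support_subset)
    show "compact (closure {x. \<phi> x \<noteq> 0} \<union> closure {x. \<psi> x \<noteq> 0})"
      using assms by (intro compact_Un) (simp_all only: test_function_def)
    fix x assume "\<phi> x + \<psi> x \<noteq> 0"
    then have "x \<in> {x. \<phi> x \<noteq> 0} \<union> {x. \<psi> x \<noteq> 0}" by auto
    then show "x \<in> closure {x. \<phi> x \<noteq> 0} \<union> closure {x. \<psi> x \<noteq> 0}"
      by (rule subsetD[OF Un_mono[OF closure_subset closure_subset]])
  qed
qed (use assms in \<open>auto simp: test_function_def intro: C_k_add\<close>)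

lemma test_function_cmult:
  assumes "test_function \<phi>" shows "test_function (\<lambda>x. c * \<phi> x)"
  unfolding test_function_def
proof (intro conjI allI)
  show "compact (closure {x. c * \<phi> x \<noteq> 0})"
  proof (rule compact_support_subset)
    show "compact (closure {x. \<phi> x \<noteq> 0})"
      using assms by (simp only: test_function_def)
    fix x assume "c * \<phi> x \<noteq> 0"
    then have "x \<in> {x. \<phi> x \<noteq> 0}" by auto
    then show "x \<in> closure {x. \<phi> x \<noteq> 0}"
      by (rule subsetD[OF closure_subset])
  qed
qed (use assms in \<open>auto simp: test_function_def intro: C_k_cmult\<close>)

definition box_bump :: "real \<Rightarrow> 'a::euclidean_space \<Rightarrow> 'a \<Rightarrow> 'a \<Rightarrow> real" where
  "box_bump j a b x = (\<Prod>i\<in>Basis. flat 0 (j * (x \<bullet> i - a \<bullet> i)) * flat 0 (j * (b \<bullet> i - x \<bullet> i)))"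

lemma box_bump_bounds: "0 \<le> box_bump j a b x" "box_bump j a b x \<le> 1"
  by (auto simp: box_bump_def flat_bounds intro!: prod_nonneg prod_le_1 mult_le_one)

lemma box_bump_pos_iff: "j > 0 \<Longrightarrow> box_bump j a b x > 0 \<longleftrightarrow> x \<in> box a b"
proof -
  assume j: "j > 0"
  have "flat 0 s = 0 \<longleftrightarrow> s \<le> 0" for s by (auto simp: flat_def)
  then have "box_bump j a b x \<noteq> 0 \<longleftrightarrow> x \<in> box a b"
    using j by (auto simp: box_bump_def box_def mult_le_0_iff not_le)
  then show ?thesis using box_bump_bounds[of j a b x] by auto
qed

lemma test_function_box_bump:
  assumes "j > 0" shows "test_function (box_bump j a b)"
  unfolding test_function_def
proof (intro conjI allI)
  have "x \<in> cbox a b" if "box_bump j a b x \<noteq> 0" for x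
    using that box_bump_pos_iff[OF assms, of a b x] box_bump_bounds(1)[of j a b x] box_subset_cbox[of a b]
    by auto
  then show "compact (closure {x. box_bump j a b x \<noteq> 0})"
    by (intro compact_support_subset[OF compact_cbox])
  fix k
  have "C_k k (\<lambda>x. \<Prod>i\<in>Basis. flat 0 (j * (x \<bullet> i) + (- (j * (a \<bullet> i)))) * flat 0 ((- j) * (x \<bullet> i) + j * (b \<bullet> i)))"
    by (intro C_k_prod C_k_mult C_k_flat finite_Basis)
  then show "C_k k (box_bump j a b)"
    by (simp add: box_bump_def[abs_def] algebra_simps)
qed

text \<open>The bumps stay below 1 and approximate the indicator of the box; this is how test functions
  reach integrals over boxes.\<close>

lemma box_bump_tendsto: "(\<lambda>n. box_bump (real (Suc n)) a b x) \<longlonglongrightarrow> indicator (box a b) x"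
proof (cases "x \<in> box a b")
  case True
  have lim: "(\<lambda>n. flat 0 (real (Suc n) * s)) \<longlonglongrightarrow> 1" if "s > 0" for s
  proof -
    have "(\<lambda>n. exp (- (1/s) * (1 / real (Suc n)))) \<longlonglongrightarrow> exp (- (1/s) * 0)"
      by (intro tendsto_intros) (use lim_1_over_n[where 'a=real] LIMSEQ_Suc in blast)
    then show ?thesis using that by (simp add: flat_def mult.commute)
  qed
  have "(\<lambda>n. box_bump (real (Suc n)) a b x) \<longlonglongrightarrow> (\<Prod>i\<in>(Basis::'a set). 1 * 1)"
    unfolding box_bump_def using True
    by (intro tendsto_prod tendsto_mult lim) (auto simp: box_def)
  then show ?thesis using True by simp
next
  case False
  then have "box_bump (real (Suc n)) a b x = 0" for n
    using box_bump_pos_iff[of "real (Suc n)" a b x] box_bump_bounds(1)[of "real (Suc n)" a b x] by auto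
  then show ?thesis using False by simp
qed

lemma test_function_differentiable:
  "test_function \<phi> \<Longrightarrow> (\<phi> has_derivative frechet_derivative \<phi> (at x)) (at x)"
proof -
  assume "test_function \<phi>"
  then have "C_k (Suc 0) \<phi>" by (simp add: test_function_def)
  then show ?thesis by (auto simp: differentiable_on_def frechet_derivative_works[symmetric])
qed

lemma test_function_continuous:
  assumes "test_function \<phi>" shows "continuous_on S \<phi>"
proof -
  have "C_k 0 \<phi>" using assms by (simp add: test_function_def)
  then show ?thesis by (auto intro: continuous_on_subset)
qed

lemma frechet_expand:
  assumes "test_function \<phi>"
  shows "frechet_derivative \<phi> (at x) v = (\<Sum>b\<in>Basis. (v \<bullet> b) * frechet_derivative \<phi> (at x) b)"
proof -
  interpret linear "frechet_derivative \<phi> (at x)"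
    using test_function_differentiable[OF assms, of x] has_derivative_linear by auto
  have "frechet_derivative \<phi> (at x) (\<Sum>b\<in>Basis. (v \<bullet> b) *\<^sub>R b) = (\<Sum>b\<in>Basis. (v \<bullet> b) * frechet_derivative \<phi> (at x) b)"
    by (simp add: sum scale)
  then show ?thesis by (simp add: euclidean_representation)
qed

lemma test_function_derivative_continuous:
  assumes "test_function \<phi>" shows "continuous_on S (\<lambda>x. frechet_derivative \<phi> (at x) v)"
proof -
  have "C_k (Suc 0) \<phi>" using assms by (simp add: test_function_def)
  then have "continuous_on S (\<lambda>x. frechet_derivative \<phi> (at x) b)" if "b \<in> Basis" for b
    using that by (auto intro: continuous_on_subset)
  then show ?thesis
    by (subst frechet_expand[OF assms]) (auto intro!: continuous_intros)
qed

lemma test_function_support: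
  fixes \<phi> :: "'a::euclidean_space \<Rightarrow> real"
  assumes "test_function \<phi>"
  obtains R where "R > 0" "\<And>x. norm x \<ge> R \<Longrightarrow> \<phi> x = 0"
    "\<And>x v. norm x \<ge> R \<Longrightarrow> frechet_derivative \<phi> (at x) v = 0"
proof -
  define K where "K = closure {x. \<phi> x \<noteq> 0}"
  have "compact K" using assms by (simp add: K_def test_function_def)
  then obtain R where R: "R > 0" "\<And>x. x \<in> K \<Longrightarrow> norm x < R"
    using compact_imp_bounded[of K] unfolding bounded_pos_less by auto
  have 0: "\<phi> x = 0" if "x \<notin> K" for x
    using that closure_subset[of "{x. \<phi> x \<noteq> 0}"] by (auto simp: K_def)
  show ?thesis
  proof (rule that[of R])
    fix x v :: 'a assume x: "norm x \<ge> R"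
    then have xK: "x \<in> - K" using R(2) by force
    show "\<phi> x = 0" using xK 0 by auto
    have "(\<phi> has_derivative (\<lambda>_. 0)) (at x)"
      by (rule has_derivative_transform_within_open[where f="\<lambda>_. 0" and s="- K"])
         (use xK 0 compact_imp_closed[OF \<open>compact K\<close>] in \<open>simp_all add: open_Compl\<close>)
    then have "frechet_derivative \<phi> (at x) = (\<lambda>_. 0)"
      by (rule frechet_derivative_at[symmetric])
    then show "frechet_derivative \<phi> (at x) v = 0" by simp
  qed (use R in auto)
qed

lemma test_function_bounded:
  assumes "test_function \<phi>"
  obtains B where "B > 0" "\<And>x. \<bar>\<phi> x\<bar> \<le> B" "\<And>x. \<bar>frechet_derivative \<phi> (at x) v\<bar> \<le> B"
proof -
  obtain R where R: "R > 0" "\<And>x. norm x \<ge> R \<Longrightarrow> \<phi> x = 0"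
    "\<And>x v. norm x \<ge> R \<Longrightarrow> frechet_derivative \<phi> (at x) v = 0"
    using test_function_support[OF assms] by metis
  have "bounded (\<phi> ` cball 0 R)" "bounded ((\<lambda>x. frechet_derivative \<phi> (at x) v) ` cball 0 R)"
    using assms by (auto intro!: compact_imp_bounded compact_continuous_image
        test_function_continuous test_function_derivative_continuous)
  then obtain B1 B2 where B: "B1 > 0" "\<And>x. norm x \<le> R \<Longrightarrow> \<bar>\<phi> x\<bar> \<le> B1"
     "B2 > 0" "\<And>x. norm x \<le> R \<Longrightarrow> \<bar>frechet_derivative \<phi> (at x) v\<bar> \<le> B2"
    unfolding bounded_pos by auto
  show ?thesis
  proof (rule that[of "max B1 B2"])
    fix x
    show "\<bar>\<phi> x\<bar> \<le> max B1 B2"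
      using B R by (cases "norm x \<le> R") (auto simp: le_max_iff_disj)
    show "\<bar>frechet_derivative \<phi> (at x) v\<bar> \<le> max B1 B2"
      using B R by (cases "norm x \<le> R") (auto simp: le_max_iff_disj)
  qed (use B in auto)
qed

lemma test_function_measurable[measurable (raw)]:
  assumes "test_function \<phi>" 
  shows "\<phi> \<in> borel_measurable borel" "(\<lambda>x. frechet_derivative \<phi> (at x) v) \<in> borel_measurable borel"
  using assms by (auto intro!: borel_measurable_continuous_onI
      test_function_continuous test_function_derivative_continuous)

lemma test_function_DERIV:
  assumes "test_function \<phi>"
  shows "DERIV (\<lambda>t. \<phi> (x + t *\<^sub>R v)) t :> frechet_derivative \<phi> (at (x + t *\<^sub>R v)) v"
proof -
  interpret linear "frechet_derivative \<phi> (at (x + t *\<^sub>R v))"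
    using test_function_differentiable[OF assms] has_derivative_linear by blast
  have "((\<lambda>t. \<phi> (x + t *\<^sub>R v)) has_derivative
      (\<lambda>s. frechet_derivative \<phi> (at (x + t *\<^sub>R v)) (s *\<^sub>R v))) (at t)"
    by (intro has_derivative_compose[where g=\<phi> and f="\<lambda>t. x + t *\<^sub>R v"]
        test_function_differentiable[OF assms]) (auto intro!: derivative_eq_intros)
  moreover have "(\<lambda>s. frechet_derivative \<phi> (at (x + t *\<^sub>R v)) (s *\<^sub>R v))
      = (*) (frechet_derivative \<phi> (at (x + t *\<^sub>R v)) v)"
    by (simp add: fun_eq_iff scale mult.commute)
  ultimately show ?thesis by (simp only: has_field_derivative_def)
qed

section \<open>Weak gradients\<close>

text \<open>The boxes are an intersection-stable generator of the Borel sets, so vanishing integrals over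
  them propagate to all Borel sets. The hypothesis on the whole space serves complements.\<close>

lemma AE_zero_of_box_integrals:
  fixes w :: "'a::euclidean_space \<Rightarrow> real"
  assumes w: "integrable lborel w"
    and box: "\<And>a b. (LINT x|lborel. indicator (box a b) x * w x) = 0"
    and all: "(LINT x|lborel. w x) = 0"
  shows "AE x in lborel. w x = 0"
proof -
  have [measurable]: "w \<in> borel_measurable borel" using borel_measurable_integrable[OF w] by simp
  have int: "integrable lborel (\<lambda>x. indicator A x * w x)" if "A \<in> sets borel" for A
    using integrable_mult_indicator[OF _ w, of A] that by simp
  have zero: "(LINT x|lborel. indicator A x * w x) = 0" if A: "A \<in> sets borel" for A
  proof -
    have "Int_stable (range (\<lambda>(a, b). box a b :: 'a set))"
      by (auto simp: Int_stable_def box_Int_box)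
    moreover have "range (\<lambda>(a, b). box a b :: 'a set) \<subseteq> Pow UNIV" by simp
    moreover have "A \<in> sigma_sets UNIV (range (\<lambda>(a, b). box a b))"
      using A unfolding borel_eq_box by simp
    ultimately show ?thesis
    proof (induction rule: sigma_sets_induct_disjoint)
      case (basic A) then show ?case using box by auto
    next
      case empty then show ?case by simp
    next
      case (compl A)
      then have A: "A \<in> sets borel" by (simp add: borel_eq_box)
      have "(LINT x|lborel. indicator (UNIV - A) x * w x)
          = (LINT x|lborel. w x - indicator A x * w x)"
        by (intro Bochner_Integration.integral_cong) (auto simp: indicator_def)
      also have "\<dots> = 0" using compl all int[OF A] w by simp
      finally show ?case .
    next
      case (union F)
      then have F: "F i \<in> sets borel" for i by (auto simp: borel_eq_box)
      have "(\<lambda>n. LINT x|lborel. indicator (\<Union>i<n. F i) x * w x)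
          \<longlonglongrightarrow> (LINT x|lborel. indicator (\<Union>i. F i) x * w x)"
      proof (rule integral_dominated_convergence[where w="\<lambda>x. \<bar>w x\<bar>"])
        show "AE x in lborel. (\<lambda>n. indicator (\<Union>i<n. F i) x * w x) \<longlonglongrightarrow> indicator (\<Union>i. F i) x * w x"
        proof (intro AE_I2)
          fix x show "(\<lambda>n. indicator (\<Union>i<n. F i) x * w x) \<longlonglongrightarrow> indicator (\<Union>i. F i) x * w x"
            by (intro tendsto_intros LIMSEQ_indicator_UN)
        qed
      qed (use F w in \<open>auto simp: indicator_def\<close>)
      moreover have "(LINT x|lborel. indicator (\<Union>i<n. F i) x * w x) = 0" for n
      proof -
        have "(LINT x|lborel. indicator (\<Union>i<n. F i) x * w x)
            = (LINT x|lborel. (\<Sum>i<n. indicator (F i) x * w x))"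
          using union(1)
          by (intro Bochner_Integration.integral_cong)
             (auto simp: indicator_UN_disjoint sum_distrib_right disjoint_family_on_def)
        also have "\<dots> = (\<Sum>i<n. LINT x|lborel. indicator (F i) x * w x)"
          by (rule Bochner_Integration.integral_sum) (rule int[OF F])
        also have "\<dots> = 0" using union(3) by simp
        finally show ?thesis .
      qed
      ultimately show ?case using LIMSEQ_unique[OF _ tendsto_const] by fastforce
    qed
  qed
  have "AE x in lborel. w x = (\<lambda>_. 0) x"
    using w zero by (intro density_unique_real) (auto simp: set_lebesgue_integral_def)
  then show ?thesis by simp
qed

text \<open>Local integrability of a Borel function. Working with Borel representatives and \<open>lborel\<close>
  instead of \<open>lebesgue\<close> makes the product measure, hence Fubini's theorem, available.\<close>

definition locint :: "('a::euclidean_space \<Rightarrow> 'b::euclidean_space) \<Rightarrow> bool" where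
  "locint u \<longleftrightarrow> u \<in> borel_measurable borel \<and>
     (\<forall>R. integrable lborel (\<lambda>x. indicator (cball 0 R) x *\<^sub>R u x))"

lemma locint_measurable: "locint u \<Longrightarrow> u \<in> borel_measurable borel"
  by (simp add: locint_def)

lemma integrable_imp_locint: "integrable lborel u \<Longrightarrow> locint u"
  by (auto simp: locint_def intro!: integrable_mult_indicator dest: borel_measurable_integrable)

lemma locint_mult_integrable:
  fixes u :: "'a::euclidean_space \<Rightarrow> 'b::euclidean_space"
  assumes u: "locint u" and [measurable]: "\<psi> \<in> borel_measurable borel"
    and B: "\<And>x. \<bar>\<psi> x\<bar> \<le> B" and R: "\<And>x. norm x \<ge> R \<Longrightarrow> \<psi> x = 0"
  shows "integrable lborel (\<lambda>x. \<psi> x *\<^sub>R u x)"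
proof (rule Bochner_Integration.integrable_bound)
  show "integrable lborel (\<lambda>x. B *\<^sub>R (indicator (cball 0 R) x *\<^sub>R u x))"
    using u by (intro integrable_scaleR_right) (simp add: locint_def)
  have [measurable]: "u \<in> borel_measurable borel" using u by (simp add: locint_def)
  show "(\<lambda>x. \<psi> x *\<^sub>R u x) \<in> borel_measurable lborel" by measurable
  have "B \<ge> 0" using B[of 0] by linarith
  then show "AE x in lborel. norm (\<psi> x *\<^sub>R u x) \<le> norm (B *\<^sub>R indicator (cball 0 R) x *\<^sub>R u x)"
    using B R by (auto simp: indicator_def intro!: mult_right_mono)
qed

lemma locint_mult_test:
  fixes u :: "'a::euclidean_space \<Rightarrow> real"
  assumes "locint u" "test_function \<phi>"
  shows "integrable lborel (\<lambda>x. u x * \<phi> x)"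
    "integrable lborel (\<lambda>x. u x * frechet_derivative \<phi> (at x) v)"
proof -
  obtain R where R: "\<And>x. norm x \<ge> R \<Longrightarrow> \<phi> x = 0"
    "\<And>x v. norm x \<ge> R \<Longrightarrow> frechet_derivative \<phi> (at x) v = 0"
    using test_function_support[OF assms(2)] by metis
  obtain B where B: "\<And>x. \<bar>\<phi> x\<bar> \<le> B" "\<And>x. \<bar>frechet_derivative \<phi> (at x) v\<bar> \<le> B"
    using test_function_bounded[OF assms(2)] by metis
  note m = test_function_measurable[OF assms(2)]
  show "integrable lborel (\<lambda>x. u x * \<phi> x)"
    using locint_mult_integrable[OF assms(1) m(1) B(1) R(1)] by (simp add: mult.commute)
  show "integrable lborel (\<lambda>x. u x * frechet_derivative \<phi> (at x) v)"
    using locint_mult_integrable[OF assms(1) m(2) B(2) R(2)] by (simp add: mult.commute)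
qed

lemma bounded_imp_locint:
  fixes u :: "'a::euclidean_space \<Rightarrow> 'b::euclidean_space"
  assumes u: "u \<in> borel_measurable borel" and B: "\<And>x. norm (u x) \<le> B"
  shows "locint u"
  unfolding locint_def
proof (intro conjI allI u)
  fix R
  have "emeasure lborel (cball 0 R :: 'a set) < \<infinity>"
    using emeasure_lborel_cball_finite[of "0::'a" R] by simp
  then have i: "integrable lborel (\<lambda>x. B * indicator (cball (0::'a) R) x)"
    by (intro integrable_mult_right) (auto simp: integrable_indicator_iff)
  have m: "(\<lambda>x. indicator (cball 0 R) x *\<^sub>R u x) \<in> borel_measurable lborel"
    by (intro borel_measurable_scaleR borel_measurable_indicator) (use u in auto)
  show "integrable lborel (\<lambda>x. indicator (cball 0 R) x *\<^sub>R u x)"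
    by (rule Bochner_Integration.integrable_bound[OF i m])
       (use order_trans[OF B abs_ge_self] in \<open>auto simp: indicator_def intro!: AE_I2\<close>)
qed

lemma continuous_imp_locint:
  fixes u :: "'a::euclidean_space \<Rightarrow> 'b::euclidean_space"
  assumes u: "continuous_on UNIV u"
  shows "locint u"
  unfolding locint_def
proof (intro conjI allI borel_measurable_continuous_onI u)
  show "integrable lborel (\<lambda>x. indicator (cball 0 R) x *\<^sub>R u x)" for R
    using borel_integrable_compact[of "cball 0 R" u] continuous_on_subset[OF u] by auto
qed

lemma locint_inner: 
  fixes g :: "'a::euclidean_space \<Rightarrow> 'b::euclidean_space"
  assumes "locint g" shows "locint (\<lambda>x. g x \<bullet> e)"
proof -
  have [measurable]: "g \<in> borel_measurable borel" using assms by (simp add: locint_def)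
  have "integrable lborel (\<lambda>x. (indicator (cball 0 R) x *\<^sub>R g x) \<bullet> e)" for R
    using assms by (intro integrable_inner_left) (auto simp: locint_def)
  then show ?thesis by (auto simp: locint_def)
qed

lemma locint_add: "locint u \<Longrightarrow> locint v \<Longrightarrow> locint (\<lambda>x. u x + v x)"
  by (auto simp: locint_def scaleR_add_right)

lemma locint_diff: "locint u \<Longrightarrow> locint v \<Longrightarrow> locint (\<lambda>x. u x - v x)"
  by (auto simp: locint_def scaleR_diff_right)

text \<open>The fundamental lemma of the calculus of variations. Nonnegative test functions suffice
  because the bumps that approximate the indicator of a box are nonnegative.\<close>

lemma fundamental_lemma:
  fixes w :: "'a::euclidean_space \<Rightarrow> real"
  assumes w: "locint w"
    and test: "\<And>\<phi>. test_function \<phi> \<Longrightarrow> (\<And>x. 0 \<le> \<phi> x) \<Longrightarrow> (LINT x|lborel. w x * \<phi> x) = 0"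
  shows "AE x in lborel. w x = 0"
proof -
  have [measurable]: "w \<in> borel_measurable borel" using w by (simp add: locint_def)
  have int: "integrable lborel (\<lambda>x. indicator S x * w x)"
    if S: "bounded S" and [measurable]: "S \<in> sets borel" for S
  proof -
    obtain R where "\<And>x. x \<in> S \<Longrightarrow> norm x < R" using S unfolding bounded_pos_less by auto
    then show ?thesis
      using locint_mult_integrable[OF w, of "indicator S" 1 R] by (force simp: indicator_def)
  qed
  have box: "(LINT x|lborel. indicator (box a b) x * w x) = 0" for a b
  proof -
    have "(\<lambda>n. LINT x|lborel. box_bump (real (Suc n)) a b x * w x)
        \<longlonglongrightarrow> (LINT x|lborel. indicator (box a b) x * w x)"
    proof (rule integral_dominated_convergence[where w="\<lambda>x. \<bar>indicator (box a b) x * w x\<bar>"])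
      show "integrable lborel (\<lambda>x. \<bar>indicator (box a b) x * w x\<bar>)"
        by (intro integrable_abs int) auto
      show "AE x in lborel. (\<lambda>n. box_bump (real (Suc n)) a b x * w x) \<longlonglongrightarrow> indicator (box a b) x * w x"
        by (intro AE_I2 tendsto_mult box_bump_tendsto tendsto_const)
      show "AE x in lborel. norm (box_bump (real (Suc n)) a b x * w x)
           \<le> \<bar>indicator (box a b) x * w x\<bar>" for n
      proof (intro AE_I2)
        fix x
        have "\<bar>box_bump (real (Suc n)) a b x\<bar> \<le> indicator (box a b) x"
          using box_bump_bounds[of "real (Suc n)" a b x] box_bump_pos_iff[of "real (Suc n)" a b x]
          by (auto simp: indicator_def)
        then show "norm (box_bump (real (Suc n)) a b x * w x) \<le> \<bar>indicator (box a b) x * w x\<bar>"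
          by (simp add: abs_mult mult_right_mono)
      qed
      show "(\<lambda>x. box_bump (real (Suc n)) a b x * w x) \<in> borel_measurable lborel" for n
        using test_function_measurable(1)[OF test_function_box_bump[of "real (Suc n)" a b]] by simp
    qed simp
    moreover have "(LINT x|lborel. box_bump (real (Suc n)) a b x * w x) = 0" for n
      using test[OF test_function_box_bump[of "real (Suc n)" a b] box_bump_bounds(1)]
      by (simp add: mult.commute)
    ultimately show ?thesis using LIMSEQ_unique[OF _ tendsto_const] by fastforce
  qed
  have "AE x in lborel. \<forall>n. indicator (box (- (real n *\<^sub>R One)) (real n *\<^sub>R One)) x * w x = 0"
    unfolding AE_all_countable
  proof
    fix n :: nat
    let ?B = "box (- (real n *\<^sub>R One)) (real n *\<^sub>R One :: 'a)"
    show "AE x in lborel. indicator ?B x * w x = 0"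
    proof (rule AE_zero_of_box_integrals)
      show "(LINT x|lborel. indicator (box a b) x * (indicator ?B x * w x)) = 0" for a b
        using box by (simp add: mult.assoc[symmetric] indicator_inter_arith[symmetric] box_Int_box)
    qed (auto intro: int box)
  qed
  then show ?thesis
  proof eventually_elim
    fix x assume *: "\<forall>n. indicator (box (- (real n *\<^sub>R One)) (real n *\<^sub>R One)) x * w x = 0"
    obtain n where "x \<in> box (- (real n *\<^sub>R One)) (real n *\<^sub>R One)"
    proof -
      have "x \<in> (\<Union>i::nat. box (- (real i *\<^sub>R One)) (real i *\<^sub>R One))"
        unfolding UN_box_eq_UNIV by simp
      then show thesis using that by (elim UN_E)
    qed
    then show "w x = 0" using *[rule_format, of n] by simp
  qed
qed

text \<open>Weak gradients for Borel representatives; \<open>wgrad_imp_weak_gradient\<close>,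
  \<open>weak_gradient_ex_wgrad\<close> and \<open>weak_grad_AE\<close> translate to the almost everywhere classes.\<close>

definition wgrad :: "('a::euclidean_space \<Rightarrow> real) \<Rightarrow> ('a \<Rightarrow> 'a) \<Rightarrow> bool" where
  "wgrad u g \<longleftrightarrow> locint u \<and> locint g \<and> (\<forall>\<phi>. test_function \<phi> \<longrightarrow> (\<forall>e\<in>Basis.
     (LINT x|lborel. u x * frechet_derivative \<phi> (at x) e) = - (LINT x|lborel. (g x \<bullet> e) * \<phi> x)))"

text \<open>An arbitrary test function is a difference of nonnegative ones: add a large multiple of a
  bump that is positive on its support.\<close>

lemma wgradI_nonneg:
  fixes u :: "'a::euclidean_space \<Rightarrow> real"
  assumes u: "locint u" and g: "locint g"
    and eq: "\<And>\<phi> e. test_function \<phi> \<Longrightarrow> (\<And>x. 0 \<le> \<phi> x) \<Longrightarrow> e \<in> Basis \<Longrightarrow>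
     (LINT x|lborel. u x * frechet_derivative \<phi> (at x) e) = - (LINT x|lborel. (g x \<bullet> e) * \<phi> x)"
  shows "wgrad u g"
  unfolding wgrad_def
proof (intro conjI allI impI ballI u g)
  fix \<phi> :: "'a \<Rightarrow> real" and e :: 'a assume \<phi>: "test_function \<phi>" and e: "e \<in> Basis"
  obtain R where R: "R > 0" "\<And>x. norm x \<ge> R \<Longrightarrow> \<phi> x = 0"
    using test_function_support[OF \<phi>] by metis
  obtain B where B: "B > 0" "\<And>x. \<bar>\<phi> x\<bar> \<le> B" using test_function_bounded[OF \<phi>] by metis
  obtain a :: 'a where a: "cball 0 R \<subseteq> box (- a) a"
    using bounded_subset_box_symmetric[OF bounded_cball] by metis
  define \<eta> where "\<eta> = box_bump 1 (- a) a"
  have \<eta>: "test_function \<eta>" unfolding \<eta>_def by (rule test_function_box_bump) simp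
  have pos: "\<eta> x \<ge> 0" for x by (simp add: \<eta>_def box_bump_bounds)
  \<comment> \<open>The bump has a positive minimum on the support of \<open>\<phi>\<close>, which determines the multiple \<open>K\<close>.\<close>
  obtain x0 where x0: "x0 \<in> cball 0 R" "\<And>x. x \<in> cball 0 R \<Longrightarrow> \<eta> x0 \<le> \<eta> x"
    using continuous_attains_inf[of "cball (0::'a) R" \<eta>] test_function_continuous[OF \<eta>] R by auto
  have "\<eta> x0 > 0" unfolding \<eta>_def using x0(1) a by (subst box_bump_pos_iff) auto
  define K where "K = B / \<eta> x0"
  have le: "0 \<le> K * \<eta> x + \<phi> x" for x
  proof (cases "norm x < R")
    case True
    then have "B \<le> K * \<eta> x" using x0(2)[of x] \<open>\<eta> x0 > 0\<close> B(1) by (simp add: K_def field_simps)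
    then show ?thesis using B(2)[of x] by linarith
  qed (use R pos[of x] B \<open>\<eta> x0 > 0\<close> in \<open>auto simp: K_def\<close>)
  have K0: "0 \<le> K * \<eta> x" for x using pos[of x] B \<open>\<eta> x0 > 0\<close> by (auto simp: K_def)
  have K\<eta>: "test_function (\<lambda>x. K * \<eta> x)" by (rule test_function_cmult[OF \<eta>])
  have S: "test_function (\<lambda>x. K * \<eta> x + \<phi> x)" by (rule test_function_add[OF K\<eta> \<phi>])
  have D: "frechet_derivative (\<lambda>x. K * \<eta> x + \<phi> x) (at x)
      = (\<lambda>e. frechet_derivative (\<lambda>x. K * \<eta> x) (at x) e + frechet_derivative \<phi> (at x) e)" for x
    by (intro frechet_derivative_at[symmetric] has_derivative_add test_function_differentiable K\<eta> \<phi>)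
  have "(LINT x|lborel. u x * frechet_derivative \<phi> (at x) e)
      = (LINT x|lborel. u x * frechet_derivative (\<lambda>x. K * \<eta> x + \<phi> x) (at x) e)
      - (LINT x|lborel. u x * frechet_derivative (\<lambda>x. K * \<eta> x) (at x) e)"
    unfolding D by (subst Bochner_Integration.integral_diff[symmetric])
      (use locint_mult_test[OF u \<phi>] locint_mult_test[OF u K\<eta>] in \<open>auto simp: distrib_left intro!: Bochner_Integration.integrable_add\<close>)
  also have "\<dots> = - ((LINT x|lborel. (g x \<bullet> e) * (K * \<eta> x + \<phi> x)) - (LINT x|lborel. (g x \<bullet> e) * (K * \<eta> x)))"
    using eq[OF S le e] eq[OF K\<eta> K0 e] by simp
  also have "(LINT x|lborel. (g x \<bullet> e) * (K * \<eta> x + \<phi> x)) - (LINT x|lborel. (g x \<bullet> e) * (K * \<eta> x))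
      = (LINT x|lborel. (g x \<bullet> e) * \<phi> x)"
    by (subst Bochner_Integration.integral_diff[symmetric])
      (use locint_mult_test(1)[OF locint_inner[OF g] \<phi>] locint_mult_test(1)[OF locint_inner[OF g] K\<eta>] in
        \<open>auto simp: distrib_left intro!: Bochner_Integration.integrable_add\<close>)
  finally show "(LINT x|lborel. u x * frechet_derivative \<phi> (at x) e) = - (LINT x|lborel. (g x \<bullet> e) * \<phi> x)" .
qed

lemma wgrad_unique:
  fixes u :: "'a::euclidean_space \<Rightarrow> real"
  assumes "wgrad u g" "wgrad u' g'" "AE x in lborel. u x = u' x"
  shows "AE x in lborel. g x = g' x"
proof -
  have g: "locint g" "locint g'" and u: "locint u" "locint u'" using assms by (auto simp: wgrad_def)
  note [measurable] = u[THEN locint_measurable]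
  have "AE x in lborel. g x \<bullet> e - g' x \<bullet> e = 0" if e: "e \<in> Basis" for e
  proof (rule fundamental_lemma)
    show "locint (\<lambda>x. g x \<bullet> e - g' x \<bullet> e)" by (intro locint_diff locint_inner g)
    fix \<phi> :: "'a \<Rightarrow> real" assume \<phi>: "test_function \<phi>"
    note [measurable] = test_function_measurable[OF \<phi>]
    have "(LINT x|lborel. u x * frechet_derivative \<phi> (at x) e) = (LINT x|lborel. u' x * frechet_derivative \<phi> (at x) e)"
      using assms(3) by (intro integral_cong_AE) auto
    then have "(LINT x|lborel. (g x \<bullet> e) * \<phi> x) = (LINT x|lborel. (g' x \<bullet> e) * \<phi> x)"
      using assms(1,2) \<phi> e by (auto simp: wgrad_def)
    then show "(LINT x|lborel. (g x \<bullet> e - g' x \<bullet> e) * \<phi> x) = 0"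
      using locint_mult_test(1)[OF locint_inner[OF g(1)] \<phi>, of e] locint_mult_test(1)[OF locint_inner[OF g(2)] \<phi>, of e]
      by (simp add: left_diff_distrib)
  qed
  then have "AE x in lborel. \<forall>e\<in>Basis. g x \<bullet> e - g' x \<bullet> e = 0"
    by (intro AE_finite_allI) auto
  then show ?thesis by eventually_elim (auto intro: euclidean_eqI)
qed

lemma wgrad_diff:
  assumes "wgrad u g" "wgrad v h" shows "wgrad (\<lambda>x. u x - v x) (\<lambda>x. g x - h x)"
  unfolding wgrad_def
proof (intro conjI allI impI ballI)
  have l: "locint u" "locint v" "locint g" "locint h" using assms by (auto simp: wgrad_def)
  then show "locint (\<lambda>x. u x - v x)" "locint (\<lambda>x. g x - h x)" by (auto intro: locint_diff)
  fix \<phi> :: "'a \<Rightarrow> real" and e :: 'a assume \<phi>: "test_function \<phi>" and e: "e \<in> Basis"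
  show "(LINT x|lborel. (u x - v x) * frechet_derivative \<phi> (at x) e)
      = - (LINT x|lborel. ((g x - h x) \<bullet> e) * \<phi> x)"
    using assms \<phi> e locint_mult_test[OF l(1) \<phi>] locint_mult_test[OF l(2) \<phi>]
      locint_mult_test(1)[OF locint_inner[OF l(3)] \<phi>] locint_mult_test(1)[OF locint_inner[OF l(4)] \<phi>]
    by (simp add: left_diff_distrib inner_diff_left wgrad_def)
qed

lemma lebesgue_measurable_AE:
  fixes u v :: "'a::euclidean_space \<Rightarrow> 'b::euclidean_space"
  assumes u: "u \<in> borel_measurable lebesgue" and ae: "AE x in lebesgue. u x = v x"
  shows "v \<in> borel_measurable lebesgue"
proof (rule borel_measurableI)
  fix S :: "'b set" assume S: "open S"
  have ae': "AE x in lborel. u x = v x" using ae by (simp add: AE_completion_iff)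
  have "Measurable.pred lebesgue (\<lambda>x. u x \<noteq> v x)" "Measurable.pred lebesgue (\<lambda>x. v x \<in> S \<and> u x \<noteq> v x)"
    using ae' by (auto intro!: sets_completion_AE)
  then have "{x. u x \<noteq> v x} \<in> sets lebesgue" "{x. v x \<in> S \<and> u x \<noteq> v x} \<in> sets lebesgue"
    by (simp_all add: pred_def)
  moreover have "u -` S \<in> sets lebesgue" using measurable_sets[OF u borel_open[OF S]] by simp
  ultimately have "(u -` S - {x. u x \<noteq> v x}) \<union> {x. v x \<in> S \<and> u x \<noteq> v x} \<in> sets lebesgue"
    by (intro sets.Un sets.Diff)
  also have "(u -` S - {x. u x \<noteq> v x}) \<union> {x. v x \<in> S \<and> u x \<noteq> v x} = v -` S" by auto
  finally show "v -` S \<inter> space lebesgue \<in> sets lebesgue" by simp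
qed

lemma lebesgue_integral_representative:
  fixes f g :: "'a::euclidean_space \<Rightarrow> 'b::euclidean_space"
  assumes [measurable]: "g \<in> borel_measurable borel" and ae: "AE x in lborel. f x = g x"
  shows "integral\<^sup>L lebesgue f = integral\<^sup>L lborel g"
proof -
  have ae': "AE x in lebesgue. g x = f x" 
    by (intro AE_completion eventually_mono[OF ae]) simp
  have g: "g \<in> borel_measurable lebesgue" by (intro measurable_completion) simp
  have "integral\<^sup>L lebesgue g = integral\<^sup>L lebesgue f"
    by (rule integral_cong_AE[OF g lebesgue_measurable_AE[OF g ae'] ae'])
  then show ?thesis by (simp add: integral_completion)
qed

lemma locint_imp_locally_integrable:
  fixes u :: "'a::euclidean_space \<Rightarrow> 'b::euclidean_space"
  assumes "locint u" "AE x in lborel. u x = v x"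
  shows "locally_integrable v"
  unfolding locally_integrable_def set_integrable_def
proof (intro allI impI)
  fix K :: "'a set" assume K: "compact K"
  then obtain R where R: "K \<subseteq> cball 0 R"
    using bounded_subset_ballD[OF compact_imp_bounded[OF K], of 0] ball_subset_cball by blast
  have [measurable]: "u \<in> borel_measurable borel" "K \<in> sets borel"
    using assms(1) K by (auto simp: locint_def borel_compact)
  have "integrable lborel (\<lambda>x. indicator K x *\<^sub>R (indicator (cball 0 R) x *\<^sub>R u x))"
    using assms(1) by (intro integrable_mult_indicator[of K]) (auto simp only: locint_def, simp)
  then have i: "integrable lborel (\<lambda>x. indicator K x *\<^sub>R u x)"
    by (rule back_subst[of "integrable lborel"]) (use R in \<open>auto simp: indicator_def fun_eq_iff\<close>)
  then have i': "integrable lebesgue (\<lambda>x. indicator K x *\<^sub>R u x)"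
    by (subst integrable_completion) auto
  have AE: "AE x in lebesgue. indicator K x *\<^sub>R u x = indicator K x *\<^sub>R v x"
    using assms(2) by (intro AE_completion) auto
  show "integrable lebesgue (\<lambda>x. indicator K x *\<^sub>R v x)"
    by (rule integrable_cong_AE_imp[OF i' _ AE], rule lebesgue_measurable_AE[OF _ AE])
       (rule borel_measurable_integrable[OF i'])
qed

lemma wgrad_imp_weak_gradient:
  assumes w: "wgrad u g" and u: "AE x in lborel. u x = u' x" and g: "AE x in lborel. g x = g' x"
  shows "u' has_weak_gradient g'"
  unfolding has_weak_gradient_def
proof (intro conjI allI impI ballI)
  have l: "locint u" "locint g" using w by (auto simp: wgrad_def)
  note [measurable] = l[THEN locint_measurable]
  show "locally_integrable u'" "locally_integrable g'"
    using locint_imp_locally_integrable l u g by auto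
  fix \<phi> :: "'a \<Rightarrow> real" and e :: 'a assume \<phi>: "test_function \<phi>" and e: "e \<in> Basis"
  note [measurable] = test_function_measurable[OF \<phi>]
  have "(LINT x|lebesgue. u' x * frechet_derivative \<phi> (at x) e)
      = (LINT x|lborel. u x * frechet_derivative \<phi> (at x) e)"
    by (rule lebesgue_integral_representative) (use u in \<open>auto\<close>)
  moreover have "(LINT x|lebesgue. (g' x \<bullet> e) * \<phi> x) = (LINT x|lborel. (g x \<bullet> e) * \<phi> x)"
    by (rule lebesgue_integral_representative) (use g in \<open>auto\<close>)
  ultimately show "(LINT x|lebesgue. u' x * frechet_derivative \<phi> (at x) e)
      = - (LINT x|lebesgue. (g' x \<bullet> e) * \<phi> x)"
    using w \<phi> e by (simp add: wgrad_def)
qed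

lemma locally_integrable_measurable:
  fixes u :: "'a::euclidean_space \<Rightarrow> 'b::euclidean_space"
  assumes "locally_integrable u" shows "u \<in> borel_measurable lebesgue"
proof (rule borel_measurable_LIMSEQ_metric)
  show "(\<lambda>x. indicator (cball 0 (real n)) x *\<^sub>R u x) \<in> borel_measurable lebesgue" for n
    using assms compact_cball[of "0::'a" "real n"] unfolding locally_integrable_def set_integrable_def
    by (intro borel_measurable_integrable) simp
  fix x :: 'a
  obtain N where N: "norm x \<le> real N" using real_arch_simple by blast
  have "\<forall>\<^sub>F n in sequentially. indicator (cball 0 (real n)) x *\<^sub>R u x = u x"
    using eventually_ge_at_top[of N] by eventually_elim (use N in \<open>auto simp: indicator_def\<close>)
  then show "(\<lambda>n. indicator (cball 0 (real n)) x *\<^sub>R u x) \<longlonglongrightarrow> u x"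
    by (rule tendsto_eventually)
qed

lemma lebesgue_ex_borel:
  fixes u :: "'a::euclidean_space \<Rightarrow> 'b::euclidean_space"
  assumes "u \<in> borel_measurable lebesgue"
  obtains u' where "u' \<in> borel_measurable borel" "AE x in lborel. u x = u' x"
proof -
  have "\<exists>g'\<in>borel_measurable lborel. AE x in lborel. u x \<bullet> e = g' x" for e
    using assms by (intro completion_ex_borel_measurable_real) auto
  then obtain g' where g': "\<And>e. g' e \<in> borel_measurable lborel" "\<And>e. AE x in lborel. u x \<bullet> e = g' e x"
    by metis
  have [measurable]: "g' e \<in> borel_measurable borel" for e using g'(1)[of e] by simp
  show ?thesis
  proof (rule that[of "\<lambda>x. \<Sum>e\<in>Basis. g' e x *\<^sub>R e"])
    have "AE x in lborel. \<forall>e\<in>Basis. u x \<bullet> e = g' e x"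
      using g'(2) by (intro AE_finite_allI) auto
    then show "AE x in lborel. u x = (\<Sum>e\<in>Basis. g' e x *\<^sub>R e)"
    proof eventually_elim
      fix x assume "\<forall>e\<in>Basis. u x \<bullet> e = g' e x"
      then have "(\<Sum>e\<in>Basis. g' e x *\<^sub>R e) = (\<Sum>e\<in>Basis. (u x \<bullet> e) *\<^sub>R e)" by simp
      then show "u x = (\<Sum>e\<in>Basis. g' e x *\<^sub>R e)" by (simp add: euclidean_representation)
    qed
  qed measurable
qed

lemma locally_integrable_ex_locint:
  fixes u :: "'a::euclidean_space \<Rightarrow> 'b::euclidean_space"
  assumes u: "locally_integrable u"
  obtains u' where "locint u'" "AE x in lborel. u x = u' x"
proof -
  obtain u' where m: "u' \<in> borel_measurable borel" and ae: "AE x in lborel. u x = u' x"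
    using lebesgue_ex_borel[OF locally_integrable_measurable[OF u]] by metis
  have "integrable lborel (\<lambda>x. indicator (cball 0 R) x *\<^sub>R u' x)" for R
  proof -
    have i: "integrable lebesgue (\<lambda>x. indicator (cball 0 R) x *\<^sub>R u x)"
      using u by (auto simp: locally_integrable_def set_integrable_def)
    have [measurable]: "(\<lambda>x. indicator (cball 0 R) x *\<^sub>R u' x) \<in> borel_measurable borel"
      by (intro borel_measurable_scaleR borel_measurable_indicator m) auto
    have "integrable lebesgue (\<lambda>x. indicator (cball 0 R) x *\<^sub>R u' x)"
      by (rule integrable_cong_AE_imp[OF i]) (use ae in \<open>auto intro!: AE_completion measurable_completion\<close>)
    then show ?thesis by (subst (asm) integrable_completion) auto
  qed
  then show ?thesis using ae m by (intro that) (auto simp: locint_def)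
qed

lemma weak_gradient_ex_wgrad:
  assumes "u has_weak_gradient g"
  obtains u' g' where "wgrad u' g'" "AE x in lborel. u x = u' x" "AE x in lborel. g x = g' x"
proof -
  from assms obtain u' g' where l: "locint u'" "locint g'"
    and ae: "AE x in lborel. u x = u' x" "AE x in lborel. g x = g' x"
    unfolding has_weak_gradient_def using locally_integrable_ex_locint by metis
  note [measurable] = l[THEN locint_measurable]
  have "wgrad u' g'"
    unfolding wgrad_def
  proof (intro conjI allI impI ballI l)
    fix \<phi> :: "'a \<Rightarrow> real" and e :: 'a assume \<phi>: "test_function \<phi>" and e: "e \<in> Basis"
    note [measurable] = test_function_measurable[OF \<phi>]
    have "(LINT x|lebesgue. u x * frechet_derivative \<phi> (at x) e)
        = (LINT x|lborel. u' x * frechet_derivative \<phi> (at x) e)"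
      by (rule lebesgue_integral_representative) (use ae(1) in \<open>auto\<close>)
    moreover have "(LINT x|lebesgue. (g x \<bullet> e) * \<phi> x) = (LINT x|lborel. (g' x \<bullet> e) * \<phi> x)"
      by (rule lebesgue_integral_representative) (use ae(2) in \<open>auto\<close>)
    ultimately show "(LINT x|lborel. u' x * frechet_derivative \<phi> (at x) e)
        = - (LINT x|lborel. (g' x \<bullet> e) * \<phi> x)"
      using assms \<phi> e by (simp add: has_weak_gradient_def)
  qed
  then show ?thesis using ae by (rule that)
qed

lemma weak_grad_AE:
  assumes w: "wgrad u g" and u: "AE x in lborel. u' x = u x"
  shows "AE x in lborel. weak_grad u' x = g x"
proof -
  have "AE x in lborel. u x = u' x" using u by eventually_elim simp
  then have "u' has_weak_gradient g" using wgrad_imp_weak_gradient[OF w] by simp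
  then have "u' has_weak_gradient weak_grad u'" unfolding weak_grad_def by (rule someI[of "\<lambda>g. u' has_weak_gradient g"])
  then obtain v h where vh: "wgrad v h" "AE x in lborel. u' x = v x" "AE x in lborel. weak_grad u' x = h x"
    using weak_gradient_ex_wgrad by metis
  have "AE x in lborel. u x = v x" using u vh(2) by eventually_elim simp
  then have "AE x in lborel. g x = h x" using wgrad_unique[OF w vh(1)] by simp
  then show ?thesis using vh(3) by eventually_elim simp
qed

section \<open>Translations and increments of Sobolev functions\<close>

lemma nn_integral_shift:
  fixes v :: "'a::euclidean_space"
  assumes [measurable]: "f \<in> borel_measurable borel"
  shows "(\<integral>\<^sup>+x. f (x + v) \<partial>lborel) = (\<integral>\<^sup>+x. f x \<partial>lborel)"
proof -
  have "(\<integral>\<^sup>+x. f x \<partial>lborel) = (\<integral>\<^sup>+x. f x \<partial>distr lborel borel ((+) v))"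
    by (simp add: lborel_distr_plus)
  also have "\<dots> = (\<integral>\<^sup>+x. f (x + v) \<partial>lborel)"
    by (subst nn_integral_distr) (auto simp: add.commute)
  finally show ?thesis by simp
qed

lemma lborel_integrable_shift:
  fixes f :: "'a::euclidean_space \<Rightarrow> 'b::euclidean_space"
  assumes f: "integrable lborel f"
  shows "integrable lborel (\<lambda>x. f (x + v))"
proof -
  have "integrable (distr lborel borel ((+) v)) f" using f by (simp add: lborel_distr_plus)
  then have "integrable lborel (\<lambda>x. f (v + x))" by (subst (asm) integrable_distr_eq) (use f in auto)
  then show ?thesis by (simp add: add.commute)
qed

lemma lborel_integral_shift:
  fixes f :: "'a::euclidean_space \<Rightarrow> 'b::euclidean_space"
  assumes [measurable]: "f \<in> borel_measurable borel"
  shows "(LINT x|lborel. f (x + v)) = (LINT x|lborel. f x)"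
proof -
  have "(LINT x|lborel. f x) = (LINT x|distr lborel borel ((+) v). f x)"
    by (simp add: lborel_distr_plus)
  also have "\<dots> = (LINT x|lborel. f (x + v))"
    by (subst integral_distr) (auto simp: add.commute)
  finally show ?thesis by simp
qed

text \<open>Translations preserve the integral, so continuity of translations in mean passes to limits
  in mean.\<close>

lemma translation_L1_approx:
  fixes f :: "'a::euclidean_space \<Rightarrow> real"
  assumes f: "integrable lborel f" and v: "v \<longlonglongrightarrow> 0"
    and approx: "\<And>\<epsilon>. \<epsilon> > 0 \<Longrightarrow> \<exists>h. integrable lborel h \<and> (LINT x|lborel. \<bar>f x - h x\<bar>) < \<epsilon> \<and>
      (\<lambda>n. LINT x|lborel. \<bar>h (x + v n) - h x\<bar>) \<longlonglongrightarrow> 0"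
  shows "(\<lambda>n. LINT x|lborel. \<bar>f (x + v n) - f x\<bar>) \<longlonglongrightarrow> 0"
proof (rule LIMSEQ_I)
  fix \<epsilon> :: real assume "\<epsilon> > 0"
  then obtain h where h: "integrable lborel h" "(LINT x|lborel. \<bar>f x - h x\<bar>) < \<epsilon> / 3"
    and lim: "(\<lambda>n. LINT x|lborel. \<bar>h (x + v n) - h x\<bar>) \<longlonglongrightarrow> 0"
    using approx[of "\<epsilon> / 3"] by auto
  obtain N where N: "\<And>n. n \<ge> N \<Longrightarrow> \<bar>LINT x|lborel. \<bar>h (x + v n) - h x\<bar>\<bar> < \<epsilon> / 3"
    using LIMSEQ_D[OF lim, of "\<epsilon> / 3"] \<open>\<epsilon> > 0\<close> by auto
  show "\<exists>N. \<forall>n\<ge>N. norm ((LINT x|lborel. \<bar>f (x + v n) - f x\<bar>) - 0) < \<epsilon>"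
  proof (intro exI allI impI)
    fix n assume n: "n \<ge> N"
    note [simp] = f h(1) lborel_integrable_shift[OF f] lborel_integrable_shift[OF h(1)]
    have "(LINT x|lborel. \<bar>f (x + v n) - f x\<bar>)
      \<le> (LINT x|lborel. \<bar>f (x + v n) - h (x + v n)\<bar> + \<bar>h (x + v n) - h x\<bar> + \<bar>f x - h x\<bar>)"
      by (intro integral_mono) auto
    also have "\<dots> = (LINT x|lborel. \<bar>f (x + v n) - h (x + v n)\<bar>) + (LINT x|lborel. \<bar>h (x + v n) - h x\<bar>)
        + (LINT x|lborel. \<bar>f x - h x\<bar>)"
      by simp
    also have "(LINT x|lborel. \<bar>f (x + v n) - h (x + v n)\<bar>) = (LINT x|lborel. \<bar>f x - h x\<bar>)"
      by (rule lborel_integral_shift[of "\<lambda>x. \<bar>f x - h x\<bar>"])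
         (use borel_measurable_integrable[OF f] borel_measurable_integrable[OF h(1)] in auto)
    finally have "(LINT x|lborel. \<bar>f (x + v n) - f x\<bar>) < \<epsilon>" using h(2) N[OF n] by linarith
    then show "norm ((LINT x|lborel. \<bar>f (x + v n) - f x\<bar>) - 0) < \<epsilon>"
      by (simp add: integral_nonneg_AE)
  qed
qed

text \<open>For an open set the indicator is lower semicontinuous, so its negative increments tend to
  zero pointwise, and increments have mean zero.\<close>

lemma translation_L1_open:
  fixes U :: "'a::euclidean_space set"
  assumes U: "open U" and fin: "emeasure lborel U < \<infinity>" and v: "v \<longlonglongrightarrow> 0"
  shows "(\<lambda>n. LINT x|lborel. \<bar>indicator U (x + v n) - indicator U x :: real\<bar>) \<longlonglongrightarrow> 0"
proof -
  let ?u = "indicator U :: 'a \<Rightarrow> real"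
  have [measurable]: "U \<in> sets borel" using U by auto
  have i: "integrable lborel ?u" using fin by (auto simp: integrable_indicator_iff)
  note [simp] = i lborel_integrable_shift[OF i]
  have "(\<lambda>n. LINT x|lborel. max 0 (?u x - ?u (x + v n))) \<longlonglongrightarrow> (LINT x|(lborel :: 'a measure). 0)"
  proof (rule integral_dominated_convergence[where w="?u"])
    show "AE x in lborel. (\<lambda>n. max 0 (?u x - ?u (x + v n))) \<longlonglongrightarrow> 0"
    proof (intro AE_I2)
      fix x
      show "(\<lambda>n. max 0 (?u x - ?u (x + v n))) \<longlonglongrightarrow> 0"
      proof (cases "x \<in> U")
        case True
        have "(\<lambda>n. x + v n) \<longlonglongrightarrow> x + 0" by (intro tendsto_intros v)
        then have "\<forall>\<^sub>F n in sequentially. x + v n \<in> U" using True U by (auto dest: topological_tendstoD)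
        then have "\<forall>\<^sub>F n in sequentially. max 0 (?u x - ?u (x + v n)) = 0"
          by eventually_elim (auto simp: indicator_def)
        then show ?thesis by (rule tendsto_eventually)
      qed (simp add: indicator_def)
    qed
  qed (auto simp: indicator_def)
  then have lim: "(\<lambda>n. 2 * (LINT x|lborel. max 0 (?u x - ?u (x + v n)))) \<longlonglongrightarrow> 2 * 0"
    by (intro tendsto_intros) simp
  have "(LINT x|lborel. \<bar>?u (x + v n) - ?u x\<bar>) = 2 * (LINT x|lborel. max 0 (?u x - ?u (x + v n)))" for n
  proof -
    have "(LINT x|lborel. \<bar>?u (x + v n) - ?u x\<bar>)
        = (LINT x|lborel. 2 * max 0 (?u x - ?u (x + v n)) + (?u (x + v n) - ?u x))"
      by (intro Bochner_Integration.integral_cong) (auto simp: max_def)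
    also have "\<dots> = 2 * (LINT x|lborel. max 0 (?u x - ?u (x + v n)))
        + ((LINT x|lborel. ?u (x + v n)) - (LINT x|lborel. ?u x))"
      by (subst Bochner_Integration.integral_add) auto
    also have "(LINT x|lborel. ?u (x + v n)) = (LINT x|lborel. ?u x)"
      by (rule lborel_integral_shift) simp
    finally show ?thesis by simp
  qed
  then show ?thesis using lim by simp
qed

lemma translation_L1:
  fixes g :: "'a::euclidean_space \<Rightarrow> real"
  assumes g: "integrable lborel g" and v: "v \<longlonglongrightarrow> 0"
  shows "(\<lambda>n. LINT x|lborel. \<bar>g (x + v n) - g x\<bar>) \<longlonglongrightarrow> 0"
  using g
proof (induction rule: integrable_induct)
  case (base A c)
  then have [measurable]: "A \<in> sets borel" by simp
  have iA: "integrable lborel (indicator A :: 'a \<Rightarrow> real)" using base by (auto simp: integrable_indicator_iff)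
  have "(\<lambda>n. LINT x|lborel. \<bar>indicator A (x + v n) - indicator A x :: real\<bar>) \<longlonglongrightarrow> 0"
  proof (rule translation_L1_approx[OF iA v])
    fix \<epsilon> :: real assume e: "\<epsilon> > 0"
    have "A \<in> sets lebesgue" using base by auto
    then obtain U where U: "open U" "A \<subseteq> U" "U - A \<in> lmeasurable" "emeasure lebesgue (U - A) < ennreal \<epsilon>"
      using sets_lebesgue_outer_open[OF _ e] by metis
    have [measurable]: "U \<in> sets borel" using U by auto
    have lt: "emeasure lborel (U - A) < ennreal \<epsilon>" using U(4) by (subst (asm) emeasure_completion) auto
    have "emeasure lborel U \<le> emeasure lborel A + emeasure lborel (U - A)"
      using U(2) by (subst emeasure_Un_Int[of A lborel "U - A"]) (auto simp: Un_absorb1)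
    also have "\<dots> < \<infinity>" using base lt by (auto intro: ennreal_add_less_top less_trans)
    finally have fin: "emeasure lborel U < \<infinity>" .
    have iU: "integrable lborel (indicator U :: 'a \<Rightarrow> real)" using fin by (auto simp: integrable_indicator_iff)
    have "(LINT x|lborel. \<bar>indicator A x - indicator U x :: real\<bar>) = (LINT x|lborel. indicator (U - A) x)"
      using U(2) by (intro Bochner_Integration.integral_cong) (auto simp: indicator_def)
    also have "\<dots> = measure lborel (U - A)" by simp
    also have "\<dots> < \<epsilon>"
    proof -
      have "emeasure lborel (U - A) \<noteq> top" using lt by auto
      then have "ennreal (measure lborel (U - A)) < ennreal \<epsilon>"
        using lt by (simp add: emeasure_eq_ennreal_measure)
      then show ?thesis by (simp add: ennreal_less_iff)
    qed
    finally show "\<exists>h. integrable lborel h \<and> (LINT x|lborel. \<bar>indicator A x - h x\<bar>) < \<epsilon> \<and>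
      (\<lambda>n. LINT x|lborel. \<bar>h (x + v n) - h x\<bar>) \<longlonglongrightarrow> (0::real)"
      using translation_L1_open[OF U(1) fin v] iU by blast
  qed
  then have "(\<lambda>n. \<bar>c\<bar> * (LINT x|lborel. \<bar>indicator A (x + v n) - indicator A x :: real\<bar>)) \<longlonglongrightarrow> \<bar>c\<bar> * 0"
    by (intro tendsto_intros)
  moreover have "\<bar>indicator A (x + v n) *\<^sub>R c - indicator A x *\<^sub>R c\<bar>
      = \<bar>c\<bar> * \<bar>indicator A (x + v n) - indicator A x\<bar>" for x n
    by (simp add: left_diff_distrib[symmetric] abs_mult)
  ultimately show ?case by simp
next
  case (add f h)
  note [simp] = add.hyps lborel_integrable_shift[OF add.hyps(1)] lborel_integrable_shift[OF add.hyps(2)]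
  have "(\<lambda>n. (LINT x|lborel. \<bar>f (x + v n) - f x\<bar>) + (LINT x|lborel. \<bar>h (x + v n) - h x\<bar>)) \<longlonglongrightarrow> 0 + 0"
    by (intro tendsto_intros add.IH)
  then have "(\<lambda>n. (LINT x|lborel. \<bar>f (x + v n) - f x\<bar>) + (LINT x|lborel. \<bar>h (x + v n) - h x\<bar>)) \<longlonglongrightarrow> 0"
    by simp
  note lim0 = this
  show ?case
  proof (rule Lim_null_comparison[OF always_eventually[OF allI] lim0])
    fix n
    have "(LINT x|lborel. \<bar>f (x + v n) + h (x + v n) - (f x + h x)\<bar>)
       \<le> (LINT x|lborel. \<bar>f (x + v n) - f x\<bar> + \<bar>h (x + v n) - h x\<bar>)"
      by (intro integral_mono) auto
    then show "norm (LINT x|lborel. \<bar>f (x + v n) + h (x + v n) - (f x + h x)\<bar>)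
      \<le> (LINT x|lborel. \<bar>f (x + v n) - f x\<bar>) + (LINT x|lborel. \<bar>h (x + v n) - h x\<bar>)"
      by (simp add: integral_nonneg_AE)
  qed
next
  case (lim f s)
  show ?case
  proof (rule translation_L1_approx[OF lim.hyps(4) v])
    fix \<epsilon> :: real assume e: "\<epsilon> > 0"
    have [measurable]: "f \<in> borel_measurable borel" "\<And>i. s i \<in> borel_measurable borel"
      using borel_measurable_integrable[OF lim.hyps(4)] borel_measurable_integrable[OF lim.hyps(1)] by auto
    have "(\<lambda>i. LINT x|lborel. \<bar>f x - s i x\<bar>) \<longlonglongrightarrow> (LINT x|(lborel :: 'a measure). 0)"
    proof (rule integral_dominated_convergence[where w="\<lambda>x. 3 * \<bar>f x\<bar>"])
      show "AE x in lborel. (\<lambda>i. \<bar>f x - s i x\<bar>) \<longlonglongrightarrow> 0"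
      proof (intro AE_I2)
        fix x
        have "(\<lambda>i. \<bar>f x - s i x\<bar>) \<longlonglongrightarrow> \<bar>f x - f x\<bar>" by (intro tendsto_intros lim.hyps) simp
        then show "(\<lambda>i. \<bar>f x - s i x\<bar>) \<longlonglongrightarrow> 0" by simp
      qed
      show "AE x in lborel. norm \<bar>f x - s i x\<bar> \<le> 3 * \<bar>f x\<bar>" for i
      proof (intro AE_I2)
        fix x show "norm \<bar>f x - s i x\<bar> \<le> 3 * \<bar>f x\<bar>" using lim.hyps(3)[of x i] by simp
      qed
    qed (use lim.hyps(4) in auto)
    then have "\<forall>\<^sub>F i in sequentially. (LINT x|lborel. \<bar>f x - s i x\<bar>) < \<epsilon>"
      using e by (intro order_tendstoD) auto
    then obtain i where "(LINT x|lborel. \<bar>f x - s i x\<bar>) < \<epsilon>" by (auto simp: eventually_sequentially)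
    then show "\<exists>h. integrable lborel h \<and> (LINT x|lborel. \<bar>f x - h x\<bar>) < \<epsilon> \<and>
      (\<lambda>n. LINT x|lborel. \<bar>h (x + v n) - h x\<bar>) \<longlonglongrightarrow> 0"
      using lim.hyps(1) lim.IH by blast
  qed
qed

lemma wgrad_direction:
  assumes w: "wgrad u g" and \<phi>: "test_function \<phi>"
  shows "(LINT x|lborel. u x * frechet_derivative \<phi> (at x) v) = - (LINT x|lborel. (g x \<bullet> v) * \<phi> x)"
proof -
  have l: "locint u" "locint g" using w by (auto simp: wgrad_def)
  have "(LINT x|lborel. u x * frechet_derivative \<phi> (at x) v)
      = (LINT x|lborel. (\<Sum>b\<in>Basis. (v \<bullet> b) * (u x * frechet_derivative \<phi> (at x) b)))"
    by (subst frechet_expand[OF \<phi>]) (simp add: sum_distrib_left mult_ac)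
  also have "\<dots> = (\<Sum>b\<in>Basis. (v \<bullet> b) * (LINT x|lborel. u x * frechet_derivative \<phi> (at x) b))"
    using locint_mult_test(2)[OF l(1) \<phi>] by simp
  also have "\<dots> = - (\<Sum>b\<in>Basis. (v \<bullet> b) * (LINT x|lborel. (g x \<bullet> b) * \<phi> x))"
    using w \<phi> by (simp add: wgrad_def sum_negf)
  also have "(\<Sum>b\<in>Basis. (v \<bullet> b) * (LINT x|lborel. (g x \<bullet> b) * \<phi> x))
      = (LINT x|lborel. (\<Sum>b\<in>Basis. (v \<bullet> b) * ((g x \<bullet> b) * \<phi> x)))"
    using locint_mult_test(1)[OF locint_inner[OF l(2)] \<phi>] by simp
  also have "\<dots> = (LINT x|lborel. (g x \<bullet> v) * \<phi> x)"
    by (simp add: euclidean_inner[where x="g x" and y=v for x] sum_distrib_right sum_distrib_left mult_ac)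
  finally show ?thesis .
qed

lemma shear_integrable:
  fixes k :: "'a::euclidean_space \<Rightarrow> real" and h :: "real \<Rightarrow> 'a \<Rightarrow> real"
  assumes k: "integrable lborel k" and [measurable]: "case_prod h \<in> borel_measurable (borel \<Otimes>\<^sub>M borel)"
    and le: "\<And>s y. \<bar>h s y\<bar> \<le> \<bar>k (y + s *\<^sub>R v)\<bar>"
  shows "integrable (lborel \<Otimes>\<^sub>M lborel) (\<lambda>(s, y). indicator {0..1} s * h s y)"
proof -
  have [measurable]: "k \<in> borel_measurable borel" using borel_measurable_integrable[OF k] by simp
  have ik: "integrable lborel (\<lambda>y. \<bar>k (y + s *\<^sub>R v)\<bar>)" for s
    using lborel_integrable_shift[OF k] by (intro integrable_abs)
  have "integrable (lborel \<Otimes>\<^sub>M lborel) (\<lambda>(s, y). indicator {0..1::real} s * \<bar>k (y + s *\<^sub>R v)\<bar>)"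
  proof (rule lborel_pair.Fubini_integrable)
    have "(LINT y|lborel. \<bar>k (y + s *\<^sub>R v)\<bar>) = (LINT y|lborel. \<bar>k y\<bar>)" for s
      by (rule lborel_integral_shift[of "\<lambda>y. \<bar>k y\<bar>"]) simp
    then show "integrable lborel (\<lambda>x. LINT y|lborel. norm (case (x, y) of (s, y) \<Rightarrow> indicator {0..1::real} s * \<bar>k (y + s *\<^sub>R v)\<bar>))"
      by (simp add: abs_mult)
    show "AE x in lborel. integrable lborel (\<lambda>y. case (x, y) of (s, y) \<Rightarrow> indicator {0..1::real} s * \<bar>k (y + s *\<^sub>R v)\<bar>)"
      using ik by (auto intro!: AE_I2)
  qed measurable
  then show ?thesis
    by (rule Bochner_Integration.integrable_bound)
       (use le in \<open>auto simp: indicator_def intro!: AE_I2\<close>)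
qed

text \<open>Tested against a bump, an increment of \<open>f\<close> becomes an increment of the bump, to which the
  fundamental theorem of calculus applies. The weak gradient equation moves the derivative back,
  and the fundamental lemma removes the bump.\<close>

lemma increment_formula:
  fixes f :: "'a::euclidean_space \<Rightarrow> real"
  assumes w: "wgrad f g" and f: "integrable lborel f" and g: "integrable lborel g"
  shows "AE y in lborel. f (y + v) - f y = (LINT s|lborel. indicator {0..1} s * (g (y + s *\<^sub>R v) \<bullet> v))"
    and "integrable lborel (\<lambda>y. LINT s|lborel. indicator {0..1} s * (g (y + s *\<^sub>R v) \<bullet> v))"
proof -
  note [measurable] = borel_measurable_integrable[OF f, simplified] borel_measurable_integrable[OF g, simplified]
  define gv where "gv y = g y \<bullet> v" for y
  have gv: "integrable lborel gv" unfolding gv_def using g by simp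
  have [measurable]: "gv \<in> borel_measurable borel" unfolding gv_def by measurable
  define I where "I y = (LINT s|lborel. indicator {0..1} s * gv (y + s *\<^sub>R v))" for y
  have "integrable (lborel \<Otimes>\<^sub>M lborel) (\<lambda>(s, y). indicator {0..1} s * gv (y + s *\<^sub>R v))"
    by (rule shear_integrable[OF gv]) auto
  then have I: "integrable lborel I" unfolding I_def by (rule lborel_pair.integrable_snd)
  then show "integrable lborel (\<lambda>y. LINT s|lborel. indicator {0..1} s * (g (y + s *\<^sub>R v) \<bullet> v))"
    by (simp add: I_def[abs_def] gv_def)
  have "AE y in lborel. (f (y + v) - f y) - I y = 0"
  proof (rule fundamental_lemma)
    have i: "integrable lborel (\<lambda>y. (f (y + v) - f y) - I y)"
      using f I lborel_integrable_shift[OF f] by auto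
    then show "locint (\<lambda>y. (f (y + v) - f y) - I y)" by (rule integrable_imp_locint)
    fix \<phi> :: "'a \<Rightarrow> real" assume \<phi>: "test_function \<phi>"
    note [measurable] = test_function_measurable[OF \<phi>]
    obtain B where B: "B > 0" "\<And>x. \<bar>\<phi> x\<bar> \<le> B" "\<And>x. \<bar>frechet_derivative \<phi> (at x) v\<bar> \<le> B"
      using test_function_bounded[OF \<phi>] by metis
    have i1: "integrable (lborel \<Otimes>\<^sub>M lborel) (\<lambda>(s, y). indicator {0..1} s * (gv (y + s *\<^sub>R v) * \<phi> y))"
      by (rule shear_integrable[where k="\<lambda>y. B * gv y"])
         (use gv B in \<open>auto simp: abs_mult mult.commute[of B] intro!: mult_left_mono\<close>)
    have i2: "integrable (lborel \<Otimes>\<^sub>M lborel)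
        (\<lambda>(s, y). indicator {0..1} s * (f y * frechet_derivative \<phi> (at (y - s *\<^sub>R v)) v))"
    proof (rule shear_integrable[where k="\<lambda>y. B * f y" and v=0])
      have "(\<lambda>p::real \<times> 'a. frechet_derivative \<phi> (at (snd p - fst p *\<^sub>R v)) v) \<in> borel_measurable (borel \<Otimes>\<^sub>M borel)"
        by (rule measurable_compose[OF _ test_function_measurable(2)[OF \<phi>]]) measurable
      then show "(\<lambda>(s, y). f y * frechet_derivative \<phi> (at (y - s *\<^sub>R v)) v) \<in> borel_measurable (borel \<Otimes>\<^sub>M borel)"
        by (simp add: split_beta')
    qed (use f B in \<open>auto simp: abs_mult mult.commute[of B] intro!: mult_left_mono\<close>)
    have "(LINT y|lborel. I y * \<phi> y) = (LINT y|lborel. LINT s|lborel. indicator {0..1} s * (gv (y + s *\<^sub>R v) * \<phi> y))"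
      unfolding I_def by (simp add: mult.assoc flip: integral_mult_left_zero)
    also have "\<dots> = (LINT s|lborel. LINT y|lborel. indicator {0..1} s * (gv (y + s *\<^sub>R v) * \<phi> y))"
      by (rule lborel_pair.Fubini_integral[OF i1])
    also have "\<dots> = (LINT s|lborel. - (LINT y|lborel. indicator {0..1} s * (f y * frechet_derivative \<phi> (at (y - s *\<^sub>R v)) v)))"
    proof (intro Bochner_Integration.integral_cong refl)
      fix s :: real
      have "(LINT y|lborel. gv (y + s *\<^sub>R v) * \<phi> y) = (LINT y|lborel. gv y * \<phi> (y - s *\<^sub>R v))"
        using lborel_integral_shift[of "\<lambda>y. gv y * \<phi> (y - s *\<^sub>R v)" "s *\<^sub>R v"] by simp
      also have "\<dots> = - (LINT y|lborel. f y * frechet_derivative (\<lambda>x. \<phi> (x - s *\<^sub>R v)) (at y) v)"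
        using wgrad_direction[OF w test_function_shift[OF \<phi>], of "s *\<^sub>R v" v] by (simp add: gv_def)
      also have "\<dots> = - (LINT y|lborel. f y * frechet_derivative \<phi> (at (y - s *\<^sub>R v)) v)"
        using \<phi> test_function_differentiable[OF \<phi>]
        by (subst frechet_derivative_shift) (auto simp: differentiable_on_def differentiable_def)
      finally show "(LINT y|lborel. indicator {0..1} s * (gv (y + s *\<^sub>R v) * \<phi> y))
         = - (LINT y|lborel. indicator {0..1} s * (f y * frechet_derivative \<phi> (at (y - s *\<^sub>R v)) v))"
        by simp
    qed
    also have "\<dots> = - (LINT y|lborel. LINT s|lborel. indicator {0..1} s * (f y * frechet_derivative \<phi> (at (y - s *\<^sub>R v)) v))"
      using lborel_pair.Fubini_integral[OF i2] by simp
    also have "\<dots> = (LINT y|lborel. f y * (\<phi> (y - v) - \<phi> y))"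
    proof (subst Bochner_Integration.integral_minus[symmetric], intro Bochner_Integration.integral_cong refl)
      fix y
      have "(LINT s|lborel. (- frechet_derivative \<phi> (at (y - s *\<^sub>R v)) v) * indicator {0..1} s)
          = \<phi> (y + 1 *\<^sub>R (- v)) - \<phi> (y + 0 *\<^sub>R (- v))"
      proof (rule integral_FTC_Icc_real)
        fix s :: real
        interpret linear "frechet_derivative \<phi> (at (y - s *\<^sub>R v))"
          using test_function_differentiable[OF \<phi>] has_derivative_linear by blast
        show "DERIV (\<lambda>t. \<phi> (y + t *\<^sub>R - v)) s :> - frechet_derivative \<phi> (at (y - s *\<^sub>R v)) v"
          using test_function_DERIV[OF \<phi>, of y "- v" s] by (simp add: neg)
        have "continuous_on UNIV (\<lambda>s. - frechet_derivative \<phi> (at (y - s *\<^sub>R v)) v)"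
          by (intro continuous_intros continuous_on_compose2[OF test_function_derivative_continuous[OF \<phi>, of UNIV]]) auto
        then show "isCont (\<lambda>s. - frechet_derivative \<phi> (at (y - s *\<^sub>R v)) v) s"
          by (simp add: continuous_on_eq_continuous_at)
      qed simp
      moreover have "(LINT s|lborel. indicator {0..1} s * (f y * frechet_derivative \<phi> (at (y - s *\<^sub>R v)) v))
          = - (f y * (LINT s|lborel. (- frechet_derivative \<phi> (at (y - s *\<^sub>R v)) v) * indicator {0..1} s))"
        by (simp add: mult_ac flip: integral_mult_right_zero)
      ultimately show "- (LINT s|lborel. indicator {0..1} s * (f y * frechet_derivative \<phi> (at (y - s *\<^sub>R v)) v))
         = f y * (\<phi> (y - v) - \<phi> y)" by simp
    qed
    also have "\<dots> = (LINT y|lborel. f y * \<phi> (y - v)) - (LINT y|lborel. f y * \<phi> y)"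
      using locint_mult_test(1)[OF integrable_imp_locint[OF f] \<phi>]
        locint_mult_test(1)[OF integrable_imp_locint[OF f] test_function_shift[OF \<phi>], of v]
      by (simp add: right_diff_distrib)
    also have "(LINT y|lborel. f y * \<phi> (y - v)) = (LINT y|lborel. f (y + v) * \<phi> y)"
      using lborel_integral_shift[of "\<lambda>y. f y * \<phi> (y - v)" v] by simp
    finally have "(LINT y|lborel. I y * \<phi> y) = (LINT y|lborel. f (y + v) * \<phi> y) - (LINT y|lborel. f y * \<phi> y)" .
    then show "(LINT y|lborel. ((f (y + v) - f y) - I y) * \<phi> y) = 0"
      using locint_mult_test(1)[OF integrable_imp_locint[OF f] \<phi>] locint_mult_test(1)[OF integrable_imp_locint[OF I] \<phi>]
        locint_mult_test(1)[OF integrable_imp_locint[OF lborel_integrable_shift[OF f, of v]] \<phi>]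
      by (simp add: left_diff_distrib)
  qed
  then show "AE y in lborel. f (y + v) - f y = (LINT s|lborel. indicator {0..1} s * (g (y + s *\<^sub>R v) \<bullet> v))"
    by (auto simp: I_def gv_def)
qed

lemma increment_integral:
  fixes f :: "'a::euclidean_space \<Rightarrow> real"
  assumes w: "wgrad f g" and f: "integrable lborel f" and g: "integrable lborel g"
    and [measurable]: "\<psi> \<in> borel_measurable borel" and B: "\<And>x. \<bar>\<psi> x\<bar> \<le> B"
  shows "(LINT y|lborel. (f (y + v) - f y) * \<psi> y)
    = (LINT s|lborel. indicator {0..1} s * (LINT y|lborel. (g (y + s *\<^sub>R v) \<bullet> v) * \<psi> y))"
proof -
  note [measurable] = borel_measurable_integrable[OF f, simplified] borel_measurable_integrable[OF g, simplified]
  have "B \<ge> 0" using B[of 0] by linarith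
  have i: "integrable (lborel \<Otimes>\<^sub>M lborel) (\<lambda>(s, y). indicator {0..1} s * ((g (y + s *\<^sub>R v) \<bullet> v) * \<psi> y))"
    by (rule shear_integrable[where k="\<lambda>y. B * (g y \<bullet> v)"])
       (use g B \<open>B \<ge> 0\<close> in \<open>auto simp: abs_mult mult.commute[of B] intro!: mult_left_mono\<close>)
  note m = borel_measurable_integrable[OF increment_formula(2)[OF w f g], simplified]
  have "(LINT y|lborel. (f (y + v) - f y) * \<psi> y)
      = (LINT y|lborel. (LINT s|lborel. indicator {0..1} s * (g (y + s *\<^sub>R v) \<bullet> v)) * \<psi> y)"
    using increment_formula(1)[OF w f g, of v] m by (intro integral_cong_AE) auto
  also have "\<dots> = (LINT y|lborel. LINT s|lborel. indicator {0..1} s * ((g (y + s *\<^sub>R v) \<bullet> v) * \<psi> y))"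
    by (simp add: mult.assoc flip: integral_mult_left_zero)
  also have "\<dots> = (LINT s|lborel. LINT y|lborel. indicator {0..1} s * ((g (y + s *\<^sub>R v) \<bullet> v) * \<psi> y))"
    by (rule lborel_pair.Fubini_integral[OF i])
  finally show ?thesis by simp
qed

lemma test_function_difference_quotient:
  fixes u :: "'a::euclidean_space \<Rightarrow> real"
  assumes u: "locint u" and \<phi>: "test_function \<phi>"
  shows "(\<lambda>n. LINT y|lborel. u y * (real (Suc n) * (\<phi> (y - (1 / real (Suc n)) *\<^sub>R v) - \<phi> y)))
    \<longlonglongrightarrow> - (LINT y|lborel. u y * frechet_derivative \<phi> (at y) v)"
proof -
  note [measurable] = test_function_measurable[OF \<phi>] locint_measurable[OF u]
  obtain B where B: "B > 0" "\<And>x. \<bar>frechet_derivative \<phi> (at x) v\<bar> \<le> B"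
    using test_function_bounded[OF \<phi>] by metis
  obtain R where R: "R > 0" "\<And>x. norm x \<ge> R \<Longrightarrow> \<phi> x = 0" using test_function_support[OF \<phi>] by metis
  have D: "DERIV (\<lambda>t. \<phi> (y - t *\<^sub>R v)) t :> - frechet_derivative \<phi> (at (y - t *\<^sub>R v)) v" for y t
  proof -
    interpret linear "frechet_derivative \<phi> (at (y - t *\<^sub>R v))"
      using test_function_differentiable[OF \<phi>] has_derivative_linear by blast
    show ?thesis using test_function_DERIV[OF \<phi>, of y "- v" t] by (simp add: neg)
  qed
  let ?q = "\<lambda>n y. real (Suc n) * (\<phi> (y - (1 / real (Suc n)) *\<^sub>R v) - \<phi> y)"
  have bd: "\<bar>?q n y\<bar> \<le> B * indicator (cball 0 (R + norm v)) y" for n y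
  proof (cases "norm y \<le> R + norm v")
    case True
    have "\<bar>\<phi> (y - a *\<^sub>R v) - \<phi> (y - b *\<^sub>R v)\<bar> \<le> B * \<bar>a - b\<bar>" for a b
      using field_differentiable_bound[of UNIV "\<lambda>t. \<phi> (y - t *\<^sub>R v)" "\<lambda>t. - frechet_derivative \<phi> (at (y - t *\<^sub>R v)) v" B] D B
      by auto
    from this[of "1 / real (Suc n)" 0] have "real (Suc n) * \<bar>\<phi> (y - (1 / real (Suc n)) *\<^sub>R v) - \<phi> y\<bar> \<le> real (Suc n) * (B * (1 / real (Suc n)))"
      by (intro mult_left_mono) (auto simp del: of_nat_Suc)
    then show ?thesis using True by (simp add: abs_mult)
  next
    case False
    have "norm ((1 / real (Suc n)) *\<^sub>R v) \<le> norm v"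
      by (simp add: field_simps mult_left_le_one_le)
    then have "norm (y - (1 / real (Suc n)) *\<^sub>R v) \<ge> R"
      using False norm_triangle_ineq2[of y "(1 / real (Suc n)) *\<^sub>R v"] by linarith
    moreover have "norm y \<ge> R" using False norm_ge_zero[of v] by linarith
    ultimately show ?thesis using R B by simp
  qed
  have "(\<lambda>n. LINT y|lborel. u y * ?q n y) \<longlonglongrightarrow> (LINT y|lborel. u y * (- frechet_derivative \<phi> (at y) v))"
  proof (rule integral_dominated_convergence[where w="\<lambda>y. B * \<bar>indicator (cball 0 (R + norm v)) y *\<^sub>R u y\<bar>"])
    show "integrable lborel (\<lambda>y. B * \<bar>indicator (cball 0 (R + norm v)) y *\<^sub>R u y\<bar>)"
      using u unfolding locint_def by (intro integrable_mult_right integrable_abs) blast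
    show "AE y in lborel. (\<lambda>n. u y * ?q n y) \<longlonglongrightarrow> u y * (- frechet_derivative \<phi> (at y) v)"
    proof (intro AE_I2 tendsto_mult tendsto_const)
      fix y
      have lim0: "filterlim (\<lambda>n. 1 / real (Suc n)) (at 0) sequentially"
        unfolding filterlim_at using LIMSEQ_Suc[OF lim_1_over_n[where 'a=real]] by auto
      have "((\<lambda>h. (\<phi> (y - h *\<^sub>R v) - \<phi> y) / h) \<longlongrightarrow> - frechet_derivative \<phi> (at y) v) (at 0)"
        using D[of y 0] by (simp add: DERIV_def)
      from filterlim_compose[OF this lim0]
      show "(\<lambda>n. ?q n y) \<longlonglongrightarrow> - frechet_derivative \<phi> (at y) v"
        by (simp add: mult.commute)
    qed
    show "AE y in lborel. norm (u y * ?q n y) \<le> B * \<bar>indicator (cball 0 (R + norm v)) y *\<^sub>R u y\<bar>" for n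
    proof (intro AE_I2)
      fix y
      have "\<bar>u y\<bar> * \<bar>?q n y\<bar> \<le> \<bar>u y\<bar> * (B * indicator (cball 0 (R + norm v)) y)"
        by (intro mult_left_mono bd) auto
      then show "norm (u y * ?q n y) \<le> B * \<bar>indicator (cball 0 (R + norm v)) y *\<^sub>R u y\<bar>"
        by (simp add: abs_mult mult_ac)
    qed
  qed measurable
  then show ?thesis by simp
qed

text \<open>If \<open>s\<close> is a subgradient of the absolute value along \<open>f\<close>, then the increments of \<open>\<bar>f\<bar>\<close>
  dominate \<open>s\<close> times those of \<open>f\<close>. Dividing by the step and passing to the limit gives an
  inequality in every direction; the opposite direction turns it into an equality.\<close>

lemma wgrad_abs:
  fixes f s :: "'a::euclidean_space \<Rightarrow> real"
  assumes w: "wgrad f g" and f: "integrable lborel f" and g: "integrable lborel g"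
    and [measurable]: "s \<in> borel_measurable borel" and s1: "\<And>x. \<bar>s x\<bar> \<le> 1" and sf: "\<And>x. s x * f x = \<bar>f x\<bar>"
  shows "wgrad (\<lambda>x. \<bar>f x\<bar>) (\<lambda>x. s x *\<^sub>R g x)" "integrable lborel (\<lambda>x. s x *\<^sub>R g x)"
proof -
  note [measurable] = borel_measurable_integrable[OF f, simplified] borel_measurable_integrable[OF g, simplified]
  show sg: "integrable lborel (\<lambda>x. s x *\<^sub>R g x)"
    by (rule Bochner_Integration.integrable_bound[OF g])
       (use s1 in \<open>auto intro!: AE_I2 mult_left_le_one_le\<close>)
  have la: "locint (\<lambda>x. \<bar>f x\<bar>)" using f by (intro integrable_imp_locint) auto
  have ineq: "(LINT y|lborel. (s y *\<^sub>R g y \<bullet> v) * \<phi> y) \<le> - (LINT y|lborel. \<bar>f y\<bar> * frechet_derivative \<phi> (at y) v)"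
    if \<phi>: "test_function \<phi>" and pos: "\<And>x. 0 \<le> \<phi> x" for \<phi> v
  proof (rule LIMSEQ_le[rotated, OF test_function_difference_quotient[OF la \<phi>, of v]])
    note [measurable] = test_function_measurable[OF \<phi>]
    obtain B where B: "B > 0" "\<And>x. \<bar>\<phi> x\<bar> \<le> B" using test_function_bounded[OF \<phi>] by metis
    define gv where "gv y = g y \<bullet> v" for y
    have gv: "integrable lborel gv" unfolding gv_def using g by simp
    have [measurable]: "gv \<in> borel_measurable borel" unfolding gv_def by measurable
    have B': "\<bar>s x * \<phi> x\<bar> \<le> B" for x
      using mult_mono[OF s1[of x] B(2)[of x]] by (simp add: abs_mult)
    have mono: "integrable lborel (\<lambda>y. \<psi> y * (s y * \<phi> y))" if "integrable lborel \<psi>" for \<psi>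
      by (rule Bochner_Integration.integrable_bound[OF integrable_mult_right[OF that, of B]])
         (use B' \<open>B > 0\<close> borel_measurable_integrable[OF that] in
          \<open>auto intro!: AE_I2 mult_right_mono simp: abs_mult mult.commute[of "\<bar>\<psi> _\<bar>"]\<close>)
    let ?t = "\<lambda>n. 1 / real (Suc n)"
    let ?b = "\<lambda>n. LINT r|lborel. indicator {0..1} r * (LINT y|lborel. gv (y + r *\<^sub>R (?t n *\<^sub>R v)) * (s y * \<phi> y))"
    have "?b \<longlonglongrightarrow> (LINT r|lborel. indicator {0..1::real} r * (LINT y|lborel. gv y * (s y * \<phi> y)))"
    proof (rule integral_dominated_convergence[where w="\<lambda>r. indicator {0..1} r * (B * (LINT y|lborel. \<bar>gv y\<bar>))"])
      show "AE r in lborel. (\<lambda>n. indicator {0..1} r * (LINT y|lborel. gv (y + r *\<^sub>R (?t n *\<^sub>R v)) * (s y * \<phi> y)))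
         \<longlonglongrightarrow> indicator {0..1::real} r * (LINT y|lborel. gv y * (s y * \<phi> y))"
      proof (intro AE_I2 tendsto_mult tendsto_const)
        fix r :: real
        have v0: "(\<lambda>n. r *\<^sub>R (?t n *\<^sub>R v)) \<longlonglongrightarrow> 0"
          using tendsto_scaleR[OF tendsto_const[of r] tendsto_scaleR[OF LIMSEQ_Suc[OF lim_1_over_n[where 'a=real]] tendsto_const[of v]]]
          by simp
        have "(\<lambda>n. B * (LINT y|lborel. \<bar>gv (y + r *\<^sub>R (?t n *\<^sub>R v)) - gv y\<bar>)) \<longlonglongrightarrow> B * 0"
          by (intro tendsto_intros translation_L1 gv v0)
        then have "(\<lambda>n. B * (LINT y|lborel. \<bar>gv (y + r *\<^sub>R (?t n *\<^sub>R v)) - gv y\<bar>)) \<longlonglongrightarrow> 0" by simp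
        note lim0 = this
        have "(\<lambda>n. (LINT y|lborel. gv (y + r *\<^sub>R (?t n *\<^sub>R v)) * (s y * \<phi> y)) - (LINT y|lborel. gv y * (s y * \<phi> y))) \<longlonglongrightarrow> 0"
        proof (rule Lim_null_comparison[OF always_eventually[OF allI] lim0])
          fix n
          let ?w = "r *\<^sub>R (?t n *\<^sub>R v)"
          have d: "integrable lborel (\<lambda>y. gv (y + ?w) - gv y)"
            using gv lborel_integrable_shift[OF gv] by auto
          have "\<bar>(LINT y|lborel. gv (y + ?w) * (s y * \<phi> y)) - (LINT y|lborel. gv y * (s y * \<phi> y))\<bar>
             = \<bar>LINT y|lborel. (gv (y + ?w) - gv y) * (s y * \<phi> y)\<bar>"
            using mono[OF gv] mono[OF lborel_integrable_shift[OF gv, of ?w]] by (simp add: left_diff_distrib)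
          also have "\<dots> \<le> (LINT y|lborel. \<bar>(gv (y + ?w) - gv y) * (s y * \<phi> y)\<bar>)"
            by (rule integral_abs_bound)
          also have "\<dots> \<le> (LINT y|lborel. B * \<bar>gv (y + ?w) - gv y\<bar>)"
            using B' by (intro integral_mono integrable_abs integrable_mult_right d mono[OF d]) (auto simp: abs_mult mult.commute[of B] intro!: mult_left_mono)
          finally show "norm ((LINT y|lborel. gv (y + ?w) * (s y * \<phi> y)) - (LINT y|lborel. gv y * (s y * \<phi> y)))
            \<le> B * (LINT y|lborel. \<bar>gv (y + ?w) - gv y\<bar>)" by simp
        qed
        then show "(\<lambda>n. LINT y|lborel. gv (y + r *\<^sub>R (?t n *\<^sub>R v)) * (s y * \<phi> y)) \<longlonglongrightarrow> (LINT y|lborel. gv y * (s y * \<phi> y))"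
          by (simp add: LIM_zero_iff)
      qed
      show "AE r in lborel. norm (indicator {0..1} r * (LINT y|lborel. gv (y + r *\<^sub>R (?t n *\<^sub>R v)) * (s y * \<phi> y)))
         \<le> indicator {0..1::real} r * (B * (LINT y|lborel. \<bar>gv y\<bar>))" for n
      proof (intro AE_I2)
        fix r :: real
        let ?w = "r *\<^sub>R (?t n *\<^sub>R v)"
        have "\<bar>LINT y|lborel. gv (y + ?w) * (s y * \<phi> y)\<bar> \<le> (LINT y|lborel. \<bar>gv (y + ?w) * (s y * \<phi> y)\<bar>)"
          by (rule integral_abs_bound)
        also have "\<dots> \<le> (LINT y|lborel. B * \<bar>gv (y + ?w)\<bar>)"
          using B' by (intro integral_mono integrable_abs integrable_mult_right lborel_integrable_shift[OF gv]
              mono[OF lborel_integrable_shift[OF gv]]) (auto simp: abs_mult mult.commute[of B] intro!: mult_left_mono)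
        also have "\<dots> = B * (LINT y|lborel. \<bar>gv y\<bar>)"
          using lborel_integral_shift[of "\<lambda>y. \<bar>gv y\<bar>" ?w] by simp
        finally show "norm (indicator {0..1} r * (LINT y|lborel. gv (y + ?w) * (s y * \<phi> y)))
         \<le> indicator {0..1::real} r * (B * (LINT y|lborel. \<bar>gv y\<bar>))" by (auto simp: indicator_def)
      qed
    qed measurable
    then show "?b \<longlonglongrightarrow> (LINT y|lborel. (s y *\<^sub>R g y \<bullet> v) * \<phi> y)"
      by (simp add: gv_def mult_ac)
    show "\<exists>N. \<forall>n\<ge>N. ?b n \<le> (LINT y|lborel. \<bar>f y\<bar> * (real (Suc n) * (\<phi> (y - ?t n *\<^sub>R v) - \<phi> y)))"
    proof (intro exI allI impI)
      fix n :: nat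
      let ?w = "?t n *\<^sub>R v"
      have f': "integrable lborel (\<lambda>y. f (y + ?w))" "integrable lborel (\<lambda>y. f (y + ?w) - f y)"
        using f lborel_integrable_shift[OF f] by auto
      note la' = integrable_imp_locint[OF integrable_abs[OF f'(1)]]
      have "(LINT y|lborel. \<bar>f y\<bar> * (\<phi> (y - ?w) - \<phi> y)) = (LINT y|lborel. \<bar>f y\<bar> * \<phi> (y - ?w)) - (LINT y|lborel. \<bar>f y\<bar> * \<phi> y)"
        using locint_mult_test(1)[OF la \<phi>] locint_mult_test(1)[OF la test_function_shift[OF \<phi>], of ?w]
        by (simp add: right_diff_distrib)
      also have "(LINT y|lborel. \<bar>f y\<bar> * \<phi> (y - ?w)) = (LINT y|lborel. \<bar>f (y + ?w)\<bar> * \<phi> y)"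
        using lborel_integral_shift[of "\<lambda>y. \<bar>f y\<bar> * \<phi> (y - ?w)" ?w] by simp
      also have "(LINT y|lborel. \<bar>f (y + ?w)\<bar> * \<phi> y) - (LINT y|lborel. \<bar>f y\<bar> * \<phi> y)
          = (LINT y|lborel. (\<bar>f (y + ?w)\<bar> - \<bar>f y\<bar>) * \<phi> y)"
        using locint_mult_test(1)[OF la \<phi>] locint_mult_test(1)[OF la' \<phi>] by (simp add: left_diff_distrib)
      also have "\<dots> \<ge> (LINT y|lborel. (f (y + ?w) - f y) * (s y * \<phi> y))"
      proof (rule integral_mono)
        show "integrable lborel (\<lambda>y. (\<bar>f (y + ?w)\<bar> - \<bar>f y\<bar>) * \<phi> y)"
          using locint_mult_test(1)[OF la \<phi>] locint_mult_test(1)[OF la' \<phi>] by (simp add: left_diff_distrib)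
        fix y
        have "s y * f (y + ?w) \<le> \<bar>f (y + ?w)\<bar>"
          using mult_right_mono[OF s1[of y], of "\<bar>f (y + ?w)\<bar>"] by (simp add: abs_mult[symmetric])
        then have "(s y * f (y + ?w) - s y * f y) * \<phi> y \<le> (\<bar>f (y + ?w)\<bar> - \<bar>f y\<bar>) * \<phi> y"
          using pos[of y] sf[of y] by (intro mult_right_mono) auto
        then show "(f (y + ?w) - f y) * (s y * \<phi> y) \<le> (\<bar>f (y + ?w)\<bar> - \<bar>f y\<bar>) * \<phi> y"
          by (simp add: algebra_simps)
      qed (rule mono[OF f'(2)])
      also have "(LINT y|lborel. (f (y + ?w) - f y) * (s y * \<phi> y))
         = (LINT r|lborel. indicator {0..1} r * (LINT y|lborel. (g (y + r *\<^sub>R ?w) \<bullet> ?w) * (s y * \<phi> y)))"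
        by (rule increment_integral[OF w f g _ B']) measurable
      also have "\<dots> = ?t n * ?b n"
        by (simp add: gv_def mult_ac flip: integral_mult_right_zero)
      finally have "real (Suc n) * (?t n * ?b n) \<le> real (Suc n) * (LINT y|lborel. \<bar>f y\<bar> * (\<phi> (y - ?w) - \<phi> y))"
        by (intro mult_left_mono) auto
      then show "?b n \<le> (LINT y|lborel. \<bar>f y\<bar> * (real (Suc n) * (\<phi> (y - ?w) - \<phi> y)))"
        by (simp add: mult.left_commute[of "\<bar>f _\<bar>"] del: of_nat_Suc)
    qed
  qed
  show "wgrad (\<lambda>x. \<bar>f x\<bar>) (\<lambda>x. s x *\<^sub>R g x)"
  proof (rule wgradI_nonneg[OF la integrable_imp_locint[OF sg]])
    fix \<phi> :: "'a \<Rightarrow> real" and e :: 'a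
    assume \<phi>: "test_function \<phi>" and pos: "\<And>x. 0 \<le> \<phi> x" and "e \<in> Basis"
    have "frechet_derivative \<phi> (at y) (- e) = - frechet_derivative \<phi> (at y) e" for y
      using has_derivative_linear[OF test_function_differentiable[OF \<phi>, of y]] by (rule linear_neg)
    then show "(LINT y|lborel. \<bar>f y\<bar> * frechet_derivative \<phi> (at y) e) = - (LINT y|lborel. (s y *\<^sub>R g y \<bullet> e) * \<phi> y)"
      using ineq[OF \<phi> pos, of e] ineq[OF \<phi> pos, of "- e"] by simp
  qed
qed

text \<open>On the zero set every number in \<open>[-1, 1]\<close> is a subgradient of the absolute value. Two different
  choices give two weak gradients of \<open>\<bar>f\<bar>\<close>, and these agree almost everywhere.\<close>

lemma wgrad_zero_on_zero_set:
  fixes f :: "'a::euclidean_space \<Rightarrow> real"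
  assumes w: "wgrad f g" and f: "integrable lborel f" and g: "integrable lborel g"
  shows "AE x in lborel. f x = 0 \<longrightarrow> g x = 0"
proof -
  note [measurable] = borel_measurable_integrable[OF f, simplified]
  have "wgrad (\<lambda>x. \<bar>f x\<bar>) (\<lambda>x. sgn (f x) *\<^sub>R g x)"
    by (rule wgrad_abs[OF w f g]) (auto simp: sgn_if)
  moreover have "wgrad (\<lambda>x. \<bar>f x\<bar>) (\<lambda>x. (if f x = 0 then 1 else sgn (f x)) *\<^sub>R g x)"
    by (rule wgrad_abs[OF w f g]) (auto simp: sgn_if)
  ultimately have "AE x in lborel. sgn (f x) *\<^sub>R g x = (if f x = 0 then 1 else sgn (f x)) *\<^sub>R g x"
    by (rule wgrad_unique) simp
  then show ?thesis by eventually_elim auto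
qed

section \<open>Fractional averages over balls\<close>

text \<open>With a nonnegative function this is the average in the maximal operator; with a component
  of a gradient it is a partial derivative of such an average.\<close>

definition frac_mean :: "real \<Rightarrow> ('a::euclidean_space \<Rightarrow> real) \<Rightarrow> real \<Rightarrow> 'a \<Rightarrow> real" where
  "frac_mean \<beta> f r x = r powr (\<beta> - DIM('a)) / unit_ball_vol DIM('a)
     * (LINT y|lborel. indicator (ball x r) y * f y)"

lemma unit_ball_vol_nonzero [simp]: "unit_ball_vol (real n) \<noteq> 0"
  using unit_ball_vol_pos[of "real n"] by linarith

lemma ball_in_borel [measurable]: "ball x r \<in> sets borel"
  by simp

lemma cball_in_borel [measurable]: "cball x r \<in> sets borel"
  by simp

lemma ball_mult_integrable:
  fixes f :: "'a::euclidean_space \<Rightarrow> real"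
  assumes "integrable lborel f" "S \<in> sets borel" 
  shows "integrable lborel (\<lambda>y. indicator S y * f y)"
  using integrable_mult_indicator[OF _ assms(1), of S] assms(2) by simp

lemma ball_integral_tendsto:
  fixes f :: "'a::euclidean_space \<Rightarrow> real"
  assumes f: "integrable lborel f" and r: "r \<longlonglongrightarrow> r0" and x: "x \<longlonglongrightarrow> x0"
  shows "(\<lambda>n. LINT y|lborel. indicator (ball (x n) (r n)) y * f y)
    \<longlonglongrightarrow> (LINT y|lborel. indicator (ball x0 r0) y * f y)"
proof (rule integral_dominated_convergence[where w="\<lambda>y. \<bar>f y\<bar>"])
  have [measurable]: "f \<in> borel_measurable borel" using borel_measurable_integrable[OF f] by simp
  show "(\<lambda>y. indicator (ball (x n) (r n)) y * f y) \<in> borel_measurable lborel" for n by measurable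
  show "(\<lambda>y. indicator (ball x0 r0) y * f y) \<in> borel_measurable lborel" by measurable
  have "sphere x0 r0 \<in> null_sets lborel"
    using negligible_sphere[of x0 r0] by (auto simp: negligible_iff_null_sets null_sets_completion_iff)
  then have "AE y in lborel. y \<notin> sphere x0 r0" by (rule AE_not_in)
  then show "AE y in lborel. (\<lambda>n. indicator (ball (x n) (r n)) y * f y) \<longlonglongrightarrow> indicator (ball x0 r0) y * f y"
  proof eventually_elim
    fix y assume y: "y \<notin> sphere x0 r0"
    have lim: "(\<lambda>n. r n - dist (x n) y) \<longlonglongrightarrow> r0 - dist x0 y" by (intro tendsto_intros r x)
    have "\<forall>\<^sub>F n in sequentially. indicator (ball (x n) (r n)) y = (indicator (ball x0 r0) y :: real)"
    proof (cases "dist x0 y < r0")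
      case True
      then have "\<forall>\<^sub>F n in sequentially. 0 < r n - dist (x n) y" using lim by (intro order_tendstoD) auto
      then show ?thesis by eventually_elim (use True in auto)
    next
      case False
      then have "\<forall>\<^sub>F n in sequentially. r n - dist (x n) y < 0" using lim y by (intro order_tendstoD) auto
      then show ?thesis by eventually_elim (use False in auto)
    qed
    then show "(\<lambda>n. indicator (ball (x n) (r n)) y * f y) \<longlonglongrightarrow> indicator (ball x0 r0) y * f y"
      by (intro tendsto_mult tendsto_const tendsto_eventually)
  qed
qed (use f in \<open>auto simp: indicator_def\<close>)

lemma frac_mean_tendsto:
  fixes f :: "'a::euclidean_space \<Rightarrow> real"
  assumes "integrable lborel f" "r \<longlonglongrightarrow> r0" "x \<longlonglongrightarrow> x0" "r0 > 0"
  shows "(\<lambda>n. frac_mean \<beta> f (r n) (x n)) \<longlonglongrightarrow> frac_mean \<beta> f r0 x0"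
  unfolding frac_mean_def using assms
  by (intro tendsto_mult tendsto_divide tendsto_const ball_integral_tendsto tendsto_powr) auto

lemma frac_mean_continuous_on_x:
  fixes f :: "'a::euclidean_space \<Rightarrow> real"
  assumes "integrable lborel f" "r > 0"
  shows "continuous_on UNIV (frac_mean \<beta> f r)"
  unfolding continuous_on_sequentially using assms by (auto intro!: frac_mean_tendsto[unfolded o_def] simp: o_def)

lemma frac_mean_continuous_on_r:
  fixes f :: "'a::euclidean_space \<Rightarrow> real"
  assumes "integrable lborel f" "\<And>r. r \<in> K \<Longrightarrow> r > 0"
  shows "continuous_on K (\<lambda>r. frac_mean \<beta> f r x)"
  unfolding continuous_on_sequentially using assms by (auto intro!: frac_mean_tendsto simp: o_def)

lemma frac_mean_nonneg: "(\<And>y. 0 \<le> f y) \<Longrightarrow> 0 \<le> frac_mean \<beta> f r x"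
  unfolding frac_mean_def by (intro mult_nonneg_nonneg divide_nonneg_nonneg integral_nonneg_AE) auto

lemma frac_mean_abs_le:
  fixes f :: "'a::euclidean_space \<Rightarrow> real"
  assumes f: "integrable lborel f"
  shows "\<bar>frac_mean \<beta> f r x\<bar> \<le> r powr (\<beta> - DIM('a)) / unit_ball_vol DIM('a) * (LINT y|lborel. \<bar>f y\<bar>)"
proof -
  have "\<bar>LINT y|lborel. indicator (ball x r) y * f y\<bar> \<le> (LINT y|lborel. \<bar>indicator (ball x r) y * f y\<bar>)"
    by (rule integral_abs_bound)
  also have "\<dots> \<le> (LINT y|lborel. \<bar>f y\<bar>)"
    by (intro integral_mono integrable_abs ball_mult_integrable f) (auto simp: indicator_def)
  finally show ?thesis unfolding frac_mean_def abs_mult by (intro mult_mono) auto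
qed

lemma frac_mean_abs_mono:
  fixes f h :: "'a::euclidean_space \<Rightarrow> real"
  assumes f: "integrable lborel f" and h: "integrable lborel h" and le: "\<And>y. \<bar>f y\<bar> \<le> h y"
  shows "\<bar>frac_mean \<beta> f r x\<bar> \<le> frac_mean \<beta> h r x"
proof -
  have "\<bar>LINT y|lborel. indicator (ball x r) y * f y\<bar> \<le> (LINT y|lborel. \<bar>indicator (ball x r) y * f y\<bar>)"
    by (rule integral_abs_bound)
  also have "\<dots> \<le> (LINT y|lborel. indicator (ball x r) y * h y)"
    using le by (intro integral_mono integrable_abs ball_mult_integrable f h) (auto simp: indicator_def)
  finally show ?thesis unfolding frac_mean_def abs_mult by (intro mult_mono) auto
qed

lemma frac_mean_diff:
  fixes f h :: "'a::euclidean_space \<Rightarrow> real"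
  assumes f: "integrable lborel f" and h: "integrable lborel h"
  shows "frac_mean \<beta> (\<lambda>y. f y - h y) r x = frac_mean \<beta> f r x - frac_mean \<beta> h r x"
  using ball_mult_integrable[OF f, of "ball x r"] ball_mult_integrable[OF h, of "ball x r"]
  by (simp add: frac_mean_def right_diff_distrib)

lemma frac_mean_cmult: "frac_mean \<beta> (\<lambda>y. c * f y) r x = c * frac_mean \<beta> f r x"
  by (simp add: frac_mean_def mult.left_commute[of _ c])

lemma frac_mean_subset_le:
  fixes f :: "'a::euclidean_space \<Rightarrow> real"
  assumes f: "integrable lborel f" and nn: "\<And>y. 0 \<le> f y" and sub: "ball x r \<subseteq> ball z s" and "0 < r" "0 < s"
  shows "frac_mean \<beta> f r x \<le> (r / s) powr (\<beta> - DIM('a)) * frac_mean \<beta> f s z"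
proof -
  have "(LINT y|lborel. indicator (ball x r) y * f y) \<le> (LINT y|lborel. indicator (ball z s) y * f y)"
    using sub nn by (intro integral_mono ball_mult_integrable f) (auto simp: indicator_def)
  then have "frac_mean \<beta> f r x \<le> r powr (\<beta> - DIM('a)) / unit_ball_vol DIM('a) * (LINT y|lborel. indicator (ball z s) y * f y)"
    unfolding frac_mean_def by (intro mult_left_mono) auto
  also have "\<dots> = (r / s) powr (\<beta> - DIM('a)) * frac_mean \<beta> f s z"
    using assms(4,5) by (simp add: frac_mean_def powr_divide)
  finally show ?thesis .
qed

lemma frac_mean_increment:
  fixes F :: "'a::euclidean_space \<Rightarrow> real"
  assumes w: "wgrad F w" and F: "integrable lborel F" and iw: "integrable lborel w"
  shows "frac_mean \<beta> F r (x + v) - frac_mean \<beta> F r x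
    = (LINT s|lborel. indicator {0..1} s * frac_mean \<beta> (\<lambda>y. w y \<bullet> v) r (x + s *\<^sub>R v))"
proof -
  note [measurable] = borel_measurable_integrable[OF F, simplified] borel_measurable_integrable[OF iw, simplified]
  have sh: "(LINT y|lborel. indicator (ball (x + u) r) y * k y) = (LINT y|lborel. k (y + u) * indicator (ball x r) y)"
    if [measurable]: "k \<in> borel_measurable borel" for k :: "'a \<Rightarrow> real" and u
  proof -
    have "(LINT y|lborel. indicator (ball (x + u) r) y * k y) = (LINT y|lborel. indicator (ball (x + u) r) (y + u) * k (y + u))"
      by (rule lborel_integral_shift[symmetric]) measurable
    also have "\<dots> = (LINT y|lborel. k (y + u) * indicator (ball x r) y)"
      by (intro Bochner_Integration.integral_cong) (auto simp: indicator_def dist_norm)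
    finally show ?thesis .
  qed
  have i: "integrable lborel (\<lambda>y. F (y + v) * indicator (ball x r) y)" "integrable lborel (\<lambda>y. F y * indicator (ball x r) y)"
    using ball_mult_integrable[OF lborel_integrable_shift[OF F], of "ball x r" v] ball_mult_integrable[OF F, of "ball x r"]
    by (simp_all add: mult.commute)
  have "(LINT y|lborel. indicator (ball (x + v) r) y * F y) - (LINT y|lborel. indicator (ball x r) y * F y)
     = (LINT y|lborel. (F (y + v) - F y) * indicator (ball x r) y)"
    using sh[of F v] sh[of F 0] i by (simp add: left_diff_distrib)
  also have "\<dots> = (LINT s|lborel. indicator {0..1} s * (LINT y|lborel. (w (y + s *\<^sub>R v) \<bullet> v) * indicator (ball x r) y))"
    by (rule increment_integral[OF w F iw, of _ 1]) (auto simp: indicator_def)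
  also have "\<dots> = (LINT s|lborel. indicator {0..1} s * (LINT y|lborel. indicator (ball (x + s *\<^sub>R v) r) y * (w y \<bullet> v)))"
    using sh[of "\<lambda>y. w y \<bullet> v"] by simp
  finally show ?thesis
    unfolding frac_mean_def right_diff_distrib[symmetric] by (simp add: mult.left_commute flip: integral_mult_right_zero)
qed

lemma unit_interval_integral_bound:
  fixes k :: "real \<Rightarrow> real"
  assumes "\<And>s. s \<in> {0..1} \<Longrightarrow> \<bar>k s\<bar> \<le> C"
  shows "\<bar>LINT s|lborel. indicator {0..1} s * k s\<bar> \<le> C"
proof -
  have C: "0 \<le> C" using assms[of 0] by auto
  have i01: "integrable lborel (indicator {0..1::real} :: real \<Rightarrow> real)" by (simp add: integrable_indicator_iff)
  have "\<bar>LINT s|lborel. indicator {0..1} s * k s\<bar> \<le> (LINT s|lborel. C * indicator {0..1::real} s)"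
  proof (cases "integrable lborel (\<lambda>s. indicator {0..1} s * k s)")
    case True
    have "\<bar>LINT s|lborel. indicator {0..1} s * k s\<bar> \<le> (LINT s|lborel. \<bar>indicator {0..1} s * k s\<bar>)"
      by (rule integral_abs_bound)
    also have "\<dots> \<le> (LINT s|lborel. C * indicator {0..1::real} s)"
      using assms True
      by (intro integral_mono integrable_abs integrable_mult_right i01) (auto simp: indicator_def)
    finally show ?thesis .
  qed (use C in \<open>simp add: not_integrable_integral_eq\<close>)
  then show ?thesis by simp
qed

lemma frac_mean_lipschitz:
  fixes F :: "'a::euclidean_space \<Rightarrow> real"
  assumes w: "wgrad F w" and F: "integrable lborel F" and iw: "integrable lborel w"
  shows "\<bar>frac_mean \<beta> F r (x + v) - frac_mean \<beta> F r x\<bar>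
    \<le> r powr (\<beta> - DIM('a)) / unit_ball_vol DIM('a) * (LINT y|lborel. norm (w y)) * norm v"
  unfolding frac_mean_increment[OF assms]
proof (rule unit_interval_integral_bound)
  fix s :: real
  have "\<bar>frac_mean \<beta> (\<lambda>y. w y \<bullet> v) r (x + s *\<^sub>R v)\<bar>
     \<le> r powr (\<beta> - DIM('a)) / unit_ball_vol DIM('a) * (LINT y|lborel. \<bar>w y \<bullet> v\<bar>)"
    by (rule frac_mean_abs_le) (use iw in auto)
  also have "\<dots> \<le> r powr (\<beta> - DIM('a)) / unit_ball_vol DIM('a) * (LINT y|lborel. norm (w y) * norm v)"
    using iw by (intro mult_left_mono integral_mono integrable_abs integrable_mult_left integrable_norm integrable_inner_left)
      (auto intro: Cauchy_Schwarz_ineq2 divide_nonneg_nonneg)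
  finally show "\<bar>frac_mean \<beta> (\<lambda>y. w y \<bullet> v) r (x + s *\<^sub>R v)\<bar>
    \<le> r powr (\<beta> - DIM('a)) / unit_ball_vol DIM('a) * (LINT y|lborel. norm (w y)) * norm v"
    by simp
qed

text \<open>The increment formula writes the difference quotient as an average over a segment that
  shrinks to \<open>x\<close>, of a function that is continuous.\<close>

lemma frac_mean_directional_derivative:
  fixes F :: "'a::euclidean_space \<Rightarrow> real"
  assumes w: "wgrad F w" and F: "integrable lborel F" and iw: "integrable lborel w" and r: "r > 0"
  shows "(\<lambda>n. real (Suc n) * (frac_mean \<beta> F r (x + (1 / real (Suc n)) *\<^sub>R v) - frac_mean \<beta> F r x))
    \<longlonglongrightarrow> frac_mean \<beta> (\<lambda>y. w y \<bullet> v) r x"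
proof -
  let ?t = "\<lambda>n. 1 / real (Suc n)"
  let ?k = "\<lambda>y. w y \<bullet> v"
  have k: "integrable lborel ?k" using iw by simp
  have t0: "?t \<longlonglongrightarrow> 0" using LIMSEQ_Suc[OF lim_1_over_n[where 'a=real]] by simp
  have "(\<lambda>n. LINT s|lborel. indicator {0..1} s * frac_mean \<beta> ?k r (x + s *\<^sub>R (?t n *\<^sub>R v)))
     \<longlonglongrightarrow> (LINT s|lborel. indicator {0..1::real} s * frac_mean \<beta> ?k r x)"
  proof (rule integral_dominated_convergence[where
      w="\<lambda>s. indicator {0..1} s * (r powr (\<beta> - DIM('a)) / unit_ball_vol DIM('a) * (LINT y|lborel. \<bar>?k y\<bar>))"])
    show "AE s in lborel. (\<lambda>n. indicator {0..1} s * frac_mean \<beta> ?k r (x + s *\<^sub>R (?t n *\<^sub>R v)))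
       \<longlonglongrightarrow> indicator {0..1::real} s * frac_mean \<beta> ?k r x"
    proof (intro AE_I2 tendsto_mult tendsto_const)
      fix s :: real
      have "(\<lambda>n. x + s *\<^sub>R (?t n *\<^sub>R v)) \<longlonglongrightarrow> x + s *\<^sub>R (0 *\<^sub>R v)" by (intro tendsto_intros t0)
      then show "(\<lambda>n. frac_mean \<beta> ?k r (x + s *\<^sub>R (?t n *\<^sub>R v))) \<longlonglongrightarrow> frac_mean \<beta> ?k r x"
        using r by (intro frac_mean_tendsto k) auto
    qed
    show "AE s in lborel. norm (indicator {0..1} s * frac_mean \<beta> ?k r (x + s *\<^sub>R (?t n *\<^sub>R v)))
       \<le> indicator {0..1::real} s * (r powr (\<beta> - DIM('a)) / unit_ball_vol DIM('a) * (LINT y|lborel. \<bar>?k y\<bar>))" for n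
      using frac_mean_abs_le[OF k] by (intro AE_I2) (auto simp: indicator_def)
    show "(\<lambda>s. indicator {0..1} s * frac_mean \<beta> ?k r (x + s *\<^sub>R (?t n *\<^sub>R v))) \<in> borel_measurable lborel" for n
    proof -
      have "frac_mean \<beta> ?k r \<in> borel_measurable borel"
        by (intro borel_measurable_continuous_onI frac_mean_continuous_on_x k r)
      then have [measurable]: "(\<lambda>s. frac_mean \<beta> ?k r (x + s *\<^sub>R (?t n *\<^sub>R v))) \<in> borel_measurable borel"
        by (rule measurable_compose[rotated]) measurable
      show ?thesis by measurable
    qed
  qed auto
  moreover have "real (Suc n) * (frac_mean \<beta> F r (x + ?t n *\<^sub>R v) - frac_mean \<beta> F r x)
     = (LINT s|lborel. indicator {0..1} s * frac_mean \<beta> ?k r (x + s *\<^sub>R (?t n *\<^sub>R v)))" for n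
  proof -
    have "frac_mean \<beta> F r (x + ?t n *\<^sub>R v) - frac_mean \<beta> F r x
       = (LINT s|lborel. indicator {0..1} s * (?t n * frac_mean \<beta> ?k r (x + s *\<^sub>R (?t n *\<^sub>R v))))"
      unfolding frac_mean_increment[OF w F iw] frac_mean_cmult[symmetric] by simp
    also have "\<dots> = ?t n * (LINT s|lborel. indicator {0..1} s * frac_mean \<beta> ?k r (x + s *\<^sub>R (?t n *\<^sub>R v)))"
      by (simp only: mult.left_commute[of _ "?t n"] integral_mult_right_zero)
    finally show ?thesis by (simp del: of_nat_Suc)
  qed
  ultimately show ?thesis by simp
qed

section \<open>Weak gradients of envelopes\<close>

text \<open>Suppose that at every point the forward quotients are asymptotically at least some slope
  \<open>p\<close>, and the backward ones at most \<open>p\<close>. Then the lower limit \<open>h\<close> of the forward quotients is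
  pointwise at least the upper limit \<open>k\<close> of the backward ones, whereas Fatou's lemma, applied to
  both after adding the Lipschitz constant, orders their integrals the other way round. Hence
  \<open>h = k\<close> almost everywhere, this is the weak derivative, and it agrees with every slope.\<close>

lemma envelope_weak_derivative:
  fixes M :: "'a::euclidean_space \<Rightarrow> real" and e :: 'a
  assumes M: "continuous_on UNIV M"
    and L: "\<And>x t. \<bar>M (x + t *\<^sub>R e) - M x\<bar> \<le> L * \<bar>t\<bar>"
    and ne: "\<And>x. S x \<noteq> {}"
    and fwd: "\<And>x p. p \<in> S x \<Longrightarrow> \<exists>a. a \<longlonglongrightarrow> p \<and>
       (\<forall>n. a n \<le> real (Suc n) * (M (x + (1 / real (Suc n)) *\<^sub>R e) - M x))"
    and bwd: "\<And>x p. p \<in> S x \<Longrightarrow> \<exists>b. b \<longlonglongrightarrow> p \<and>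
       (\<forall>n. real (Suc n) * (M x - M (x - (1 / real (Suc n)) *\<^sub>R e)) \<le> b n)"
  shows "\<exists>h. h \<in> borel_measurable borel \<and> (\<forall>x. \<bar>h x\<bar> \<le> L) \<and>
     (\<forall>\<phi>. test_function \<phi> \<and> (\<forall>x. 0 \<le> \<phi> x) \<longrightarrow>
        (LINT x|lborel. M x * frechet_derivative \<phi> (at x) e) = - (LINT x|lborel. h x * \<phi> x)) \<and>
     (AE x in lborel. \<forall>p\<in>S x. h x = p)"
proof -
  have [measurable]: "M \<in> borel_measurable borel" using M by (rule borel_measurable_continuous_onI)
  have L0: "0 \<le> L" using L[of 0 1] by auto
  have bounded_test: "integrable lborel (\<lambda>x. u x * \<phi> x)"
    if "u \<in> borel_measurable borel" "\<And>x. \<bar>u x\<bar> \<le> B" "test_function \<phi>" for u :: "'a \<Rightarrow> real" and B \<phi>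
    using that(2) by (intro locint_mult_test(1)[OF bounded_imp_locint[OF that(1), of B] that(3)]) simp
  have lM: "locint M" by (rule continuous_imp_locint[OF M])
  let ?t = "\<lambda>n. 1 / real (Suc n)"
  define A where "A n x = real (Suc n) * (M (x + ?t n *\<^sub>R e) - M x)" for n x
  define B where "B n x = real (Suc n) * (M x - M (x - ?t n *\<^sub>R e))" for n x
  have [measurable]: "A n \<in> borel_measurable borel" "B n \<in> borel_measurable borel" for n
    unfolding A_def B_def by measurable
  have A: "\<bar>A n x\<bar> \<le> L" for n x
  proof -
    have "real (Suc n) * \<bar>M (x + ?t n *\<^sub>R e) - M x\<bar> \<le> real (Suc n) * (L * \<bar>?t n\<bar>)"
      by (intro mult_left_mono L) auto
    then show ?thesis by (simp add: A_def abs_mult del: of_nat_Suc)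
  qed
  have B: "\<bar>B n x\<bar> \<le> L" for n x
    using A[of n "x - ?t n *\<^sub>R e"] by (simp add: A_def B_def)
  define h where "h x = enn2real (liminf (\<lambda>n. ennreal (A n x + L))) - L" for x
  define k where "k x = L - enn2real (liminf (\<lambda>n. ennreal (L - B n x)))" for x
  have [measurable]: "h \<in> borel_measurable borel" "k \<in> borel_measurable borel"
    unfolding h_def k_def by measurable
  have liminf_le: "liminf (\<lambda>n. ennreal (a n)) \<le> ennreal (2 * L)" if "\<And>n. a n \<le> 2 * L" for a
    by (rule Liminf_le) (use that in \<open>auto intro!: always_eventually ennreal_leI\<close>)
  have Ale: "A n x + L \<le> 2 * L" and Ble: "L - B n x \<le> 2 * L" for n x
    using A[of n x] B[of n x] by auto
  have ha: "ennreal (h x + L) = liminf (\<lambda>n. ennreal (A n x + L))" for x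
    using liminf_le[of "\<lambda>n. A n x + L"] Ale[of _ x] unfolding h_def
    by (simp, subst ennreal_enn2real) (auto simp: less_top[symmetric] top_unique)
  have kb: "ennreal (L - k x) = liminf (\<lambda>n. ennreal (L - B n x))" for x
    using liminf_le[of "\<lambda>n. L - B n x"] Ble[of _ x] unfolding k_def
    by (simp, subst ennreal_enn2real) (auto simp: less_top[symmetric] top_unique)
  have h0: "0 \<le> h x + L" and k0: "0 \<le> L - k x" for x by (auto simp: h_def k_def)
  have hL: "\<bar>h x\<bar> \<le> L" and kL: "\<bar>k x\<bar> \<le> L" for x
    using liminf_le[of "\<lambda>n. A n x + L"] Ale[of _ x] liminf_le[of "\<lambda>n. L - B n x"] Ble[of _ x]
      h0[of x] k0[of x] L0 unfolding ha[symmetric] kb[symmetric]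
    by (auto simp: ennreal_le_iff)
  have slope: "k x \<le> p \<and> p \<le> h x" if p: "p \<in> S x" for x p
  proof
    obtain a where a: "a \<longlonglongrightarrow> p" "\<And>n. a n \<le> A n x" using fwd[OF p] by (auto simp: A_def)
    have "(\<lambda>n. ennreal (a n + L)) \<longlonglongrightarrow> ennreal (p + L)" by (intro tendsto_intros a tendsto_ennrealI)
    then have "ennreal (p + L) = liminf (\<lambda>n. ennreal (a n + L))" by (simp add: lim_imp_Liminf)
    also have "\<dots> \<le> liminf (\<lambda>n. ennreal (A n x + L))"
      using a(2) by (intro Liminf_mono always_eventually allI ennreal_leI) auto
    finally have "ennreal (p + L) \<le> ennreal (h x + L)" by (simp add: ha)
    then show "p \<le> h x" using h0[of x] by (simp add: ennreal_le_iff)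
    obtain b where b: "b \<longlonglongrightarrow> p" "\<And>n. B n x \<le> b n" using bwd[OF p] by (auto simp: B_def)
    have "(\<lambda>n. ennreal (L - b n)) \<longlonglongrightarrow> ennreal (L - p)" by (intro tendsto_intros b tendsto_ennrealI)
    then have "ennreal (L - p) = liminf (\<lambda>n. ennreal (L - b n))" by (simp add: lim_imp_Liminf)
    also have "\<dots> \<le> liminf (\<lambda>n. ennreal (L - B n x))"
      using b(2) by (intro Liminf_mono always_eventually allI ennreal_leI) auto
    finally have "ennreal (L - p) \<le> ennreal (L - k x)" by (simp add: kb)
    then show "k x \<le> p" using k0[of x] by (simp add: ennreal_le_iff)
  qed
  \<comment> \<open>Some slope exists at every point, and it lies between the two limits.\<close>
  have kh: "k x \<le> h x" for x using ne[of x] slope[of _ x] by fastforce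
  have fatou: "(LINT x|lborel. (u x + L) * \<phi> x) \<le> c"
    if \<phi>: "test_function \<phi>" "\<And>x. 0 \<le> \<phi> x" and u: "u \<in> borel_measurable borel" "\<And>x. \<bar>u x\<bar> \<le> L"
      and Q: "\<And>n. Q n \<in> borel_measurable borel" "\<And>n x. \<bar>Q n x\<bar> \<le> L"
      and eq: "\<And>x. ennreal (u x + L) = liminf (\<lambda>n. ennreal (Q n x + L))"
      and c: "(\<lambda>n. LINT x|lborel. (Q n x + L) * \<phi> x) \<longlonglongrightarrow> c" for \<phi> u :: "'a \<Rightarrow> real" and Q c
  proof -
    note [measurable] = test_function_measurable(1)[OF \<phi>(1)] u(1) Q(1)
    have pos: "0 \<le> u x + L" "0 \<le> Q n x + L" for x n using u(2)[of x] Q(2)[of n x] by auto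
    have bd: "\<bar>u x + L\<bar> \<le> 2 * L" "\<bar>Q n x + L\<bar> \<le> 2 * L" for x n using u(2)[of x] Q(2)[of n x] by auto
    have iu: "integrable lborel (\<lambda>x. (u x + L) * \<phi> x)"
      by (rule bounded_test[OF _ bd(1) \<phi>(1)]) measurable
    have iQ: "integrable lborel (\<lambda>x. (Q n x + L) * \<phi> x)" for n
      by (rule bounded_test[OF _ bd(2) \<phi>(1)]) measurable
    have c0: "0 \<le> c"
      by (rule LIMSEQ_le_const[OF c]) (auto intro!: exI[of _ 0] integral_nonneg_AE simp: pos \<phi>(2))
    have "ennreal (LINT x|lborel. (u x + L) * \<phi> x) = (\<integral>\<^sup>+x. ennreal ((u x + L) * \<phi> x) \<partial>lborel)"
      by (rule nn_integral_eq_integral[symmetric, OF iu]) (auto simp: pos \<phi>(2))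
    also have "\<dots> = (\<integral>\<^sup>+x. liminf (\<lambda>n. ennreal ((Q n x + L) * \<phi> x)) \<partial>lborel)"
    proof (intro nn_integral_cong)
      fix x
      have "ennreal ((u x + L) * \<phi> x) = liminf (\<lambda>n. ennreal (Q n x + L)) * ennreal (\<phi> x)"
        using pos \<phi>(2) by (simp add: ennreal_mult eq)
      also have "\<dots> = liminf (\<lambda>n. ennreal (\<phi> x) * ennreal (Q n x + L))"
        by (subst mult.commute, rule Liminf_compose_continuous_mono[symmetric, of "\<lambda>z. ennreal (\<phi> x) * z"])
           (auto intro!: mult_left_mono monoI ennreal_continuous_on_cmult continuous_on_id)
      finally show "ennreal ((u x + L) * \<phi> x) = liminf (\<lambda>n. ennreal ((Q n x + L) * \<phi> x))"
        using pos \<phi>(2) by (simp add: ennreal_mult mult.commute)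
    qed
    also have "\<dots> \<le> liminf (\<lambda>n. \<integral>\<^sup>+x. ennreal ((Q n x + L) * \<phi> x) \<partial>lborel)"
      by (rule nn_integral_liminf) measurable
    also have "(\<lambda>n. \<integral>\<^sup>+x. ennreal ((Q n x + L) * \<phi> x) \<partial>lborel) = (\<lambda>n. ennreal (LINT x|lborel. (Q n x + L) * \<phi> x))"
      by (intro ext nn_integral_eq_integral iQ) (auto simp: pos \<phi>(2))
    also have "liminf \<dots> = ennreal c"
      by (intro lim_imp_Liminf tendsto_ennrealI c) simp
    finally show ?thesis using c0 by (simp add: ennreal_le_iff)
  qed
  have test: "(LINT x|lborel. h x * \<phi> x) = - (LINT x|lborel. M x * frechet_derivative \<phi> (at x) e)"
    "(LINT x|lborel. k x * \<phi> x) = - (LINT x|lborel. M x * frechet_derivative \<phi> (at x) e)"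
    if \<phi>: "test_function \<phi>" "\<And>x. 0 \<le> \<phi> x" for \<phi>
  proof -
    note [measurable] = test_function_measurable(1)[OF \<phi>(1)]
    define c where "c = (LINT x|lborel. M x * frechet_derivative \<phi> (at x) e)"
    define l where "l = (LINT x|lborel. L * \<phi> x)"
    note im = bounded_test[of _ L, OF _ _ \<phi>(1)]
    have iL: "integrable lborel (\<lambda>x. L * \<phi> x)" using im[of "\<lambda>_. L"] L0 by simp
    have ih: "integrable lborel (\<lambda>x. h x * \<phi> x)" using im[of h] hL by simp
    have ik: "integrable lborel (\<lambda>x. k x * \<phi> x)" using im[of k] kL by simp
    have iA: "integrable lborel (\<lambda>x. A n x * \<phi> x)" for n using im[of "A n"] A by simp
    have iB: "integrable lborel (\<lambda>x. B n x * \<phi> x)" for n using im[of "B n"] B by simp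
    have iM: "integrable lborel (\<lambda>x. M x * \<phi> (x - v))" for v
      by (rule locint_mult_test(1)[OF lM test_function_shift[OF \<phi>(1)]])
    have iM': "integrable lborel (\<lambda>x. M (x + v) * \<phi> x)" for v
      using lborel_integrable_shift[OF iM, of v v] by simp
    have quot: "(LINT x|lborel. (M (x + v) - M x) * \<phi> x) = (LINT x|lborel. M x * (\<phi> (x - v) - \<phi> x))" for v
    proof -
      have "(LINT x|lborel. M (x + v) * \<phi> x) = (LINT x|lborel. M x * \<phi> (x - v))"
        using lborel_integral_shift[of "\<lambda>x. M x * \<phi> (x - v)" v] by simp
      then show ?thesis using iM[of v] iM[of 0] iM'[of v] iM'[of 0]
        by (simp add: left_diff_distrib right_diff_distrib)
    qed
    have "(\<lambda>n. LINT x|lborel. A n x * \<phi> x) \<longlonglongrightarrow> - c"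
    proof -
      have "(LINT x|lborel. A n x * \<phi> x) = (LINT x|lborel. M x * (real (Suc n) * (\<phi> (x - ?t n *\<^sub>R e) - \<phi> x)))" for n
        using quot[of "?t n *\<^sub>R e"] unfolding A_def
        by (simp only: mult.assoc mult.left_commute[of "M _"] integral_mult_right_zero)
      then show ?thesis using test_function_difference_quotient[OF lM \<phi>(1), of e] by (simp add: c_def)
    qed
    moreover have "(LINT x|lborel. (A n x + L) * \<phi> x) = (LINT x|lborel. A n x * \<phi> x) + l" for n
      using iA[of n] iL by (simp add: distrib_right l_def)
    ultimately have limA: "(\<lambda>n. LINT x|lborel. (A n x + L) * \<phi> x) \<longlonglongrightarrow> - c + l"
      by (simp only: tendsto_add[OF _ tendsto_const])
    have "(\<lambda>n. LINT x|lborel. B n x * \<phi> x) \<longlonglongrightarrow> - c"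
    proof -
      have eq: "(LINT x|lborel. B n x * \<phi> x) = - (LINT x|lborel. M x * (real (Suc n) * (\<phi> (x - ?t n *\<^sub>R (- e)) - \<phi> x)))" for n
      proof -
        have "(LINT x|lborel. B n x * \<phi> x) = (LINT x|lborel. - (real (Suc n) * ((M (x + ?t n *\<^sub>R (- e)) - M x) * \<phi> x)))"
          by (intro Bochner_Integration.integral_cong) (auto simp: B_def algebra_simps)
        also have "\<dots> = - (real (Suc n) * (LINT x|lborel. (M (x + ?t n *\<^sub>R (- e)) - M x) * \<phi> x))"
          by (simp only: integral_mult_right_zero Bochner_Integration.integral_minus)
        finally show ?thesis
          unfolding quot by (simp only: mult.left_commute[of "M _"] integral_mult_right_zero)
      qed
      have neg: "frechet_derivative \<phi> (at x) (- e) = - frechet_derivative \<phi> (at x) e" for x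
        using has_derivative_linear[OF test_function_differentiable[OF \<phi>(1), of x]] by (rule linear_neg)
      have "(\<lambda>n. - (LINT x|lborel. M x * (real (Suc n) * (\<phi> (x - ?t n *\<^sub>R (- e)) - \<phi> x))))
          \<longlonglongrightarrow> - (- (LINT x|lborel. M x * frechet_derivative \<phi> (at x) (- e)))"
        by (intro tendsto_minus test_function_difference_quotient[OF lM \<phi>(1)])
      then show ?thesis unfolding eq by (simp add: neg c_def)
    qed
    then have "(\<lambda>n. - (LINT x|lborel. B n x * \<phi> x) + l) \<longlonglongrightarrow> - (- c) + l"
      by (intro tendsto_add tendsto_minus tendsto_const)
    moreover have "(LINT x|lborel. (- B n x + L) * \<phi> x) = - (LINT x|lborel. B n x * \<phi> x) + l" for n
      using iB[of n] iL by (simp add: left_diff_distrib l_def)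
    ultimately have limB: "(\<lambda>n. LINT x|lborel. (- B n x + L) * \<phi> x) \<longlonglongrightarrow> c + l"
      by simp
    have "(LINT x|lborel. (h x + L) * \<phi> x) \<le> - c + l"
      by (rule fatou[OF \<phi> _ hL _ A ha limA]) measurable
    then have 1: "(LINT x|lborel. h x * \<phi> x) \<le> - c"
      using ih iL by (simp add: distrib_right l_def)
    have "(LINT x|lborel. (- k x + L) * \<phi> x) \<le> c + l"
      by (rule fatou[OF \<phi> _ _ _ _ _ limB]) (use kL B kb in \<open>auto simp: algebra_simps\<close>)
    then have 2: "- c \<le> (LINT x|lborel. k x * \<phi> x)"
      using ik iL by (simp add: left_diff_distrib l_def)
    have "(LINT x|lborel. k x * \<phi> x) \<le> (LINT x|lborel. h x * \<phi> x)"
      by (intro integral_mono ih ik mult_right_mono kh \<phi>)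
    then show "(LINT x|lborel. h x * \<phi> x) = - (LINT x|lborel. M x * frechet_derivative \<phi> (at x) e)"
      "(LINT x|lborel. k x * \<phi> x) = - (LINT x|lborel. M x * frechet_derivative \<phi> (at x) e)"
      using 1 2 by (auto simp: c_def)
  qed
  have lh: "locint h" "locint k"
    using hL kL by (auto intro!: bounded_imp_locint[where B=L])
  have "AE x in lborel. h x - k x = 0"
  proof (rule fundamental_lemma[OF locint_diff[OF lh]])
    fix \<phi> :: "'a \<Rightarrow> real" assume \<phi>: "test_function \<phi>" "\<And>x. 0 \<le> \<phi> x"
    show "(LINT x|lborel. (h x - k x) * \<phi> x) = 0"
      using test[OF \<phi>] locint_mult_test(1)[OF lh(1) \<phi>(1)] locint_mult_test(1)[OF lh(2) \<phi>(1)]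
      by (simp add: left_diff_distrib)
  qed
  then have "AE x in lborel. \<forall>p\<in>S x. h x = p"
    by eventually_elim (use slope in fastforce)
  then show ?thesis using test hL by (intro exI[of _ h]) auto
qed

section \<open>The weak gradient of the maximal function\<close>

text \<open>For radii in a compact interval the supremum is attained and Lipschitz continuous; at a given
  point the parameter only matters until the interval contains an optimal radius.\<close>

definition trunc_max :: "real \<Rightarrow> ('a::euclidean_space \<Rightarrow> real) \<Rightarrow> nat \<Rightarrow> 'a \<Rightarrow> real" where
  "trunc_max \<beta> F n x = (SUP r\<in>{1 / real (Suc n)..real (Suc n)}. frac_mean \<beta> F r x)"

lemma trunc_max_attained:
  fixes F :: "'a::euclidean_space \<Rightarrow> real"
  assumes F: "integrable lborel F"
  obtains r where "r \<in> {1 / real (Suc n)..real (Suc n)}" "frac_mean \<beta> F r x = trunc_max \<beta> F n x"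
    "\<And>s. s \<in> {1 / real (Suc n)..real (Suc n)} \<Longrightarrow> frac_mean \<beta> F s x \<le> trunc_max \<beta> F n x"
proof -
  let ?I = "{1 / real (Suc n)..real (Suc n)}"
  have pos: "r > 0" if "r \<in> ?I" for r
    using that less_le_trans[of 0 "1 / real (Suc n)" r] by simp
  have "1 / real (Suc n) \<le> 1" by simp
  also have "1 \<le> real (Suc n)" by simp
  finally have "?I \<noteq> {}" by simp
  then obtain r where r: "r \<in> ?I" "\<And>s. s \<in> ?I \<Longrightarrow> frac_mean \<beta> F s x \<le> frac_mean \<beta> F r x"
    using continuous_attains_sup[OF compact_Icc _ frac_mean_continuous_on_r[OF F pos]] by blast
  have "trunc_max \<beta> F n x = frac_mean \<beta> F r x"
    unfolding trunc_max_def using r by (intro cSup_eq_maximum) auto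
  then show ?thesis using r by (intro that[of r]) auto
qed

lemma trunc_max_lipschitz:
  fixes F :: "'a::euclidean_space \<Rightarrow> real"
  assumes w: "wgrad F w" and F: "integrable lborel F" and iw: "integrable lborel w" and \<beta>: "\<beta> < real DIM('a)"
  shows "\<bar>trunc_max \<beta> F n (x + v) - trunc_max \<beta> F n x\<bar>
    \<le> (1 / real (Suc n)) powr (\<beta> - DIM('a)) / unit_ball_vol DIM('a) * (LINT y|lborel. norm (w y)) * norm v"
    (is "_ \<le> ?L * norm v")
proof -
  let ?I = "{1 / real (Suc n)..real (Suc n)}"
  have L: "\<bar>frac_mean \<beta> F r (x + v) - frac_mean \<beta> F r x\<bar> \<le> ?L * norm v" if r: "r \<in> ?I" for r
  proof -
    have "r powr (\<beta> - DIM('a)) \<le> (1 / real (Suc n)) powr (\<beta> - DIM('a))"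
      using r \<beta> by (intro powr_mono2') auto
    then have "r powr (\<beta> - DIM('a)) / unit_ball_vol DIM('a) * (LINT y|lborel. norm (w y)) * norm v \<le> ?L * norm v"
      by (intro mult_right_mono divide_right_mono) auto
    then show ?thesis using frac_mean_lipschitz[OF w F iw, of \<beta> r x v] by linarith
  qed
  obtain r where r: "r \<in> ?I" "frac_mean \<beta> F r x = trunc_max \<beta> F n x"
    "\<And>s. s \<in> ?I \<Longrightarrow> frac_mean \<beta> F s x \<le> trunc_max \<beta> F n x"
    using trunc_max_attained[OF F, of n \<beta> x] by metis
  obtain r' where r': "r' \<in> ?I" "frac_mean \<beta> F r' (x + v) = trunc_max \<beta> F n (x + v)"
    "\<And>s. s \<in> ?I \<Longrightarrow> frac_mean \<beta> F s (x + v) \<le> trunc_max \<beta> F n (x + v)"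
    using trunc_max_attained[OF F, of n \<beta> "x + v"] by metis
  show ?thesis using L[OF r(1)] L[OF r'(1)] r(2) r'(2) r(3)[OF r'(1)] r'(3)[OF r(1)] by linarith
qed

lemma trunc_max_continuous:
  fixes F :: "'a::euclidean_space \<Rightarrow> real"
  assumes w: "wgrad F w" and F: "integrable lborel F" and iw: "integrable lborel w" and \<beta>: "\<beta> < real DIM('a)"
  shows "continuous_on UNIV (trunc_max \<beta> F n)"
proof -
  define L where "L = (1 / real (Suc n)) powr (\<beta> - DIM('a)) / unit_ball_vol DIM('a) * (LINT y|lborel. norm (w y))"
  have "L-lipschitz_on UNIV (trunc_max \<beta> F n)"
  proof (rule lipschitz_onI)
    fix x y :: 'a
    show "dist (trunc_max \<beta> F n x) (trunc_max \<beta> F n y) \<le> L * dist x y"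
      using trunc_max_lipschitz[OF assms, of n y "x - y"] by (simp add: L_def dist_norm)
  qed (simp add: L_def integral_nonneg_AE)
  then show ?thesis by (rule lipschitz_on_continuous_on)
qed

text \<open>Every radius that attains the maximum at \<open>x\<close> contributes the slope of its mean: the maximal
  function lies above that mean and touches it at \<open>x\<close>.\<close>

lemma trunc_max_wgrad:
  fixes F :: "'a::euclidean_space \<Rightarrow> real"
  assumes w: "wgrad F w" and F: "integrable lborel F" and iw: "integrable lborel w" and \<beta>: "\<beta> < real DIM('a)"
  obtains G where "wgrad (trunc_max \<beta> F n) G"
    "AE x in lborel. \<forall>r\<in>{1 / real (Suc n)..real (Suc n)}. frac_mean \<beta> F r x = trunc_max \<beta> F n x \<longrightarrow>
       (\<forall>e\<in>Basis. G x \<bullet> e = frac_mean \<beta> (\<lambda>y. w y \<bullet> e) r x)"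
proof -
  let ?I = "{1 / real (Suc n)..real (Suc n)}"
  let ?M = "trunc_max \<beta> F n"
  let ?S = "\<lambda>e x. {frac_mean \<beta> (\<lambda>y. w y \<bullet> e) r x | r. r \<in> ?I \<and> frac_mean \<beta> F r x = ?M x}"
  define L where "L = (1 / real (Suc n)) powr (\<beta> - DIM('a)) / unit_ball_vol DIM('a) * (LINT y|lborel. norm (w y))"
  have le: "frac_mean \<beta> F r x \<le> ?M x" if "r \<in> ?I" for r x
    using trunc_max_attained[OF F, of n \<beta> x] that by metis
  have pos: "r > 0" if "r \<in> ?I" for r
    using that less_le_trans[of 0 "1 / real (Suc n)" r] by simp
  have cont: "continuous_on UNIV ?M" by (rule trunc_max_continuous[OF assms])
  have ex: "\<exists>h. h \<in> borel_measurable borel \<and> (\<forall>x. \<bar>h x\<bar> \<le> L) \<and>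
     (\<forall>\<phi>. test_function \<phi> \<and> (\<forall>x. 0 \<le> \<phi> x) \<longrightarrow>
        (LINT x|lborel. ?M x * frechet_derivative \<phi> (at x) e) = - (LINT x|lborel. h x * \<phi> x)) \<and>
     (AE x in lborel. \<forall>p\<in>?S e x. h x = p)" (is "\<exists>h. ?P e h") if e: "e \<in> Basis" for e
  proof (rule envelope_weak_derivative[OF cont])
    show "\<bar>?M (x + t *\<^sub>R e) - ?M x\<bar> \<le> L * \<bar>t\<bar>" for x t
      using trunc_max_lipschitz[OF assms, of n x "t *\<^sub>R e"] e by (simp add: L_def)
    show "?S e x \<noteq> {}" for x
    proof -
      obtain r where "r \<in> ?I" "frac_mean \<beta> F r x = ?M x" using trunc_max_attained[OF F, of n \<beta> x] by metis
      then have "frac_mean \<beta> (\<lambda>y. w y \<bullet> e) r x \<in> ?S e x" by auto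
      then show ?thesis by (metis empty_iff)
    qed
  next
    fix x p assume "p \<in> ?S e x"
    then obtain r where r: "r \<in> ?I" "frac_mean \<beta> F r x = ?M x" "p = frac_mean \<beta> (\<lambda>y. w y \<bullet> e) r x" by auto
    show "\<exists>a. a \<longlonglongrightarrow> p \<and> (\<forall>n. a n \<le> real (Suc n) * (?M (x + (1 / real (Suc n)) *\<^sub>R e) - ?M x))"
    proof (intro exI conjI allI)
      show "(\<lambda>n. real (Suc n) * (frac_mean \<beta> F r (x + (1 / real (Suc n)) *\<^sub>R e) - frac_mean \<beta> F r x)) \<longlonglongrightarrow> p"
        unfolding r(3) by (rule frac_mean_directional_derivative[OF w F iw pos[OF r(1)]])
      fix k show "real (Suc k) * (frac_mean \<beta> F r (x + (1 / real (Suc k)) *\<^sub>R e) - frac_mean \<beta> F r x)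
         \<le> real (Suc k) * (?M (x + (1 / real (Suc k)) *\<^sub>R e) - ?M x)"
        using le[OF r(1), of "x + (1 / real (Suc k)) *\<^sub>R e"] r(2) by (intro mult_left_mono) auto
    qed
    show "\<exists>b. b \<longlonglongrightarrow> p \<and> (\<forall>n. real (Suc n) * (?M x - ?M (x - (1 / real (Suc n)) *\<^sub>R e)) \<le> b n)"
    proof (intro exI conjI allI)
      have "(\<lambda>n. - (real (Suc n) * (frac_mean \<beta> F r (x + (1 / real (Suc n)) *\<^sub>R (- e)) - frac_mean \<beta> F r x)))
         \<longlonglongrightarrow> - frac_mean \<beta> (\<lambda>y. w y \<bullet> (- e)) r x"
        by (intro tendsto_minus frac_mean_directional_derivative[OF w F iw pos[OF r(1)]])
      moreover have "- frac_mean \<beta> (\<lambda>y. w y \<bullet> (- e)) r x = p"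
        using frac_mean_cmult[of \<beta> "-1" "\<lambda>y. w y \<bullet> e" r x] by (simp add: r(3))
      ultimately show "(\<lambda>n. - (real (Suc n) * (frac_mean \<beta> F r (x + (1 / real (Suc n)) *\<^sub>R (- e)) - frac_mean \<beta> F r x))) \<longlonglongrightarrow> p"
        by simp
      fix k
      have "real (Suc k) * (?M x - ?M (x - (1 / real (Suc k)) *\<^sub>R e))
        \<le> real (Suc k) * (frac_mean \<beta> F r x - frac_mean \<beta> F r (x - (1 / real (Suc k)) *\<^sub>R e))"
        using le[OF r(1), of "x - (1 / real (Suc k)) *\<^sub>R e"] r(2) by (intro mult_left_mono) auto
      then show "real (Suc k) * (?M x - ?M (x - (1 / real (Suc k)) *\<^sub>R e))
         \<le> - (real (Suc k) * (frac_mean \<beta> F r (x + (1 / real (Suc k)) *\<^sub>R (- e)) - frac_mean \<beta> F r x))"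
        by (simp add: right_diff_distrib del: of_nat_Suc)
    qed
  qed
  then have "\<exists>h. \<forall>e\<in>Basis. ?P e (h e)" by (intro bchoice ballI)
  then obtain h where hP: "\<forall>e\<in>Basis. ?P e (h e)" ..
  have h: "\<And>e. e \<in> Basis \<Longrightarrow> h e \<in> borel_measurable borel" "\<And>e x. e \<in> Basis \<Longrightarrow> \<bar>h e x\<bar> \<le> L"
     "\<And>e \<phi>. e \<in> Basis \<Longrightarrow> test_function \<phi> \<Longrightarrow> (\<And>x. 0 \<le> \<phi> x) \<Longrightarrow>
        (LINT x|lborel. ?M x * frechet_derivative \<phi> (at x) e) = - (LINT x|lborel. h e x * \<phi> x)"
     "\<And>e. e \<in> Basis \<Longrightarrow> (AE x in lborel. \<forall>p\<in>?S e x. h e x = p)"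
    using hP by (blast, blast, blast, blast)
  define G where "G x = (\<Sum>e\<in>Basis. h e x *\<^sub>R e)" for x
  have G: "G x \<bullet> e = h e x" if "e \<in> Basis" for x e
    using that by (simp add: G_def inner_sum_left inner_Basis if_distrib[of "(*) _"] cong: if_cong)
  have [measurable]: "G \<in> borel_measurable borel"
    unfolding G_def by (intro borel_measurable_sum borel_measurable_scaleR h) auto
  have GL: "norm (G x) \<le> DIM('a) * L" for x
  proof -
    have "norm (G x) \<le> (\<Sum>e\<in>Basis. \<bar>G x \<bullet> e\<bar>)" by (rule norm_le_l1)
    also have "\<dots> \<le> (\<Sum>e\<in>(Basis::'a set). L)" using G h(2) by (intro sum_mono) simp
    finally show ?thesis by simp
  qed
  show ?thesis
  proof (rule that[of G])
    show "wgrad ?M G"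
    proof (rule wgradI_nonneg)
      show "locint ?M" by (rule continuous_imp_locint[OF cont])
      show "locint G" by (rule bounded_imp_locint[OF _ GL]) measurable
    qed (use h(3) G in simp)
    have "AE x in lborel. \<forall>e\<in>Basis. \<forall>p\<in>?S e x. h e x = p"
      using h(4) by (intro AE_finite_allI) auto
    then show "AE x in lborel. \<forall>r\<in>?I. frac_mean \<beta> F r x = ?M x \<longrightarrow> (\<forall>e\<in>Basis. G x \<bullet> e = frac_mean \<beta> (\<lambda>y. w y \<bullet> e) r x)"
    proof eventually_elim
      case (elim x)
      show ?case
      proof (intro ballI impI)
        fix r and e :: 'a assume "r \<in> ?I" "frac_mean \<beta> F r x = ?M x" "e \<in> Basis"
        then have "h e x = frac_mean \<beta> (\<lambda>y. w y \<bullet> e) r x" using elim by blast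
        then show "G x \<bullet> e = frac_mean \<beta> (\<lambda>y. w y \<bullet> e) r x" using G \<open>e \<in> Basis\<close> by simp
      qed
    qed
  qed
qed

text \<open>Fubini's theorem, since \<open>y\<close> lies in the ball about \<open>x\<close> if and only if \<open>x\<close> lies in the ball
  about \<open>y\<close>.\<close>

lemma nn_integral_ball_average:
  fixes k :: "'a::euclidean_space \<Rightarrow> ennreal"
  assumes [measurable]: "k \<in> borel_measurable borel" and s: "0 \<le> s"
  shows "(\<integral>\<^sup>+x. (\<integral>\<^sup>+y. indicator (ball x s) y * k y \<partial>lborel) \<partial>lborel)
    = ennreal (unit_ball_vol DIM('a) * s ^ DIM('a)) * (\<integral>\<^sup>+y. k y \<partial>lborel)"
proof -
  have ind: "indicator (ball x s) y = (indicator {p. dist (fst p) (snd p) < s} (x, y) :: ennreal)" for x y :: 'a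
    by (auto simp: indicator_def)
  have [measurable]: "{p. dist (fst p) (snd p :: 'a) < s} \<in> sets (borel \<Otimes>\<^sub>M borel)"
    unfolding borel_prod by (intro borel_open open_Collect_less continuous_intros)
  have "(\<integral>\<^sup>+x. (\<integral>\<^sup>+y. indicator (ball x s) y * k y \<partial>lborel) \<partial>lborel)
     = (\<integral>\<^sup>+y. (\<integral>\<^sup>+x. indicator (ball x s) y * k y \<partial>lborel) \<partial>lborel)"
    unfolding ind by (rule lborel_pair.Fubini'[symmetric]) measurable
  also have "\<dots> = (\<integral>\<^sup>+y. ennreal (unit_ball_vol DIM('a) * s ^ DIM('a)) * k y \<partial>lborel)"
  proof (intro nn_integral_cong)
    fix y
    have "(\<integral>\<^sup>+x. indicator (ball x s) y * k y \<partial>lborel) = (\<integral>\<^sup>+x. k y * indicator (ball y s) x \<partial>lborel)"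
      by (intro nn_integral_cong) (auto simp: indicator_def dist_commute)
    also have "\<dots> = k y * emeasure lborel (ball y s)" by (simp add: nn_integral_cmult)
    finally show "(\<integral>\<^sup>+x. indicator (ball x s) y * k y \<partial>lborel) = ennreal (unit_ball_vol DIM('a) * s ^ DIM('a)) * k y"
      using s by (simp add: emeasure_ball mult.commute)
  qed
  also have "\<dots> = ennreal (unit_ball_vol DIM('a) * s ^ DIM('a)) * (\<integral>\<^sup>+y. k y \<partial>lborel)"
    by (rule nn_integral_cmult) measurable
  finally show ?thesis .
qed

text \<open>Decomposing the radii dyadically bounds all fractional averages by one locally integrable
  function: the powers of the radius gain a convergent geometric series because \<open>\<beta> > 0\<close>.\<close>

lemma frac_mean_dominated:
  fixes k :: "'a::euclidean_space \<Rightarrow> real"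
  assumes k: "integrable lborel k" and nn: "\<And>y. 0 \<le> k y" and \<beta>: "0 < \<beta>" "\<beta> < real DIM('a)"
  obtains D where "locint D" "AE x in lborel. \<forall>r>0. frac_mean \<beta> k r x \<le> D x"
proof -
  have [measurable]: "k \<in> borel_measurable borel" using borel_measurable_integrable[OF k] by simp
  define d where "d = real DIM('a)"
  define \<omega> where "\<omega> = unit_ball_vol d"
  have \<omega>: "\<omega> > 0" by (simp add: \<omega>_def d_def)
  define K where "K = (LINT y|lborel. k y)"
  have K: "K \<ge> 0" using nn by (simp add: K_def integral_nonneg_AE)
  have intk: "(\<integral>\<^sup>+y. ennreal (k y) \<partial>lborel) = ennreal K"
    unfolding K_def using nn by (intro nn_integral_eq_integral k) auto
  define c where "c j = ((1/2) ^ Suc j) powr (\<beta> - d) / \<omega>" for j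
  have c: "c j \<ge> 0" for j using \<omega> by (simp add: c_def)
  define b where "b j x = (\<integral>\<^sup>+y. indicator (ball x ((1/2) ^ j)) y * ennreal (k y) \<partial>lborel)" for j and x :: 'a
  have b: "b j x = ennreal (LINT y|lborel. indicator (ball x ((1/2) ^ j)) y * k y)" for j x
  proof -
    have "b j x = (\<integral>\<^sup>+y. ennreal (indicator (ball x ((1/2) ^ j)) y * k y) \<partial>lborel)"
      unfolding b_def by (intro nn_integral_cong) (auto simp: indicator_def)
    then show ?thesis using nn by (simp add: nn_integral_eq_integral ball_mult_integrable[OF k])
  qed
  have ind: "indicator (ball x s) y = (indicator {p. dist (fst p) (snd p) < s} (x, y) :: ennreal)" for x y :: 'a and s
    by (auto simp: indicator_def)
  have [measurable]: "{p. dist (fst p) (snd p :: 'a) < s} \<in> sets (borel \<Otimes>\<^sub>M borel)" for s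
    unfolding borel_prod by (intro borel_open open_Collect_less continuous_intros)
  have [measurable]: "b j \<in> borel_measurable borel" for j
    unfolding b_def[abs_def] ind by measurable
  define S where "S x = (\<Sum>j. ennreal (c j) * b j x)" for x
  have [measurable]: "S \<in> borel_measurable borel" unfolding S_def by measurable
  define \<theta> where "\<theta> = (1/2) powr \<beta>"
  have \<theta>: "0 \<le> \<theta>" "\<theta> < 1"
    using \<beta> powr01_less_one[of "1/2" \<beta>] by (auto simp: \<theta>_def)
  have "(\<integral>\<^sup>+x. S x \<partial>lborel) = (\<Sum>j. \<integral>\<^sup>+x. ennreal (c j) * b j x \<partial>lborel)"
    unfolding S_def by (rule nn_integral_suminf) measurable
  also have "\<dots> = (\<Sum>j. ennreal ((1/2) powr (\<beta> - d) * K * \<theta> ^ j))"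
  proof (intro suminf_cong)
    fix j
    have "(\<integral>\<^sup>+x. ennreal (c j) * b j x \<partial>lborel) = ennreal (c j) * (ennreal (\<omega> * ((1/2) ^ j) ^ DIM('a)) * ennreal K)"
    proof -
      have "(\<integral>\<^sup>+x. b j x \<partial>lborel) = ennreal (\<omega> * ((1/2) ^ j) ^ DIM('a)) * ennreal K"
        unfolding b_def by (subst nn_integral_ball_average) (auto simp: intk \<omega>_def d_def)
      then show ?thesis by (simp add: nn_integral_cmult)
    qed
    also have "\<dots> = ennreal (c j * (\<omega> * ((1/2) ^ j) ^ DIM('a) * K))"
      using c \<omega> K by (simp add: ennreal_mult)
    also have "c j * (\<omega> * ((1/2) ^ j) ^ DIM('a) * K) = (1/2) powr (\<beta> - d) * K * \<theta> ^ j"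
    proof -
      have 1: "((1/2::real) ^ Suc j) powr (\<beta> - d) = (1/2) powr (\<beta> - d) * (1/2) powr (real j * (\<beta> - d))"
        by (simp add: powr_realpow[symmetric] powr_powr powr_add[symmetric] algebra_simps del: power_Suc)
      have 2: "((1/2::real) ^ j) ^ DIM('a) = (1/2) powr (real j * d)"
        by (simp add: powr_realpow[symmetric] powr_powr d_def flip: power_mult)
      have 3: "\<theta> ^ j = (1/2) powr (real j * \<beta>)"
        by (simp add: \<theta>_def powr_realpow[symmetric] powr_powr mult.commute)
      have "(1/2::real) powr (real j * (\<beta> - d)) * (1/2) powr (real j * d) = \<theta> ^ j"
        unfolding 3 by (simp add: powr_add[symmetric] algebra_simps)
      then show ?thesis using \<omega> unfolding c_def 1 2 by simp
    qed
    finally show "(\<integral>\<^sup>+x. ennreal (c j) * b j x \<partial>lborel) = ennreal ((1/2) powr (\<beta> - d) * K * \<theta> ^ j)" .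
  qed
  also have "\<dots> < \<infinity>"
    using \<theta> K by (subst suminf_ennreal2) (auto intro!: summable_mult summable_geometric)
  finally have S: "(\<integral>\<^sup>+x. S x \<partial>lborel) < \<infinity>" .
  have AE: "AE x in lborel. S x \<noteq> \<infinity>"
    by (rule nn_integral_PInf_AE) (use S in auto)
  have iS: "integrable lborel (\<lambda>x. enn2real (S x))"
  proof (rule integrableI_nonneg)
    have "(\<integral>\<^sup>+x. ennreal (enn2real (S x)) \<partial>lborel) = (\<integral>\<^sup>+x. S x \<partial>lborel)"
      using AE by (intro nn_integral_cong_AE) (auto simp: less_top)
    then show "(\<integral>\<^sup>+x. ennreal (enn2real (S x)) \<partial>lborel) < \<infinity>" using S by simp
  qed auto
  show ?thesis
  proof (rule that[of "\<lambda>x. enn2real (S x) + K / \<omega>"])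
    have "locint (\<lambda>x::'a. K / \<omega>)" by (intro continuous_imp_locint continuous_intros)
    then show "locint (\<lambda>x. enn2real (S x) + K / \<omega>)"
      by (rule locint_add[OF integrable_imp_locint[OF iS]])
    show "AE x in lborel. \<forall>r>0. frac_mean \<beta> k r x \<le> enn2real (S x) + K / \<omega>"
      using AE
    proof eventually_elim
      fix x assume Sx: "S x \<noteq> \<infinity>"
      show "\<forall>r>0. frac_mean \<beta> k r x \<le> enn2real (S x) + K / \<omega>"
      proof (intro allI impI)
        fix r :: real assume r: "r > 0"
        show "frac_mean \<beta> k r x \<le> enn2real (S x) + K / \<omega>"
        proof (cases "r \<ge> 1")
          case True
          have "frac_mean \<beta> k r x \<le> r powr (\<beta> - d) / \<omega> * K"
            using frac_mean_abs_le[OF k, of \<beta> r x] nn by (simp add: d_def \<omega>_def K_def)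
          also have "r powr (\<beta> - d) \<le> 1 powr (\<beta> - d)"
            using True \<beta> by (intro powr_mono2') (auto simp: d_def)
          then have "r powr (\<beta> - d) / \<omega> * K \<le> 1 / \<omega> * K"
            using \<omega> K by (intro mult_right_mono divide_right_mono) auto
          finally show ?thesis using enn2real_nonneg[of "S x"] by (simp add: add_increasing)
        next
          case False
          \<comment> \<open>The index \<open>j\<close> of the dyadic interval with \<open>2\<^sup>-\<^sup>j\<^sup>-\<^sup>1 < r \<le> 2\<^sup>-\<^sup>j\<close>.\<close>
          define N where "N = (LEAST n. (1/2) ^ n < r)"
          obtain m where "(1/2) ^ m < r" using real_arch_pow_inv[OF r, of "1/2"] by auto
          then have N: "(1/2) ^ N < r" unfolding N_def by (rule LeastI)
          then have "N \<noteq> 0" using False by (cases N) auto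
          then obtain j where j: "N = Suc j" by (cases N) auto
          have rj: "r \<le> (1/2) ^ j" using not_less_Least[of j "\<lambda>n. (1/2) ^ n < r"] j by (simp add: N_def[symmetric])
          have "frac_mean \<beta> k r x \<le> c j * (LINT y|lborel. indicator (ball x ((1/2) ^ j)) y * k y)"
            unfolding frac_mean_def c_def \<omega>_def d_def
          proof (intro mult_mono divide_right_mono)
            show "r powr (\<beta> - real DIM('a)) \<le> ((1/2) ^ Suc j) powr (\<beta> - real DIM('a))"
              using N j \<beta> by (intro powr_mono2') auto
            show "(LINT y|lborel. indicator (ball x r) y * k y) \<le> (LINT y|lborel. indicator (ball x ((1/2) ^ j)) y * k y)"
              using rj nn by (intro integral_mono ball_mult_integrable k) (auto simp: indicator_def)
          qed (use nn in \<open>auto intro!: integral_nonneg_AE\<close>)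
          then have "ennreal (frac_mean \<beta> k r x) \<le> ennreal (c j) * b j x"
            unfolding b using c by (subst ennreal_mult[symmetric]) (use nn in \<open>auto intro!: ennreal_leI integral_nonneg_AE\<close>)
          also have "\<dots> \<le> S x"
            unfolding S_def using sum_le_suminf[of "\<lambda>j. ennreal (c j) * b j x" "{j}"] by simp
          also have "S x = ennreal (enn2real (S x))" using Sx by (simp add: less_top)
          finally have "frac_mean \<beta> k r x \<le> enn2real (S x)" by (simp add: ennreal_le_iff)
          then show ?thesis using K \<omega> by (simp add: add_increasing2)
        qed
      qed
    qed
  qed
qed

text \<open>Optimality in terms of real means instead of an extended supremum; \<open>optimal_radius_max_ball\<close>
  gives the connection with \<open>max_balls\<close>.\<close>

definition optimal_radius :: "real \<Rightarrow> ('a::euclidean_space \<Rightarrow> real) \<Rightarrow> 'a \<Rightarrow> real \<Rightarrow> bool" where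
  "optimal_radius \<beta> F x r \<longleftrightarrow> r > 0 \<and> (\<forall>s>0. frac_mean \<beta> F s x \<le> frac_mean \<beta> F r x)"

lemma optimal_radius_trunc_max:
  fixes F :: "'a::euclidean_space \<Rightarrow> real"
  assumes F: "integrable lborel F" and r: "optimal_radius \<beta> F x r" "r \<in> {1 / real (Suc n)..real (Suc n)}"
  shows "trunc_max \<beta> F n x = frac_mean \<beta> F r x"
proof -
  obtain r' where r': "r' \<in> {1 / real (Suc n)..real (Suc n)}" "frac_mean \<beta> F r' x = trunc_max \<beta> F n x"
    "\<And>s. s \<in> {1 / real (Suc n)..real (Suc n)} \<Longrightarrow> frac_mean \<beta> F s x \<le> trunc_max \<beta> F n x"
    using trunc_max_attained[OF F, of n \<beta> x] by metis
  have "0 < 1 / real (Suc n)" by simp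
  then have "r' > 0" using r'(1) by (meson atLeastAtMost_iff less_le_trans)
  then show ?thesis using r'(2) r'(3)[OF r(2)] r(1) unfolding optimal_radius_def by (metis antisym)
qed

lemma eventually_in_exhausting_interval:
  assumes "r > 0" shows "\<forall>\<^sub>F n in sequentially. r \<in> {1 / real (Suc n)..real (Suc n)}"
proof -
  have "(\<lambda>n. 1 / real (Suc n)) \<longlonglongrightarrow> 0" using LIMSEQ_Suc[OF lim_1_over_n[where 'a=real]] by simp
  then have "\<forall>\<^sub>F n in sequentially. 1 / real (Suc n) < r" using assms by (intro order_tendstoD) auto
  moreover obtain N where N: "r \<le> real N" using real_arch_simple by blast
  have "\<forall>\<^sub>F n in sequentially. r \<le> real (Suc n)"
    using eventually_ge_at_top[of N] by eventually_elim (use N in auto)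
  ultimately show ?thesis by eventually_elim auto
qed

text \<open>At a point with an optimal radius the truncated maximal functions and their gradients are
  eventually constant, and both are dominated, so the weak gradient passes to the limit.\<close>

lemma maximal_wgrad:
  fixes F M :: "'a::euclidean_space \<Rightarrow> real"
  assumes w: "wgrad F w" and F: "integrable lborel F" and iw: "integrable lborel w"
    and nn: "\<And>y. 0 \<le> F y" and \<beta>: "0 < \<beta>" "\<beta> < real DIM('a)"
    and ex: "AE x in lborel. \<exists>r. optimal_radius \<beta> F x r"
    and M: "\<And>x r. optimal_radius \<beta> F x r \<Longrightarrow> M x = frac_mean \<beta> F r x"
    and Mm [measurable]: "M \<in> borel_measurable borel"
  obtains G where "wgrad M G"
    "AE x in lborel. \<forall>r. optimal_radius \<beta> F x r \<longrightarrow> (\<forall>e\<in>Basis. G x \<bullet> e = frac_mean \<beta> (\<lambda>y. w y \<bullet> e) r x)"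
proof -
  let ?I = "\<lambda>n. {1 / real (Suc n)..real (Suc n)}"
  have pos: "r > 0" if "r \<in> ?I n" for r n
    using that less_le_trans[of 0 "1 / real (Suc n)" r] by simp
  have "\<exists>G. wgrad (trunc_max \<beta> F n) G \<and>
    (AE x in lborel. \<forall>r\<in>?I n. frac_mean \<beta> F r x = trunc_max \<beta> F n x \<longrightarrow>
       (\<forall>e\<in>Basis. G x \<bullet> e = frac_mean \<beta> (\<lambda>y. w y \<bullet> e) r x))" (is "\<exists>G. ?P n G") for n
    by (rule trunc_max_wgrad[OF w F iw \<beta>(2), of n]) blast
  then have "\<exists>G. \<forall>n. ?P n (G n)" by (intro choice allI)
  then obtain G where GP: "\<forall>n. ?P n (G n)" ..
  then have G: "\<And>n. wgrad (trunc_max \<beta> F n) (G n)"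
    and GAE: "\<And>n. AE x in lborel. \<forall>r\<in>?I n. frac_mean \<beta> F r x = trunc_max \<beta> F n x \<longrightarrow>
       (\<forall>e\<in>Basis. G n x \<bullet> e = frac_mean \<beta> (\<lambda>y. w y \<bullet> e) r x)"
    by blast+
  have lG: "locint (G n)" and lT: "locint (trunc_max \<beta> F n)" for n using G[of n] by (auto simp: wgrad_def)
  note [measurable] = lG[THEN locint_measurable] lT[THEN locint_measurable]
  obtain D1 where D1: "locint D1" "AE x in lborel. \<forall>r>0. frac_mean \<beta> F r x \<le> D1 x"
    by (rule frac_mean_dominated[OF F nn \<beta>])
  obtain D2 where D2: "locint D2" "AE x in lborel. \<forall>r>0. frac_mean \<beta> (\<lambda>y. norm (w y)) r x \<le> D2 x"
    by (rule frac_mean_dominated[OF integrable_norm[OF iw] norm_ge_zero \<beta>])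
  note [measurable] = D1(1)[THEN locint_measurable] D2(1)[THEN locint_measurable]
  define H where "H x = (\<Sum>e\<in>Basis. lim (\<lambda>n. G n x \<bullet> e) *\<^sub>R e)" for x
  have He: "H x \<bullet> e = lim (\<lambda>n. G n x \<bullet> e)" if "e \<in> Basis" for x e
    using that by (simp add: H_def inner_sum_left inner_Basis if_distrib[of "(*) _"] cong: if_cong)
  have [measurable]: "H \<in> borel_measurable borel" unfolding H_def by measurable
  have good: "AE x in lborel. (\<exists>r. optimal_radius \<beta> F x r) \<and> (\<forall>r>0. frac_mean \<beta> F r x \<le> D1 x) \<and>
      (\<forall>r>0. frac_mean \<beta> (\<lambda>y. norm (w y)) r x \<le> D2 x) \<and>
      (\<forall>n. \<forall>r\<in>?I n. frac_mean \<beta> F r x = trunc_max \<beta> F n x \<longrightarrow>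
       (\<forall>e\<in>Basis. G n x \<bullet> e = frac_mean \<beta> (\<lambda>y. w y \<bullet> e) r x))" (is "AE x in lborel. ?good x")
    using ex D1(2) D2(2) GAE by (intro AE_conjI AE_all_countable[THEN iffD2] allI)
  have limT: "trunc_max \<beta> F n x \<le> D1 x" "0 \<le> trunc_max \<beta> F n x"
    "\<And>e. e \<in> Basis \<Longrightarrow> \<bar>G n x \<bullet> e\<bar> \<le> D2 x" if "?good x" for x n
  proof -
    obtain r where r: "r \<in> ?I n" "frac_mean \<beta> F r x = trunc_max \<beta> F n x"
      using trunc_max_attained[OF F, of n \<beta> x] by metis
    show "trunc_max \<beta> F n x \<le> D1 x" "0 \<le> trunc_max \<beta> F n x"
      using that r(2)[symmetric] pos[OF r(1)] frac_mean_nonneg[of F \<beta> r x] nn by auto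
    fix e :: 'a assume e: "e \<in> Basis"
    have "G n x \<bullet> e = frac_mean \<beta> (\<lambda>y. w y \<bullet> e) r x" using that r e by auto
    also have "\<bar>\<dots>\<bar> \<le> frac_mean \<beta> (\<lambda>y. norm (w y)) r x"
      using iw e by (intro frac_mean_abs_mono) (auto simp: Basis_le_norm)
    also have "\<dots> \<le> D2 x" using that pos[OF r(1)] by auto
    finally show "\<bar>G n x \<bullet> e\<bar> \<le> D2 x" by simp
  qed
  have ev: "\<forall>\<^sub>F n in sequentially. trunc_max \<beta> F n x = M x"
    "\<And>e. e \<in> Basis \<Longrightarrow> \<forall>\<^sub>F n in sequentially. G n x \<bullet> e = frac_mean \<beta> (\<lambda>y. w y \<bullet> e) r x"
    if "?good x" "optimal_radius \<beta> F x r" for x r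
  proof -
    have r: "r > 0" using that by (auto simp: optimal_radius_def)
    show "\<forall>\<^sub>F n in sequentially. trunc_max \<beta> F n x = M x"
      using eventually_in_exhausting_interval[OF r]
      by eventually_elim (simp only: optimal_radius_trunc_max[OF F that(2)] M[OF that(2)])
    fix e :: 'a assume e: "e \<in> Basis"
    show "\<forall>\<^sub>F n in sequentially. G n x \<bullet> e = frac_mean \<beta> (\<lambda>y. w y \<bullet> e) r x"
      using eventually_in_exhausting_interval[OF r]
    proof eventually_elim
      case (elim n)
      then show ?case using that(1) e optimal_radius_trunc_max[OF F that(2) elim] by (metis (no_types, lifting))
    qed
  qed
  have HV: "H x \<bullet> e = frac_mean \<beta> (\<lambda>y. w y \<bullet> e) r x" if "?good x" "optimal_radius \<beta> F x r" "e \<in> Basis" for x r e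
    unfolding He[OF that(3)] by (rule limI, rule tendsto_eventually, rule ev(2)[OF that])
  have limG: "(\<lambda>n. G n x \<bullet> e) \<longlonglongrightarrow> H x \<bullet> e" if "?good x" "e \<in> Basis" for x e
  proof -
    from that(1) obtain r where r: "optimal_radius \<beta> F x r" by (elim conjE exE)
    show ?thesis unfolding HV[OF that(1) r that(2)] by (rule tendsto_eventually, rule ev(2)[OF that(1) r that(2)])
  qed
  have limM: "(\<lambda>n. trunc_max \<beta> F n x) \<longlonglongrightarrow> M x" if "?good x" for x
  proof -
    from that obtain r where r: "optimal_radius \<beta> F x r" by (elim conjE exE)
    show ?thesis by (rule tendsto_eventually, rule ev(1)[OF that r])
  qed
  have MD: "\<bar>M x\<bar> \<le> D1 x" if "?good x" for x
    using LIMSEQ_le_const2[OF limM[OF that], of "D1 x"] LIMSEQ_le_const[OF limM[OF that], of 0] limT[OF that] by auto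
  have HD: "norm (H x) \<le> DIM('a) * D2 x" if "?good x" for x
  proof -
    have "\<bar>H x \<bullet> e\<bar> \<le> D2 x" if e: "e \<in> Basis" for e
      using LIMSEQ_le_const2[OF tendsto_rabs[OF limG[OF \<open>?good x\<close> e]], of "D2 x"] limT(3)[OF \<open>?good x\<close> e] by auto
    then have "(\<Sum>e\<in>Basis. \<bar>H x \<bullet> e\<bar>) \<le> (\<Sum>e\<in>(Basis::'a set). D2 x)" by (intro sum_mono) simp
    then show ?thesis using norm_le_l1[of "H x"] by simp
  qed
  have lM: "locint M"
    unfolding locint_def
  proof (intro conjI allI Mm)
    fix R
    show "integrable lborel (\<lambda>x. indicator (cball 0 R) x *\<^sub>R M x)"
    proof (rule Bochner_Integration.integrable_bound)
      show "integrable lborel (\<lambda>x. indicator (cball 0 R) x *\<^sub>R D1 x)" using D1 by (auto simp: locint_def)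
      show "AE x in lborel. norm (indicator (cball 0 R) x *\<^sub>R M x) \<le> norm (indicator (cball 0 R) x *\<^sub>R D1 x)"
        using good
      proof eventually_elim
        case (elim x)
        then show ?case using MD[of x] by (auto simp: indicator_def)
      qed
    qed measurable
  qed
  have lH: "locint H"
    unfolding locint_def
  proof (intro conjI allI)
    fix R
    show "integrable lborel (\<lambda>x. indicator (cball 0 R) x *\<^sub>R H x)"
    proof (rule Bochner_Integration.integrable_bound)
      show "integrable lborel (\<lambda>x. DIM('a) * (indicator (cball 0 R) x *\<^sub>R D2 x))"
        using D2 unfolding locint_def by (intro integrable_mult_right) auto
      show "AE x in lborel. norm (indicator (cball 0 R) x *\<^sub>R H x) \<le> norm (DIM('a) * (indicator (cball 0 R) x *\<^sub>R D2 x))"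
        using good
      proof eventually_elim
        case (elim x)
        then show ?case using order_trans[OF HD[of x] abs_ge_self] by (auto simp: indicator_def)
      qed
    qed measurable
  qed measurable
  have "wgrad M H"
    unfolding wgrad_def
  proof (intro conjI allI impI ballI lM lH)
    fix \<phi> :: "'a \<Rightarrow> real" and e :: 'a assume \<phi>: "test_function \<phi>" and e: "e \<in> Basis"
    note [measurable] = test_function_measurable[OF \<phi>]
    have "(\<lambda>n. LINT x|lborel. trunc_max \<beta> F n x * frechet_derivative \<phi> (at x) e)
      \<longlonglongrightarrow> (LINT x|lborel. M x * frechet_derivative \<phi> (at x) e)"
    proof (rule integral_dominated_convergence[where w="\<lambda>x. \<bar>D1 x * frechet_derivative \<phi> (at x) e\<bar>"])
      show "AE x in lborel. (\<lambda>n. trunc_max \<beta> F n x * frechet_derivative \<phi> (at x) e) \<longlonglongrightarrow> M x * frechet_derivative \<phi> (at x) e"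
        using good by eventually_elim (intro tendsto_mult tendsto_const limM)
      show "AE x in lborel. norm (trunc_max \<beta> F n x * frechet_derivative \<phi> (at x) e) \<le> \<bar>D1 x * frechet_derivative \<phi> (at x) e\<bar>" for n
        using good
      proof eventually_elim
        case (elim x)
        then show ?case using limT(1,2)[of x n] by (auto simp: abs_mult intro!: mult_right_mono)
      qed
    qed (use locint_mult_test(2)[OF D1(1) \<phi>] in \<open>auto intro!: integrable_abs\<close>)
    moreover have "(\<lambda>n. - (LINT x|lborel. (G n x \<bullet> e) * \<phi> x)) \<longlonglongrightarrow> - (LINT x|lborel. (H x \<bullet> e) * \<phi> x)"
    proof (intro tendsto_minus integral_dominated_convergence[where w="\<lambda>x. \<bar>D2 x * \<phi> x\<bar>"])
      show "AE x in lborel. (\<lambda>n. (G n x \<bullet> e) * \<phi> x) \<longlonglongrightarrow> (H x \<bullet> e) * \<phi> x"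
        using good by eventually_elim (intro tendsto_mult tendsto_const limG e)
      show "AE x in lborel. norm ((G n x \<bullet> e) * \<phi> x) \<le> \<bar>D2 x * \<phi> x\<bar>" for n
        using good
      proof eventually_elim
        case (elim x)
        then show ?case using order_trans[OF limT(3)[of x e n] abs_ge_self] e by (auto simp: abs_mult intro!: mult_right_mono)
      qed
    qed (use locint_mult_test(1)[OF D2(1) \<phi>] in \<open>auto intro!: integrable_abs\<close>)
    moreover have "(LINT x|lborel. trunc_max \<beta> F n x * frechet_derivative \<phi> (at x) e) = - (LINT x|lborel. (G n x \<bullet> e) * \<phi> x)" for n
      using G[of n] \<phi> e by (simp add: wgrad_def)
    ultimately show "(LINT x|lborel. M x * frechet_derivative \<phi> (at x) e) = - (LINT x|lborel. (H x \<bullet> e) * \<phi> x)"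
      using LIMSEQ_unique by auto
  qed
  moreover have "AE x in lborel. \<forall>r. optimal_radius \<beta> F x r \<longrightarrow> (\<forall>e\<in>Basis. H x \<bullet> e = frac_mean \<beta> (\<lambda>y. w y \<bullet> e) r x)"
    using good
  proof eventually_elim
    case (elim x)
    then show ?case using HV[of x] by blast
  qed
  ultimately show ?thesis by (rule that)
qed

section \<open>Averages of radial functions away from the origin\<close>

text \<open>Averaging over translates by the points of the unit ball, which the transformation
  preserves, reduces invariance under an isometry to invariance under translations.\<close>

lemma nn_integral_orthogonal:
  fixes T :: "'a::euclidean_space \<Rightarrow> 'a"
  assumes T: "orthogonal_transformation T" and F [measurable]: "F \<in> borel_measurable borel"
  shows "(\<integral>\<^sup>+x. F (T x) \<partial>lborel) = (\<integral>\<^sup>+x. F x \<partial>lborel)"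
proof -
  have lin: "linear T" using T by (rule orthogonal_transformation_linear)
  then have [measurable]: "T \<in> borel_measurable borel"
    by (intro borel_measurable_continuous_onI linear_continuous_on) (simp add: linear_conv_bounded_linear)
  have dist: "dist (T x) (T y) = dist x y" for x y
    using T lin by (simp add: dist_norm orthogonal_transformation_norm flip: linear_diff)
  obtain S where S: "\<And>y. T (S y) = y"
    using orthogonal_transformation_surj[OF T] by (metis surj_def)
  let ?B = "ball (0::'a) 1"
  define c where "c = emeasure lborel ?B"
  have c: "c \<noteq> 0" "c \<noteq> \<infinity>" by (auto simp: c_def emeasure_ball)
  have cball: "emeasure lborel (ball x 1 :: 'a set) = c" for x by (simp add: c_def emeasure_ball)
  have m: "(\<lambda>(x, y). indicator ?B y * F (T x + y)) \<in> borel_measurable (lborel \<Otimes>\<^sub>M lborel)"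
    by measurable
  have m2: "(\<lambda>(x, z). indicator ?B (z - T x) * F z) \<in> borel_measurable (lborel \<Otimes>\<^sub>M lborel)"
    by measurable
  have "c * (\<integral>\<^sup>+x. F (T x) \<partial>lborel) = (\<integral>\<^sup>+y. indicator ?B y * (\<integral>\<^sup>+x. F (T x) \<partial>lborel) \<partial>lborel)"
    by (subst nn_integral_multc) (auto simp: c_def)
  also have "\<dots> = (\<integral>\<^sup>+y. indicator ?B y * (\<integral>\<^sup>+x. F (T x + y) \<partial>lborel) \<partial>lborel)"
  proof (intro nn_integral_cong)
    fix y
    have "(\<integral>\<^sup>+x. F (T (x + S y)) \<partial>lborel) = (\<integral>\<^sup>+x. F (T x) \<partial>lborel)"
      by (rule nn_integral_shift) measurable
    then show "indicator ?B y * (\<integral>\<^sup>+x. F (T x) \<partial>lborel) = indicator ?B y * (\<integral>\<^sup>+x. F (T x + y) \<partial>lborel)"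
      using lin S by (simp add: linear_add)
  qed
  also have "\<dots> = (\<integral>\<^sup>+y. (\<integral>\<^sup>+x. indicator ?B y * F (T x + y) \<partial>lborel) \<partial>lborel)"
    by (simp add: nn_integral_cmult)
  also have "\<dots> = (\<integral>\<^sup>+x. (\<integral>\<^sup>+y. indicator ?B y * F (T x + y) \<partial>lborel) \<partial>lborel)"
    using lborel_pair.Fubini'[OF m] by simp
  also have "\<dots> = (\<integral>\<^sup>+x. (\<integral>\<^sup>+z. indicator ?B (z - T x) * F z \<partial>lborel) \<partial>lborel)"
  proof (rule nn_integral_cong)
    fix x
    show "(\<integral>\<^sup>+y. indicator ?B y * F (T x + y) \<partial>lborel) = (\<integral>\<^sup>+z. indicator ?B (z - T x) * F z \<partial>lborel)"
    proof -
      have m: "(\<lambda>z. indicator ?B (z - T x) * F z) \<in> borel_measurable borel" by measurable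
      show ?thesis using nn_integral_shift[OF m, of "T x"] by (simp add: add.commute)
    qed
  qed
  also have "\<dots> = (\<integral>\<^sup>+z. (\<integral>\<^sup>+x. indicator ?B (z - T x) * F z \<partial>lborel) \<partial>lborel)"
    using lborel_pair.Fubini'[OF m2] by simp
  also have "\<dots> = (\<integral>\<^sup>+z. c * F z \<partial>lborel)"
  proof (intro nn_integral_cong)
    fix z
    have "indicator ?B (z - T x) = (indicator (ball (S z) 1) x :: ennreal)" for x
      using dist[of "S z" x] S[of z] by (auto simp: indicator_def dist_norm norm_minus_commute)
    then show "(\<integral>\<^sup>+x. indicator ?B (z - T x) * F z \<partial>lborel) = c * F z"
      by (simp add: nn_integral_multc cball)
  qed
  also have "\<dots> = c * (\<integral>\<^sup>+z. F z \<partial>lborel)" by (simp add: nn_integral_cmult)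
  finally show ?thesis using c by (simp add: ennreal_mult_cancel_left)
qed

lemma radial_ball_integral_eq:
  fixes f :: "real ^ 'n \<Rightarrow> real"
  assumes rad: "AE x in lborel. f x = h (norm x)" and [measurable]: "f \<in> borel_measurable borel"
    and xz: "norm x = norm z"
  shows "(\<integral>\<^sup>+y. indicator (ball x r) y * ennreal \<bar>f y\<bar> \<partial>lborel)
    = (\<integral>\<^sup>+y. indicator (ball z r) y * ennreal \<bar>f y\<bar> \<partial>lborel)"
proof -
  obtain T where T: "orthogonal_transformation T" "T x = z"
    using orthogonal_transformation_exists[OF xz] by metis
  have lin: "linear T" using T by (auto intro: orthogonal_transformation_linear)
  then have [measurable]: "T \<in> borel_measurable borel"
    by (intro borel_measurable_continuous_onI linear_continuous_on) (simp add: linear_conv_bounded_linear)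
  have norm: "norm (T y) = norm y" for y using T by (simp add: orthogonal_transformation_norm)
  have dist: "dist z (T y) = dist x y" for y
    using T lin norm[of "x - y"] by (simp add: dist_norm linear_diff)
  obtain N where N: "N \<in> null_sets lborel" "\<And>y. y \<notin> N \<Longrightarrow> f y = h (norm y)"
    using rad by (auto elim!: AE_E3)
  have [measurable]: "N \<in> sets borel" using N by auto
  have "(\<integral>\<^sup>+y. indicator N (T y) \<partial>lborel) = (\<integral>\<^sup>+y. indicator N y \<partial>lborel)"
    by (rule nn_integral_orthogonal[OF T(1)]) measurable
  also have "\<dots> = 0" using N by auto
  finally have "AE y in lborel. indicator N (T y) = (0::ennreal)"
    by (subst (asm) nn_integral_0_iff_AE) auto
  then have inv: "AE y in lborel. f (T y) = f y"
    using AE_not_in[OF N(1)]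
  proof eventually_elim
    case (elim y)
    then show ?case using N(2)[of y] N(2)[of "T y"] norm[of y] by (auto simp: indicator_def split: if_splits)
  qed
  have "(\<integral>\<^sup>+y. indicator (ball z r) y * ennreal \<bar>f y\<bar> \<partial>lborel)
      = (\<integral>\<^sup>+y. indicator (ball z r) (T y) * ennreal \<bar>f (T y)\<bar> \<partial>lborel)"
    by (rule nn_integral_orthogonal[OF T(1), symmetric]) measurable
  also have "\<dots> = (\<integral>\<^sup>+y. indicator (ball x r) y * ennreal \<bar>f y\<bar> \<partial>lborel)"
    using inv by (intro nn_integral_cong_AE) (auto simp: indicator_def dist elim!: eventually_mono)
  finally show ?thesis by simp
qed

text \<open>For a radial function the integral over \<open>B(x,r)\<close> depends only on \<open>\<bar>x\<bar>\<close>. A point \<open>x'\<close> with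
  \<open>\<bar>x\<bar> \<le> \<bar>x'\<bar> < \<bar>x\<bar> + r\<close> is at distance less than \<open>r\<close> from the sphere through \<open>x\<close>, so that
  integral is at most the one over \<open>B(x',2r)\<close>. Integrating over \<open>x'\<close> gains the missing powers
  of \<open>r\<close>.\<close>

lemma radial_ball_le_annulus:
  fixes f :: "real ^ 'n \<Rightarrow> real"
  assumes rad: "AE x in lborel. f x = h (norm x)" and [measurable]: "f \<in> borel_measurable borel"
    and r: "0 < r" and x: "norm x > 0"
  shows "ennreal (unit_ball_vol CARD('n) * ((norm x + r) ^ CARD('n) - norm x ^ CARD('n)))
      * (\<integral>\<^sup>+y. indicator (ball x r) y * ennreal \<bar>f y\<bar> \<partial>lborel)
    \<le> ennreal (unit_ball_vol CARD('n) * (2 * r) ^ CARD('n))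
      * (\<integral>\<^sup>+y. indicator {y. norm x - 2 * r < norm y \<and> norm y < norm x + 3 * r} y * ennreal \<bar>f y\<bar> \<partial>lborel)"
proof -
  define s where "s = norm x"
  define A where "A = ball 0 (s + r) - ball (0 :: real ^ 'n) s"
  define A' where "A' = {y :: real ^ 'n. s - 2 * r < norm y \<and> norm y < s + 3 * r}"
  have [measurable]: "A \<in> sets borel" "A' \<in> sets borel" by (auto simp: A_def A'_def)
  define I where "I x \<rho> = (\<integral>\<^sup>+y. indicator (ball x \<rho>) y * ennreal \<bar>f y\<bar> \<partial>lborel)" for x \<rho>
  have "emeasure lborel A = emeasure lborel (ball (0 :: real ^ 'n) (s + r)) - emeasure lborel (ball (0 :: real ^ 'n) s)"
    unfolding A_def using r x by (intro emeasure_Diff) (auto simp: emeasure_ball s_def)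
  also have "\<dots> = ennreal (unit_ball_vol CARD('n) * ((s + r) ^ CARD('n) - s ^ CARD('n)))"
    using r by (simp add: emeasure_ball s_def right_diff_distrib ennreal_minus[symmetric])
  finally have eA: "emeasure lborel A = ennreal (unit_ball_vol CARD('n) * ((s + r) ^ CARD('n) - s ^ CARD('n)))" .
  have le: "I x r \<le> (\<integral>\<^sup>+y. indicator (ball x' (2 * r)) y * (indicator A' y * ennreal \<bar>f y\<bar>) \<partial>lborel)"
    if x': "x' \<in> A" for x'
  proof -
    define \<rho> where "\<rho> = norm x'"
    have \<rho>: "s \<le> \<rho>" "\<rho> < s + r" "\<rho> > 0" using x' x by (auto simp: A_def \<rho>_def s_def)
    \<comment> \<open>The radial projection of \<open>x'\<close> to the sphere through \<open>x\<close>.\<close>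
    define z where "z = (s / \<rho>) *\<^sub>R x'"
    have z: "norm z = norm x" using \<rho> x by (simp add: z_def \<rho>_def s_def)
    have "x' - z = (1 - s / \<rho>) *\<^sub>R x'" by (simp add: z_def scaleR_diff_left)
    then have "dist x' z = \<bar>1 - s / \<rho>\<bar> * \<rho>" by (simp add: dist_norm \<rho>_def)
    also have "\<dots> = \<rho> - s" using \<rho> by (simp add: field_simps abs_if)
    finally have d: "dist x' z < r" using \<rho> by simp
    have "I x r = I z r" unfolding I_def by (rule radial_ball_integral_eq[OF rad _ z[symmetric]]) measurable
    also have "\<dots> \<le> (\<integral>\<^sup>+y. indicator (ball x' (2 * r)) y * (indicator A' y * ennreal \<bar>f y\<bar>) \<partial>lborel)"
      unfolding I_def
    proof (intro nn_integral_mono)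
      fix y
      have "y \<in> ball x' (2 * r)" if "y \<in> ball z r"
        using that d dist_triangle[of x' y z] by simp
      moreover have "y \<in> A'" if "y \<in> ball x' (2 * r)"
        using that \<rho> norm_triangle_ineq2[of x' y] norm_triangle_ineq2[of y x']
        by (auto simp: A'_def \<rho>_def dist_norm norm_minus_commute)
      ultimately show "indicator (ball z r) y * ennreal \<bar>f y\<bar>
         \<le> indicator (ball x' (2 * r)) y * (indicator A' y * ennreal \<bar>f y\<bar>)"
        by (auto simp: indicator_def)
    qed
    finally show ?thesis .
  qed
  have "emeasure lborel A * I x r = (\<integral>\<^sup>+x'. indicator A x' * I x r \<partial>lborel)"
    by (simp add: nn_integral_multc)
  also have "\<dots> \<le> (\<integral>\<^sup>+x'. (\<integral>\<^sup>+y. indicator (ball x' (2 * r)) y * (indicator A' y * ennreal \<bar>f y\<bar>) \<partial>lborel) \<partial>lborel)"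
    using le by (intro nn_integral_mono) (auto simp: indicator_def)
  also have "\<dots> = ennreal (unit_ball_vol CARD('n) * (2 * r) ^ CARD('n)) * (\<integral>\<^sup>+y. indicator A' y * ennreal \<bar>f y\<bar> \<partial>lborel)"
    using r by (subst nn_integral_ball_average) auto
  finally show ?thesis by (simp add: eA I_def A'_def s_def)
qed

text \<open>A line in direction \<open>v\<close> crosses the part of a thin annulus where \<open>v\<close> is transversal to the
  spheres in a set of length comparable to the width.\<close>

lemma transversal_line_measure:
  fixes v z :: "'a::euclidean_space"
  assumes v: "norm v = 1" and \<alpha>: "0 < \<alpha>" "\<alpha> \<le> \<gamma>" and D: "D > 0"
  defines "len \<equiv> (\<gamma>\<^sup>2 - \<alpha>\<^sup>2) * D / (2 * \<alpha>)"
  shows "emeasure lborel {t. z - t *\<^sub>R v \<in> {y. \<alpha> < norm y \<and> norm y < \<gamma> \<and> norm y / D \<le> y \<bullet> v}} \<le> ennreal (2 * len)"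
proof -
  let ?A = "{y. \<alpha> < norm y \<and> norm y < \<gamma> \<and> norm y / D \<le> y \<bullet> v}"
  let ?T = "{t. z - t *\<^sub>R v \<in> ?A}"
  have len0: "0 \<le> len" using \<alpha> D by (auto simp: len_def intro!: divide_nonneg_pos mult_nonneg_nonneg power_mono)
  have key: "t1 - t2 \<le> len" if t: "t1 \<in> ?T" "t2 \<in> ?T" "t2 \<le> t1" for t1 t2
  proof -
    define y1 where "y1 = z - t1 *\<^sub>R v"
    define y2 where "y2 = z - t2 *\<^sub>R v"
    define t where "t = t1 - t2"
    have y: "\<alpha> < norm y1" "norm y1 < \<gamma>" "norm y1 / D \<le> y1 \<bullet> v" "\<alpha> < norm y2" "norm y2 < \<gamma>"
      using that by (auto simp: y1_def y2_def)
    have "y2 = y1 + t *\<^sub>R v" by (simp add: y1_def y2_def t_def scaleR_diff_left)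
    then have "(norm y2)\<^sup>2 = (norm y1)\<^sup>2 + 2 * t * (y1 \<bullet> v) + t\<^sup>2"
      using v unfolding power2_norm_eq_inner
      by (simp add: inner_add_left inner_add_right inner_commute power2_eq_square norm_eq_1)
    moreover have "(norm y2)\<^sup>2 \<le> \<gamma>\<^sup>2" "\<alpha>\<^sup>2 \<le> (norm y1)\<^sup>2" using y \<alpha> by (auto intro!: power_mono)
    ultimately have "2 * t * (y1 \<bullet> v) \<le> \<gamma>\<^sup>2 - \<alpha>\<^sup>2" using zero_le_power2[of t] by linarith
    moreover have "\<alpha> / D \<le> y1 \<bullet> v" using y(1,3) D by (meson divide_right_mono less_imp_le order_trans)
    then have "2 * t * (\<alpha> / D) \<le> 2 * t * (y1 \<bullet> v)" using t by (intro mult_left_mono) (auto simp: t_def)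
    ultimately have "2 * t * (\<alpha> / D) \<le> \<gamma>\<^sup>2 - \<alpha>\<^sup>2" by linarith
    then show ?thesis using \<alpha> D by (simp add: len_def t_def field_simps)
  qed
  show ?thesis
  proof (cases "?T = {}")
    case False
    then obtain t0 where t0: "t0 \<in> ?T" by blast
    have "?T \<subseteq> {t0 - len..t0 + len}"
    proof
      fix t assume "t \<in> ?T"
      then show "t \<in> {t0 - len..t0 + len}" using key[of t t0] key[of t0 t] t0 len0 by (cases "t \<le> t0") auto
    qed
    then have "emeasure lborel ?T \<le> emeasure lborel {t0 - len..t0 + len}" by (intro emeasure_mono) auto
    also have "\<dots> = ennreal (2 * len)" using len0 by (simp add: algebra_simps)
    finally show ?thesis .
  next
    case True then show ?thesis by (simp only: emeasure_empty zero_le)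
  qed
qed

lemma transversal_average:
  fixes v :: "'a::euclidean_space" and m :: "'a \<Rightarrow> ennreal"
  assumes v: "norm v = 1" and \<alpha>: "0 < \<alpha>" "\<alpha> \<le> \<gamma>" and D: "D > 0" and [measurable]: "m \<in> borel_measurable borel"
  defines "A \<equiv> {y. \<alpha> < norm y \<and> norm y < \<gamma> \<and> norm y / D \<le> y \<bullet> v}"
  shows "(\<integral>\<^sup>+t. indicator {0..1::real} t * (\<integral>\<^sup>+y. indicator A y * m (y + t *\<^sub>R v) \<partial>lborel) \<partial>lborel)
    \<le> ennreal (2 * ((\<gamma>\<^sup>2 - \<alpha>\<^sup>2) * D / (2 * \<alpha>))) * (\<integral>\<^sup>+z. m z \<partial>lborel)"
proof -
  have [measurable]: "A \<in> sets borel" unfolding A_def by measurable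
  have "(\<integral>\<^sup>+t. indicator {0..1::real} t * (\<integral>\<^sup>+y. indicator A y * m (y + t *\<^sub>R v) \<partial>lborel) \<partial>lborel)
     \<le> (\<integral>\<^sup>+t. (\<integral>\<^sup>+z. indicator A (z - t *\<^sub>R v) * m z \<partial>lborel) \<partial>lborel)"
  proof (intro nn_integral_mono)
    fix t :: real
    have "(\<integral>\<^sup>+y. indicator A y * m (y + t *\<^sub>R v) \<partial>lborel) = (\<integral>\<^sup>+z. indicator A (z - t *\<^sub>R v) * m z \<partial>lborel)"
      using nn_integral_shift[of "\<lambda>z. indicator A (z - t *\<^sub>R v) * m z" "t *\<^sub>R v"] by simp
    then show "indicator {0..1::real} t * (\<integral>\<^sup>+y. indicator A y * m (y + t *\<^sub>R v) \<partial>lborel)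
       \<le> (\<integral>\<^sup>+z. indicator A (z - t *\<^sub>R v) * m z \<partial>lborel)"
      by (auto simp: indicator_def)
  qed
  also have "\<dots> = (\<integral>\<^sup>+z. (\<integral>\<^sup>+t. indicator A (z - t *\<^sub>R v) * m z \<partial>lborel) \<partial>lborel)"
    by (rule lborel_pair.Fubini'[symmetric]) measurable
  also have "\<dots> \<le> (\<integral>\<^sup>+z. ennreal (2 * ((\<gamma>\<^sup>2 - \<alpha>\<^sup>2) * D / (2 * \<alpha>))) * m z \<partial>lborel)"
  proof (intro nn_integral_mono)
    fix z
    have [measurable]: "{t. z - t *\<^sub>R v \<in> A} \<in> sets borel"
    proof -
      have "(\<lambda>t. z - t *\<^sub>R v) -` A \<inter> space borel \<in> sets borel"
        by (rule measurable_sets[of _ borel borel]) measurable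
      then show ?thesis by (simp add: vimage_def)
    qed
    have "(\<integral>\<^sup>+t. indicator A (z - t *\<^sub>R v) * m z \<partial>lborel) = (\<integral>\<^sup>+t. indicator {t. z - t *\<^sub>R v \<in> A} t * m z \<partial>lborel)"
      by (intro nn_integral_cong) (auto simp: indicator_def)
    also have "\<dots> = emeasure lborel {t. z - t *\<^sub>R v \<in> A} * m z" by (simp add: nn_integral_multc)
    also have "\<dots> \<le> ennreal (2 * ((\<gamma>\<^sup>2 - \<alpha>\<^sup>2) * D / (2 * \<alpha>))) * m z"
      unfolding A_def by (intro mult_right_mono transversal_line_measure v \<alpha> D) auto
    finally show "(\<integral>\<^sup>+t. indicator A (z - t *\<^sub>R v) * m z \<partial>lborel) \<le> ennreal (2 * ((\<gamma>\<^sup>2 - \<alpha>\<^sup>2) * D / (2 * \<alpha>))) * m z" .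
  qed
  also have "\<dots> = ennreal (2 * ((\<gamma>\<^sup>2 - \<alpha>\<^sup>2) * D / (2 * \<alpha>))) * (\<integral>\<^sup>+z. m z \<partial>lborel)"
    by (simp add: nn_integral_cmult)
  finally show ?thesis .
qed

lemma increment_bound:
  fixes f :: "'a::euclidean_space \<Rightarrow> real"
  assumes w: "wgrad f g" and f: "integrable lborel f" and g: "integrable lborel g"
    and v: "norm v = 1" and \<tau>: "0 \<le> \<tau>" "\<tau> \<le> 1"
  shows "AE y in lborel. ennreal \<bar>f y\<bar> \<le> ennreal \<bar>f (y + \<tau> *\<^sub>R v)\<bar>
    + (\<integral>\<^sup>+t. indicator {0..1::real} t * ennreal (norm (g (y + t *\<^sub>R v))) \<partial>lborel)"
proof (cases "\<tau> = 0")
  case False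
  note [measurable] = borel_measurable_integrable[OF g, simplified]
  show ?thesis
    using increment_formula(1)[OF w f g, of "\<tau> *\<^sub>R v"]
  proof eventually_elim
    case (elim y)
    let ?I = "\<integral>\<^sup>+t. indicator {0..1::real} t * ennreal (norm (g (y + t *\<^sub>R v))) \<partial>lborel"
    have "ennreal \<bar>f (y + \<tau> *\<^sub>R v) - f y\<bar>
       \<le> (\<integral>\<^sup>+t. ennreal (norm (indicator {0..1} t * (g (y + t *\<^sub>R (\<tau> *\<^sub>R v)) \<bullet> (\<tau> *\<^sub>R v)))) \<partial>lborel)"
      using integral_norm_bound_ennreal[of lborel "\<lambda>t. indicator {0..1} t * (g (y + t *\<^sub>R (\<tau> *\<^sub>R v)) \<bullet> (\<tau> *\<^sub>R v))"]
      unfolding elim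
      by (cases "integrable lborel (\<lambda>t. indicator {0..1} t * (g (y + t *\<^sub>R (\<tau> *\<^sub>R v)) \<bullet> (\<tau> *\<^sub>R v)))")
         (auto simp: not_integrable_integral_eq)
    also have "\<dots> \<le> (\<integral>\<^sup>+t. ennreal \<tau> * (indicator {0..\<tau>} (0 + \<tau> * t) * ennreal (norm (g (y + (0 + \<tau> * t) *\<^sub>R v)))) \<partial>lborel)"
    proof (intro nn_integral_mono)
      fix t :: real
      have "\<bar>g (y + t *\<^sub>R (\<tau> *\<^sub>R v)) \<bullet> (\<tau> *\<^sub>R v)\<bar> \<le> \<tau> * norm (g (y + (\<tau> * t) *\<^sub>R v))"
        using Cauchy_Schwarz_ineq2[of "g (y + (\<tau> * t) *\<^sub>R v)" v] v \<tau>
        by (simp add: abs_mult mult_left_mono mult.commute)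
      then have "ennreal \<bar>g (y + t *\<^sub>R (\<tau> *\<^sub>R v)) \<bullet> (\<tau> *\<^sub>R v)\<bar> \<le> ennreal \<tau> * ennreal (norm (g (y + (\<tau> * t) *\<^sub>R v)))"
        using \<tau> by (subst ennreal_mult[symmetric]) (auto intro: ennreal_leI)
      then show "ennreal (norm (indicator {0..1} t * (g (y + t *\<^sub>R (\<tau> *\<^sub>R v)) \<bullet> (\<tau> *\<^sub>R v))))
         \<le> ennreal \<tau> * (indicator {0..\<tau>} (0 + \<tau> * t) * ennreal (norm (g (y + (0 + \<tau> * t) *\<^sub>R v))))"
        using \<tau> False by (auto simp: indicator_def mult_le_cancel_left1)
    qed
    also have "\<dots> = ennreal \<tau> * (\<integral>\<^sup>+t. indicator {0..\<tau>} (0 + \<tau> * t) * ennreal (norm (g (y + (0 + \<tau> * t) *\<^sub>R v))) \<partial>lborel)"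
      by (rule nn_integral_cmult) measurable
    also have "\<dots> = (\<integral>\<^sup>+t. indicator {0..\<tau>} t * ennreal (norm (g (y + t *\<^sub>R v))) \<partial>lborel)"
      using nn_integral_real_affine[of "\<lambda>t. indicator {0..\<tau>} t * ennreal (norm (g (y + t *\<^sub>R v)))" \<tau> 0] \<tau> False by simp
    also have "\<dots> \<le> ?I"
      using \<tau> by (intro nn_integral_mono) (auto simp: indicator_def)
    finally have *: "ennreal \<bar>f (y + \<tau> *\<^sub>R v) - f y\<bar> \<le> ?I" .
    have "ennreal \<bar>f y\<bar> \<le> ennreal (\<bar>f (y + \<tau> *\<^sub>R v)\<bar> + \<bar>f (y + \<tau> *\<^sub>R v) - f y\<bar>)"
      by (intro ennreal_leI) linarith
    also have "\<dots> = ennreal \<bar>f (y + \<tau> *\<^sub>R v)\<bar> + ennreal \<bar>f (y + \<tau> *\<^sub>R v) - f y\<bar>" by (simp add: ennreal_plus)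
    also have "\<dots> \<le> ennreal \<bar>f (y + \<tau> *\<^sub>R v)\<bar> + ?I" using * by (rule add_left_mono)
    finally show ?case .
  qed
qed auto

text \<open>Averaging \<open>\<bar>f(y)\<bar> \<le> \<bar>f(y + \<tau>v)\<bar> + \<integral>\<bar>g(y + tv)\<bar> dt\<close> over \<open>\<tau>\<close> in the unit interval replaces
  both terms by integrals along segments transversal to the annulus, of which only a short part
  stays in it.\<close>

lemma transversal_integral_le:
  fixes f :: "'a::euclidean_space \<Rightarrow> real"
  assumes w: "wgrad f g" and f: "integrable lborel f" and g: "integrable lborel g"
    and v: "norm v = 1" and \<alpha>: "0 < \<alpha>" "\<alpha> \<le> \<gamma>" and D: "D > 0"
  defines "A \<equiv> {y. \<alpha> < norm y \<and> norm y < \<gamma> \<and> norm y / D \<le> y \<bullet> v}"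
  shows "(\<integral>\<^sup>+y. indicator A y * ennreal \<bar>f y\<bar> \<partial>lborel)
    \<le> ennreal (2 * ((\<gamma>\<^sup>2 - \<alpha>\<^sup>2) * D / (2 * \<alpha>)))
      * ((\<integral>\<^sup>+z. ennreal \<bar>f z\<bar> \<partial>lborel) + (\<integral>\<^sup>+z. ennreal (norm (g z)) \<partial>lborel))"
proof -
  note [measurable] = borel_measurable_integrable[OF f, simplified] borel_measurable_integrable[OF g, simplified]
  have [measurable]: "A \<in> sets borel" unfolding A_def by measurable
  let ?c = "ennreal (2 * ((\<gamma>\<^sup>2 - \<alpha>\<^sup>2) * D / (2 * \<alpha>)))"
  let ?X = "\<integral>\<^sup>+y. indicator A y * ennreal \<bar>f y\<bar> \<partial>lborel"
  let ?P = "\<lambda>t. \<integral>\<^sup>+y. indicator A y * ennreal \<bar>f (y + t *\<^sub>R v)\<bar> \<partial>lborel"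
  let ?Q = "\<integral>\<^sup>+y. indicator A y * (\<integral>\<^sup>+t. indicator {0..1::real} t * ennreal (norm (g (y + t *\<^sub>R v))) \<partial>lborel) \<partial>lborel"
  have le: "?X \<le> ?P \<tau> + ?Q" if \<tau>: "\<tau> \<in> {0..1}" for \<tau>
  proof -
    have "?X \<le> (\<integral>\<^sup>+y. indicator A y * ennreal \<bar>f (y + \<tau> *\<^sub>R v)\<bar>
        + indicator A y * (\<integral>\<^sup>+t. indicator {0..1::real} t * ennreal (norm (g (y + t *\<^sub>R v))) \<partial>lborel) \<partial>lborel)"
      using increment_bound[OF w f g v, of \<tau>] \<tau>
      by (intro nn_integral_mono_AE) (auto simp: indicator_def elim!: eventually_mono)
    then show ?thesis by (subst (asm) nn_integral_add) auto
  qed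
  have "?X = (\<integral>\<^sup>+\<tau>. indicator {0..1::real} \<tau> * ?X \<partial>lborel)"
    by (simp add: nn_integral_multc)
  also have "\<dots> \<le> (\<integral>\<^sup>+\<tau>. indicator {0..1::real} \<tau> * ?P \<tau> + indicator {0..1} \<tau> * ?Q \<partial>lborel)"
    using le by (intro nn_integral_mono) (auto simp: indicator_def)
  also have "\<dots> = (\<integral>\<^sup>+\<tau>. indicator {0..1::real} \<tau> * ?P \<tau> \<partial>lborel) + ?Q"
    by (subst nn_integral_add) (auto simp: nn_integral_multc)
  also have "?Q = (\<integral>\<^sup>+y. (\<integral>\<^sup>+t. indicator A y * (indicator {0..1::real} t * ennreal (norm (g (y + t *\<^sub>R v)))) \<partial>lborel) \<partial>lborel)"
    by (simp add: nn_integral_cmult)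
  also have "\<dots> = (\<integral>\<^sup>+t. (\<integral>\<^sup>+y. indicator A y * (indicator {0..1::real} t * ennreal (norm (g (y + t *\<^sub>R v)))) \<partial>lborel) \<partial>lborel)"
    by (rule lborel_pair.Fubini') measurable
  also have "\<dots> = (\<integral>\<^sup>+t. indicator {0..1::real} t * (\<integral>\<^sup>+y. indicator A y * ennreal (norm (g (y + t *\<^sub>R v))) \<partial>lborel) \<partial>lborel)"
    by (simp add: mult.left_commute[of "indicator A _"] nn_integral_cmult)
  also have "(\<integral>\<^sup>+\<tau>. indicator {0..1::real} \<tau> * ?P \<tau> \<partial>lborel) + \<dots>
     \<le> ?c * (\<integral>\<^sup>+z. ennreal \<bar>f z\<bar> \<partial>lborel) + ?c * (\<integral>\<^sup>+z. ennreal (norm (g z)) \<partial>lborel)"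
    unfolding A_def by (intro add_mono transversal_average v \<alpha> D) measurable
  finally show ?thesis by (simp add: distrib_left)
qed

text \<open>At each point some coordinate direction makes an angle with the sphere that is bounded below,
  because the largest coordinate is at least \<open>\<bar>y\<bar> / d\<close>; so finitely many transversal pieces
  cover the annulus.\<close>

lemma annulus_integral_le:
  fixes f :: "'a::euclidean_space \<Rightarrow> real"
  assumes w: "wgrad f g" and f: "integrable lborel f" and g: "integrable lborel g"
    and r: "0 < r" "r \<le> s / 8"
  shows "(\<integral>\<^sup>+y. indicator {y. s - 2 * r < norm y \<and> norm y < s + 3 * r} y * ennreal \<bar>f y\<bar> \<partial>lborel)
    \<le> ennreal (32 * (real DIM('a))\<^sup>2 * r)
      * ((\<integral>\<^sup>+z. ennreal \<bar>f z\<bar> \<partial>lborel) + (\<integral>\<^sup>+z. ennreal (norm (g z)) \<partial>lborel))"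
proof -
  note [measurable] = borel_measurable_integrable[OF f, simplified]
  define d where "d = real DIM('a)"
  define B where "B = Basis \<union> uminus ` (Basis :: 'a set)"
  define A where "A v = {y. s - 2 * r < norm y \<and> norm y < s + 3 * r \<and> norm y / d \<le> y \<bullet> v}" for v :: 'a
  let ?A = "{y::'a. s - 2 * r < norm y \<and> norm y < s + 3 * r}"
  let ?N = "(\<integral>\<^sup>+z. ennreal \<bar>f z\<bar> \<partial>lborel) + (\<integral>\<^sup>+z. ennreal (norm (g z)) \<partial>lborel)"
  have d: "d > 0" by (simp add: d_def)
  have finB: "finite B" by (simp add: B_def)
  have "card B \<le> card (Basis :: 'a set) + card (uminus ` (Basis :: 'a set))"
    unfolding B_def by (rule card_Un_le)
  also have "\<dots> \<le> 2 * DIM('a)" using card_image_le[OF finite_Basis, of "uminus :: 'a \<Rightarrow> 'a"] by simp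
  finally have cardB: "real (card B) \<le> 2 * d" by (simp add: d_def)
  have [measurable]: "A v \<in> sets borel" for v unfolding A_def by measurable
  have cover: "\<exists>v\<in>B. y \<in> A v" if y: "y \<in> ?A" for y
  proof -
    have y0: "norm y > 0" using y r by auto
    have "\<exists>b\<in>Basis. norm y / d \<le> \<bar>y \<bullet> b\<bar>"
    proof (rule ccontr)
      assume "\<not> (\<exists>b\<in>Basis. norm y / d \<le> \<bar>y \<bullet> b\<bar>)"
      then have "(\<Sum>b\<in>Basis. \<bar>y \<bullet> b\<bar>) < real (card (Basis :: 'a set)) * (norm y / d)"
        by (intro sum_bounded_above_strict) (auto simp: not_le)
      then show False using norm_le_l1[of y] d by (simp add: d_def)
    qed
    then obtain b where b: "b \<in> Basis" "norm y / d \<le> \<bar>y \<bullet> b\<bar>" by blast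
    then have "y \<in> A b \<or> y \<in> A (- b)" using y by (auto simp: A_def abs_if split: if_splits)
    then show ?thesis using b(1) by (auto simp: B_def)
  qed
  have le: "(\<integral>\<^sup>+y. indicator (A v) y * ennreal \<bar>f y\<bar> \<partial>lborel) \<le> ennreal (16 * d * r) * ?N" if v: "v \<in> B" for v
  proof -
    have v1: "norm v = 1" using v by (auto simp: B_def)
    have \<alpha>: "0 < s - 2 * r" "s - 2 * r \<le> s + 3 * r" using r by auto
    have "(\<integral>\<^sup>+y. indicator (A v) y * ennreal \<bar>f y\<bar> \<partial>lborel)
      \<le> ennreal (2 * (((s + 3 * r)\<^sup>2 - (s - 2 * r)\<^sup>2) * d / (2 * (s - 2 * r)))) * ?N"
      unfolding A_def by (rule transversal_integral_le[OF w f g v1 \<alpha> d])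
    also have "2 * (((s + 3 * r)\<^sup>2 - (s - 2 * r)\<^sup>2) * d / (2 * (s - 2 * r))) \<le> 16 * d * r"
    proof -
      have "(s + 3 * r)\<^sup>2 - (s - 2 * r)\<^sup>2 = 5 * r * (2 * s + r)" by (simp add: power2_eq_square algebra_simps)
      also have "\<dots> \<le> r * (16 * (s - 2 * r))"
        using r by (simp only: mult.assoc mult.left_commute[of 5], intro mult_left_mono) auto
      finally have "((s + 3 * r)\<^sup>2 - (s - 2 * r)\<^sup>2) * d \<le> r * (16 * (s - 2 * r)) * d"
        using d by (intro mult_right_mono) auto
      then have "((s + 3 * r)\<^sup>2 - (s - 2 * r)\<^sup>2) * d \<le> 16 * d * r * (s - 2 * r)"
        by (simp only: mult_ac)
      then have "((s + 3 * r)\<^sup>2 - (s - 2 * r)\<^sup>2) * d / (s - 2 * r) \<le> 16 * d * r"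
        using \<alpha> by (simp only: pos_divide_le_eq)
      moreover have "2 * (X / (2 * b)) = X / b" for X b :: real by simp
      ultimately show ?thesis by (simp only:)
    qed
    then have "ennreal (2 * (((s + 3 * r)\<^sup>2 - (s - 2 * r)\<^sup>2) * d / (2 * (s - 2 * r)))) * ?N \<le> ennreal (16 * d * r) * ?N"
      by (intro mult_right_mono ennreal_leI) auto
    finally show ?thesis .
  qed
  have "(\<integral>\<^sup>+y. indicator ?A y * ennreal \<bar>f y\<bar> \<partial>lborel) \<le> (\<integral>\<^sup>+y. (\<Sum>v\<in>B. indicator (A v) y * ennreal \<bar>f y\<bar>) \<partial>lborel)"
  proof (intro nn_integral_mono)
    fix y
    show "indicator ?A y * ennreal \<bar>f y\<bar> \<le> (\<Sum>v\<in>B. indicator (A v) y * ennreal \<bar>f y\<bar>)"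
    proof (cases "y \<in> ?A")
      case True
      then obtain v where "v \<in> B" "y \<in> A v" using cover by blast
      then have "ennreal \<bar>f y\<bar> \<le> (\<Sum>v\<in>B. indicator (A v) y * ennreal \<bar>f y\<bar>)"
        using member_le_sum[of v B "\<lambda>v. indicator (A v) y * ennreal \<bar>f y\<bar>"] finB by simp
      then show ?thesis using True by simp
    qed simp
  qed
  also have "\<dots> = (\<Sum>v\<in>B. \<integral>\<^sup>+y. indicator (A v) y * ennreal \<bar>f y\<bar> \<partial>lborel)"
    by (rule nn_integral_sum) measurable
  also have "\<dots> \<le> (\<Sum>v\<in>B. ennreal (16 * d * r) * ?N)" by (intro sum_mono le)
  also have "\<dots> = ennreal (real (card B)) * (ennreal (16 * d * r) * ?N)" by (simp add: ennreal_of_nat_eq_real_of_nat)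
  also have "\<dots> \<le> ennreal (2 * d) * (ennreal (16 * d * r) * ?N)"
    using cardB by (intro mult_right_mono ennreal_leI) auto
  also have "\<dots> = ennreal (32 * d\<^sup>2 * r) * ?N"
    using d r by (simp add: mult.assoc[symmetric] ennreal_mult[symmetric] power2_eq_square)
  finally show ?thesis by (simp add: d_def)
qed

text \<open>The integral over an annulus of width comparable to \<open>r\<close> is of order \<open>r\<close>, and a ball of radius
  \<open>r\<close> carries a fraction of order \<open>r\<close> to the power \<open>d - 1\<close> of it; together this is \<open>r\<^sup>d\<close>.\<close>

lemma radial_frac_mean_bound:
  fixes f :: "real ^ 'n \<Rightarrow> real"
  assumes rad: "AE x in lborel. f x = h (norm x)"
    and w: "wgrad f g" and f: "integrable lborel f" and g: "integrable lborel g"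
    and a: "0 < a" "a \<le> norm x" and r: "0 < r" "r \<le> a / 8"
  shows "frac_mean \<beta> (\<lambda>y. \<bar>f y\<bar>) r x \<le> 2 ^ CARD('n) * (32 * (real CARD('n))\<^sup>2) / (a ^ (CARD('n) - 1) * unit_ball_vol CARD('n))
    * r powr \<beta> * ((LINT y|lborel. \<bar>f y\<bar>) + (LINT y|lborel. norm (g y)))"
proof -
  note [measurable] = borel_measurable_integrable[OF f, simplified] borel_measurable_integrable[OF g, simplified]
  define d where "d = CARD('n)"
  have d: "d \<ge> 1" by (simp add: d_def Suc_leI)
  define \<omega> where "\<omega> = unit_ball_vol d"
  have \<omega>: "\<omega> > 0" by (simp add: \<omega>_def)
  define s where "s = norm x"
  define N where "N = (LINT y|lborel. \<bar>f y\<bar>) + (LINT y|lborel. norm (g y))"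
  define I where "I = (LINT y|lborel. indicator (ball x r) y * \<bar>f y\<bar>)"
  have N0: "N \<ge> 0" and I0: "I \<ge> 0" by (auto simp: N_def I_def intro!: add_nonneg_nonneg integral_nonneg_AE)
  have eN: "(\<integral>\<^sup>+z. ennreal \<bar>f z\<bar> \<partial>lborel) + (\<integral>\<^sup>+z. ennreal (norm (g z)) \<partial>lborel) = ennreal N"
    using f g by (simp add: N_def nn_integral_eq_integral integral_nonneg_AE)
  have eI: "(\<integral>\<^sup>+y. indicator (ball x r) y * ennreal \<bar>f y\<bar> \<partial>lborel) = ennreal I"
  proof -
    have "(\<integral>\<^sup>+y. indicator (ball x r) y * ennreal \<bar>f y\<bar> \<partial>lborel) = (\<integral>\<^sup>+y. ennreal (indicator (ball x r) y * \<bar>f y\<bar>) \<partial>lborel)"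
      by (intro nn_integral_cong) (auto simp: indicator_def)
    also have "\<dots> = ennreal I"
      unfolding I_def by (intro nn_integral_eq_integral ball_mult_integrable integrable_abs f) auto
    finally show ?thesis .
  qed
  have s: "s \<ge> a" "r \<le> s / 8" "s > 0" using a r by (auto simp: s_def)
  have "(s + r) ^ d - s ^ d \<ge> 0" using r s by (simp add: power_mono)
  then have "ennreal (\<omega> * ((s + r) ^ d - s ^ d) * I) = ennreal (\<omega> * ((s + r) ^ d - s ^ d)) * ennreal I"
    using \<omega> I0 by (simp add: ennreal_mult)
  also have "\<dots> \<le> ennreal (\<omega> * (2 * r) ^ d)
      * (\<integral>\<^sup>+y. indicator {y. s - 2 * r < norm y \<and> norm y < s + 3 * r} y * ennreal \<bar>f y\<bar> \<partial>lborel)"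
    using radial_ball_le_annulus[OF rad _ r(1), of x] s unfolding eI s_def d_def \<omega>_def by auto
  also have "\<dots> \<le> ennreal (\<omega> * (2 * r) ^ d) * (ennreal (32 * (real d)\<^sup>2 * r) * ennreal N)"
    using annulus_integral_le[OF w f g r(1) s(2)] unfolding eN by (intro mult_left_mono) (auto simp: d_def)
  also have "\<dots> = ennreal (\<omega> * (2 * r) ^ d * (32 * (real d)\<^sup>2 * r * N))"
    using \<omega> r N0 by (simp add: ennreal_mult)
  finally have "\<omega> * ((s + r) ^ d - s ^ d) * I \<le> \<omega> * (2 * r) ^ d * (32 * (real d)\<^sup>2 * r * N)"
    using \<omega> r N0 by (subst (asm) ennreal_le_iff) auto
  then have 1: "((s + r) ^ d - s ^ d) * I \<le> (2 * r) ^ d * (32 * (real d)\<^sup>2 * r * N)"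
    using \<omega> by (simp only: mult.assoc mult_le_cancel_left_pos)
  obtain d' where d': "d = Suc d'" using d by (cases d) auto
  have "a ^ (d - 1) * r \<le> (s + r) ^ d' * r"
    using a r s d' power_mono[of a "s + r" d'] by (intro mult_right_mono) auto
  also have "s ^ d + (s + r) ^ d' * r \<le> (s + r) ^ d"
    using s r by (simp add: d' distrib_right mult.commute[of r] power_mono)
  then have "(s + r) ^ d' * r \<le> (s + r) ^ d - s ^ d" by simp
  finally have "a ^ (d - 1) * r * I \<le> ((s + r) ^ d - s ^ d) * I" using I0 by (intro mult_right_mono)
  with 1 have "r * (a ^ (d - 1) * I) \<le> r * ((2 * r) ^ d * (32 * (real d)\<^sup>2 * N))" by (simp add: mult_ac)
  then have "a ^ (d - 1) * I \<le> (2 * r) ^ d * (32 * (real d)\<^sup>2 * N)"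
    using r by (simp only: mult_le_cancel_left_pos)
  then have I: "I \<le> (2 * r) ^ d * (32 * (real d)\<^sup>2 * N) / a ^ (d - 1)"
    using a by (simp add: pos_le_divide_eq mult.commute)
  have "frac_mean \<beta> (\<lambda>y. \<bar>f y\<bar>) r x = r powr (\<beta> - d) / \<omega> * I" by (simp add: frac_mean_def I_def d_def \<omega>_def)
  also have "\<dots> \<le> r powr (\<beta> - d) / \<omega> * ((2 * r) ^ d * (32 * (real d)\<^sup>2 * N) / a ^ (d - 1))"
    using \<omega> I by (intro mult_left_mono) auto
  also have "\<dots> = (r powr (\<beta> - d) * r ^ d) * (2 ^ d * (32 * (real d)\<^sup>2) / (a ^ (d - 1) * \<omega>) * N)"
    by (simp add: power_mult_distrib field_simps)
  also have "r powr (\<beta> - d) * r ^ d = r powr \<beta>"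
    using r by (simp add: powr_realpow[symmetric] powr_add[symmetric])
  finally show ?thesis by (simp add: d_def \<omega>_def N_def mult_ac)
qed

lemma small_radius:
  fixes K m \<beta> :: real
  assumes "0 < \<beta>" "0 < m" "0 \<le> K"
  obtains \<epsilon> where "\<epsilon> > 0" "\<And>r. 0 < r \<Longrightarrow> r \<le> \<epsilon> \<Longrightarrow> K * r powr \<beta> < m"
proof
  let ?\<epsilon> = "(m / (K + 1)) powr (1 / \<beta>)"
  show "?\<epsilon> > 0" using assms by simp
  fix r :: real assume r: "0 < r" "r \<le> ?\<epsilon>"
  have "r powr \<beta> \<le> ?\<epsilon> powr \<beta>" using r assms by (intro powr_mono2) auto
  also have "\<dots> = m / (K + 1)" using assms by (simp add: powr_powr)
  finally have "(K + 1) * r powr \<beta> \<le> m" using assms by (simp add: field_simps)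
  then show "K * r powr \<beta> < m" using r by (simp add: distrib_right) (smt (verit) powr_gt_zero)
qed

lemma large_radius:
  fixes K m \<gamma> :: real
  assumes "\<gamma> < 0" "0 < m"
  obtains R where "R > 0" "\<And>r. R \<le> r \<Longrightarrow> r powr \<gamma> * K < m"
proof -
  have "((\<lambda>r::real. r powr \<gamma> * K) \<longlongrightarrow> 0 * K) at_top"
    using assms by (intro tendsto_mult tendsto_const tendsto_neg_powr filterlim_ident)
  then have "\<forall>\<^sub>F r in at_top. r powr \<gamma> * K < m" using assms by (intro order_tendstoD) auto
  then obtain R where "\<And>r. R \<le> r \<Longrightarrow> r powr \<gamma> * K < m" unfolding eventually_at_top_linorder by auto
  then show ?thesis by (intro that[of "max R 1"]) auto
qed

text \<open>Small balls have small means by assumption and large balls because \<open>\<beta> < d\<close>, so the supremum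
  is a maximum over a compact interval.\<close>

lemma optimal_radius_exists:
  fixes F :: "'a::euclidean_space \<Rightarrow> real"
  assumes F: "integrable lborel F" and nn: "\<And>y. 0 \<le> F y" and \<beta>: "0 < \<beta>" "\<beta> < real DIM('a)"
    and r0: "0 < r0" and K: "0 \<le> K" and small: "\<And>r. 0 < r \<Longrightarrow> r \<le> r0 \<Longrightarrow> frac_mean \<beta> F r x \<le> K * r powr \<beta>"
  shows "\<exists>r. optimal_radius \<beta> F x r"
proof (cases "\<forall>r>0. frac_mean \<beta> F r x \<le> 0")
  case True
  then have "optimal_radius \<beta> F x 1" using frac_mean_nonneg[of F \<beta> 1 x] nn unfolding optimal_radius_def by (auto intro: order_trans)
  then show ?thesis by blast
next
  case False
  then obtain r1 where r1: "r1 > 0" "frac_mean \<beta> F r1 x > 0" by (auto simp: not_le)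
  define m where "m = frac_mean \<beta> F r1 x"
  have m: "m > 0" using r1 by (simp add: m_def)
  obtain \<epsilon> where \<epsilon>: "\<epsilon> > 0" "\<And>r. 0 < r \<Longrightarrow> r \<le> \<epsilon> \<Longrightarrow> K * r powr \<beta> < m"
    using small_radius[OF \<beta>(1) m K] by metis
  obtain R where R: "R > 0" "\<And>r. R \<le> r \<Longrightarrow> r powr (\<beta> - DIM('a)) * ((LINT y|lborel. \<bar>F y\<bar>) / unit_ball_vol DIM('a)) < m"
    using large_radius[of "\<beta> - DIM('a)" m] \<beta> m by (metis diff_less_0_iff_less)
  define lo where "lo = min (min \<epsilon> r0) r1"
  define hi where "hi = max R r1"
  have lo: "0 < lo" "lo \<le> \<epsilon>" "lo \<le> r0" "lo \<le> r1" using \<epsilon> r0 r1 by (auto simp: lo_def)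
  have hi: "R \<le> hi" "r1 \<le> hi" by (auto simp: hi_def)
  have "r > 0" if "r \<in> {lo..hi}" for r using that lo by auto
  then obtain r where r: "r \<in> {lo..hi}" "\<And>s. s \<in> {lo..hi} \<Longrightarrow> frac_mean \<beta> F s x \<le> frac_mean \<beta> F r x"
    using continuous_attains_sup[OF compact_Icc _ frac_mean_continuous_on_r[OF F], of lo hi] lo hi by force
  have mr: "m \<le> frac_mean \<beta> F r x" unfolding m_def using lo hi by (intro r(2)) auto
  have "frac_mean \<beta> F s x \<le> frac_mean \<beta> F r x" if s: "s > 0" for s
  proof -
    consider "s < lo" | "s \<in> {lo..hi}" | "hi < s" by force
    then show ?thesis
    proof cases
      case 1
      then show ?thesis using small[of s] \<epsilon>(2)[of s] lo s mr by auto
    next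
      case 3
      then show ?thesis using frac_mean_abs_le[OF F, of \<beta> s x] R(2)[of s] hi mr by auto
    qed (rule r)
  qed
  then have "optimal_radius \<beta> F x r" using r(1) lo(1) by (auto simp: optimal_radius_def)
  then show ?thesis by blast
qed

section \<open>Optimal radii and gradient bounds\<close>

lemma less_dimension:
  fixes \<beta> :: real assumes "\<beta> < 1" shows "\<beta> < real DIM('a::euclidean_space)"
proof -
  have "1 \<le> DIM('a)" using DIM_positive[where 'a='a] by linarith
  then have "1 \<le> real DIM('a)" by linarith
  with assms show ?thesis by linarith
qed

lemma norm_le_component_bound:
  fixes x :: "'a::euclidean_space"
  assumes "\<And>e. e \<in> Basis \<Longrightarrow> \<bar>x \<bullet> e\<bar> \<le> B"
  shows "norm x \<le> real DIM('a) * B"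
proof -
  have "(\<Sum>e\<in>Basis. \<bar>x \<bullet> e\<bar>) \<le> (\<Sum>e\<in>(Basis :: 'a set). B)" using assms by (intro sum_mono)
  then show ?thesis using norm_le_l1[of x] by simp
qed

text \<open>Enlarging the radius of an optimal ball by \<open>t\<close> bounds the average at every point at distance
  \<open>t\<close>, so at an optimal radius the average cannot grow faster than the maximal function divided by
  the radius.\<close>

lemma optimal_radius_slope_bound:
  fixes F :: "'a::euclidean_space \<Rightarrow> real"
  assumes w: "wgrad F w" and F: "integrable lborel F" and iw: "integrable lborel w"
    and nn: "\<And>y. 0 \<le> F y" and \<beta>: "0 < \<beta>" "\<beta> < real DIM('a)" and r: "optimal_radius \<beta> F x r" and e: "norm e = 1"
  shows "\<bar>frac_mean \<beta> (\<lambda>y. w y \<bullet> e) r x\<bar> \<le> 2 * real DIM('a) / r * frac_mean \<beta> F r x"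
proof -
  have r0: "r > 0" using r by (simp add: optimal_radius_def)
  let ?m = "frac_mean \<beta> F r x"
  define p where "p = real DIM('a) - \<beta>"
  have p: "p > 0" "p \<le> real DIM('a)" using \<beta> by (auto simp: p_def)
  have m0: "?m \<ge> 0" using nn by (rule frac_mean_nonneg)
  have le: "frac_mean \<beta> (\<lambda>y. w y \<bullet> v) r x \<le> 2 * real DIM('a) / r * ?m" if v: "norm v = 1" for v
  proof (rule LIMSEQ_le_const2[OF frac_mean_directional_derivative[OF w F iw r0, of \<beta> x v]])
    have "(\<lambda>n. 1 / real (Suc n)) \<longlonglongrightarrow> 0" using LIMSEQ_Suc[OF lim_1_over_n[where 'a=real]] by simp
    moreover have "0 < r / p" using p r0 by simp
    ultimately have "\<forall>\<^sub>F n in sequentially. 1 / real (Suc n) < r / p" by (intro order_tendstoD) auto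
    then obtain N where N: "\<And>n. n \<ge> N \<Longrightarrow> 1 / real (Suc n) < r / p" by (auto simp: eventually_sequentially)
    show "\<exists>N. \<forall>n\<ge>N. real (Suc n) * (frac_mean \<beta> F r (x + (1 / real (Suc n)) *\<^sub>R v) - ?m) \<le> 2 * real DIM('a) / r * ?m"
    proof (intro exI allI impI)
      fix n assume n: "n \<ge> N"
      define t where "t = 1 / real (Suc n)"
      have t: "t > 0" "t < r / p" using N[OF n] by (auto simp: t_def)
      define z where "z = p * (t / r)"
      have z: "0 \<le> z" "z \<le> 1" using t p r0 by (auto simp: z_def field_simps)
      have "ball (x + t *\<^sub>R v) r \<subseteq> ball x (r + t)"
      proof
        fix y assume "y \<in> ball (x + t *\<^sub>R v) r"
        moreover have "dist x (x + t *\<^sub>R v) = t" using t v by (simp add: dist_norm)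
        ultimately show "y \<in> ball x (r + t)" using dist_triangle[of x y "x + t *\<^sub>R v"] by simp
      qed
      then have "frac_mean \<beta> F r (x + t *\<^sub>R v) \<le> (r / (r + t)) powr (\<beta> - DIM('a)) * frac_mean \<beta> F (r + t) x"
        using t r0 by (intro frac_mean_subset_le F nn) auto
      also have "\<dots> \<le> (r / (r + t)) powr (\<beta> - DIM('a)) * ?m"
        using r t r0 by (intro mult_left_mono) (auto simp: optimal_radius_def)
      also have "(r / (r + t)) powr (\<beta> - DIM('a)) = (1 + t / r) powr p"
      proof -
        have "(r / (r + t)) powr (\<beta> - DIM('a)) = inverse ((r + t) / r) powr (- p)" by (simp add: p_def)
        also have "\<dots> = ((r + t) / r) powr p" using r0 t by (subst inverse_powr) (auto simp: powr_minus)
        also have "(r + t) / r = 1 + t / r" using r0 by (simp add: add_divide_distrib)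
        finally show ?thesis .
      qed
      also have "(1 + t / r) powr p \<le> exp (t / r) powr p"
        using t r0 p by (intro powr_mono2 exp_ge_add_one_self) auto
      then have "(1 + t / r) powr p * ?m \<le> exp z * ?m"
        using m0 by (intro mult_right_mono) (simp_all add: powr_def z_def)
      also have "exp z \<le> 1 + 2 * z" 
      proof -
        have "exp z \<le> 1 + z + z\<^sup>2" using z by (rule exp_bound)
        also have "z\<^sup>2 \<le> z" using z by (simp add: power2_eq_square mult_left_le)
        finally show ?thesis by simp
      qed
      then have "exp z * ?m \<le> (1 + 2 * z) * ?m" using m0 by (intro mult_right_mono)
      finally have "frac_mean \<beta> F r (x + t *\<^sub>R v) - ?m \<le> 2 * z * ?m" by (simp add: algebra_simps)
      then have "real (Suc n) * (frac_mean \<beta> F r (x + t *\<^sub>R v) - ?m) \<le> real (Suc n) * (2 * z * ?m)"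
        by (intro mult_left_mono) auto
      also have "\<dots> = 2 * p / r * ?m" by (simp add: z_def t_def)
      also have "\<dots> \<le> 2 * real DIM('a) / r * ?m"
        using p r0 m0 by (intro mult_right_mono divide_right_mono) auto
      finally show "real (Suc n) * (frac_mean \<beta> F r (x + (1 / real (Suc n)) *\<^sub>R v) - ?m) \<le> 2 * real DIM('a) / r * ?m"
        by (simp add: t_def)
    qed
  qed
  have "frac_mean \<beta> (\<lambda>y. w y \<bullet> (- e)) r x = - frac_mean \<beta> (\<lambda>y. w y \<bullet> e) r x"
    using frac_mean_cmult[of \<beta> "-1" "\<lambda>y. w y \<bullet> e" r x] by simp
  then show ?thesis using le[OF e] le[of "- e"] e by auto
qed

lemma frac_mean_tendsto_L1:
  fixes F :: "'a::euclidean_space \<Rightarrow> real"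
  assumes F: "integrable lborel F" and F': "\<And>n. integrable lborel (F' n)"
    and lim: "(\<lambda>n. LINT y|lborel. \<bar>F' n y - F y\<bar>) \<longlonglongrightarrow> 0"
    and x: "x \<longlonglongrightarrow> x0" and s: "s \<longlonglongrightarrow> s0" "s0 > 0"
  shows "(\<lambda>n. frac_mean \<beta> (F' n) (s n) (x n)) \<longlonglongrightarrow> frac_mean \<beta> F s0 x0"
proof -
  have "(\<lambda>n. s n powr (\<beta> - DIM('a)) / unit_ball_vol DIM('a) * (LINT y|lborel. \<bar>F' n y - F y\<bar>))
     \<longlonglongrightarrow> s0 powr (\<beta> - DIM('a)) / unit_ball_vol DIM('a) * 0"
    using s by (intro tendsto_intros lim) auto
  then have z: "(\<lambda>n. s n powr (\<beta> - DIM('a)) / unit_ball_vol DIM('a) * (LINT y|lborel. \<bar>F' n y - F y\<bar>)) \<longlonglongrightarrow> 0" by simp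
  have "(\<lambda>n. frac_mean \<beta> (F' n) (s n) (x n) - frac_mean \<beta> F (s n) (x n)) \<longlonglongrightarrow> 0"
  proof (rule Lim_null_comparison[OF always_eventually[OF allI] z])
    fix n
    show "norm (frac_mean \<beta> (F' n) (s n) (x n) - frac_mean \<beta> F (s n) (x n))
       \<le> s n powr (\<beta> - DIM('a)) / unit_ball_vol DIM('a) * (LINT y|lborel. \<bar>F' n y - F y\<bar>)"
      using frac_mean_abs_le[of "\<lambda>y. F' n y - F y" \<beta> "s n" "x n"] F F'[of n] by (simp add: frac_mean_diff)
  qed
  from tendsto_add[OF this frac_mean_tendsto[OF F s(1) x s(2), of \<beta>]] show ?thesis by simp
qed

lemma optimal_radius_limit:
  fixes F :: "'a::euclidean_space \<Rightarrow> real"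
  assumes F: "integrable lborel F" and F': "\<And>n. integrable lborel (F' n)"
    and lim: "(\<lambda>n. LINT y|lborel. \<bar>F' n y - F y\<bar>) \<longlonglongrightarrow> 0"
    and optimal_radius: "\<And>n. optimal_radius \<beta> (F' n) (x n) (r n)" and x: "x \<longlonglongrightarrow> x0" and r: "r \<longlonglongrightarrow> r0" and r0: "r0 > 0"
  shows "optimal_radius \<beta> F x0 r0"
proof -
  note conv = frac_mean_tendsto_L1[OF F F' lim x]
  have "frac_mean \<beta> F s x0 \<le> frac_mean \<beta> F r0 x0" if s: "s > 0" for s
    by (rule LIMSEQ_le[OF conv[OF tendsto_const s] conv[OF r r0]])
       (use optimal_radius s in \<open>auto simp: optimal_radius_def\<close>)
  then show ?thesis using r0 by (simp add: optimal_radius_def)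
qed

text \<open>Optimality is a closed condition on pairs of a point and a radius. Projecting along a compact
  interval of radii keeps closedness, and countably many intervals exhaust the radii.\<close>

lemma optimal_radius_set_borel:
  fixes F :: "'a::euclidean_space \<Rightarrow> real" and a b c :: real
  assumes F: "integrable lborel F"
  shows "{x. \<exists>r. optimal_radius \<beta> F x r \<and> 0 \<le> a * norm x + b * r + c} \<in> sets borel"
proof -
  let ?S = "\<lambda>n::nat. {x. \<exists>r\<in>{1 / real (Suc n)..real (Suc n)}. optimal_radius \<beta> F x r \<and> 0 \<le> a * norm x + b * r + c}"
  have "closed (?S n)" for n
    unfolding closed_sequential_limits
  proof (intro allI impI, elim conjE)
    fix x x0 assume x: "\<forall>k. x k \<in> ?S n" "x \<longlonglongrightarrow> x0"
    have "\<forall>k. \<exists>r. r \<in> {1 / real (Suc n)..real (Suc n)} \<and> optimal_radius \<beta> F (x k) r \<and> 0 \<le> a * norm (x k) + b * r + c"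
      using x(1) by blast
    from choice[OF this] obtain r where R: "\<forall>k. r k \<in> {1 / real (Suc n)..real (Suc n)} \<and>
      optimal_radius \<beta> F (x k) (r k) \<and> 0 \<le> a * norm (x k) + b * r k + c" ..
    then have r: "\<And>k. r k \<in> {1 / real (Suc n)..real (Suc n)}" "\<And>k. optimal_radius \<beta> F (x k) (r k)"
      "\<And>k. 0 \<le> a * norm (x k) + b * r k + c"
      by blast+
    obtain r0 s where s: "r0 \<in> {1 / real (Suc n)..real (Suc n)}" "strict_mono s" "(r \<circ> s) \<longlonglongrightarrow> r0"
      using compact_Icc[of "1 / real (Suc n)" "real (Suc n)", unfolded compact_def] r(1) by metis
    have xs: "(\<lambda>k. x (s k)) \<longlonglongrightarrow> x0" using LIMSEQ_subseq_LIMSEQ[OF x(2) s(2)] by (simp add: o_def)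
    have rs: "(\<lambda>k. r (s k)) \<longlonglongrightarrow> r0" using s(3) by (simp add: o_def)
    have "0 < 1 / real (Suc n)" by simp
    then have r0: "r0 > 0" using s(1) by (meson atLeastAtMost_iff less_le_trans)
    have "optimal_radius \<beta> F x0 r0"
      by (rule optimal_radius_limit[OF F, of "\<lambda>_. F" \<beta> "\<lambda>k. x (s k)" "\<lambda>k. r (s k)"]) (use F r xs rs r0 in auto)
    moreover have "0 \<le> a * norm x0 + b * r0 + c"
      by (rule LIMSEQ_le_const[of "\<lambda>k. a * norm (x (s k)) + b * r (s k) + c"])
         (use r(3) in \<open>auto intro!: tendsto_intros xs rs\<close>)
    ultimately show "x0 \<in> ?S n" using s(1) by blast
  qed
  then have "(\<Union>n. ?S n) \<in> sets borel" by (intro sets.countable_UN) auto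
  also have "(\<Union>n. ?S n) = {x. \<exists>r. optimal_radius \<beta> F x r \<and> 0 \<le> a * norm x + b * r + c}"
  proof (intro equalityI subsetI)
    fix x assume "x \<in> {x. \<exists>r. optimal_radius \<beta> F x r \<and> 0 \<le> a * norm x + b * r + c}"
    then obtain r where r: "optimal_radius \<beta> F x r" "0 \<le> a * norm x + b * r + c" by blast
    then obtain n where "r \<in> {1 / real (Suc n)..real (Suc n)}"
      using eventually_in_exhausting_interval[of r] by (auto simp: optimal_radius_def eventually_sequentially)
    then show "x \<in> (\<Union>n. ?S n)" using r by blast
  qed blast
  finally show ?thesis .
qed

section \<open>Representatives of radial Sobolev functions\<close>

text \<open>Functions in the Sobolev space are treated through Borel representatives of the function and of
  its gradient.\<close>

definition radial_representative :: "(real ^ 'n \<Rightarrow> real) \<Rightarrow> (real ^ 'n \<Rightarrow> real) \<Rightarrow> (real ^ 'n \<Rightarrow> real ^ 'n) \<Rightarrow> bool" where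
  "radial_representative f u g \<longleftrightarrow> wgrad u g \<and> integrable lborel u \<and> integrable lborel g \<and>
     (\<exists>h. AE x in lborel. u x = h (norm x)) \<and> (AE x in lborel. f x = u x)"

lemma lebesgue_integrable_representative:
  fixes f u :: "'a::euclidean_space \<Rightarrow> 'b::euclidean_space"
  assumes f: "integrable lebesgue f" and [measurable]: "u \<in> borel_measurable borel"
    and ae: "AE x in lborel. f x = u x"
  shows "integrable lborel u"
proof -
  have "integrable lebesgue u"
    by (rule integrable_cong_AE_imp[OF f]) (use ae in \<open>auto intro!: AE_completion measurable_completion\<close>)
  then show ?thesis by (subst (asm) integrable_completion) auto
qed

lemma radial_representative_exists:
  assumes "f \<in> (W11_rad :: (real ^ 'n \<Rightarrow> real) set)"
  obtains u g where "radial_representative f u g"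
proof -
  from assms obtain g0 h where f: "integrable lebesgue f" and g0: "f has_weak_gradient g0" "integrable lebesgue g0"
    and h: "AE x in lebesgue. f x = h (norm x)"
    by (auto simp: W11_rad_def W11_def radial_def)
  obtain u g where w: "wgrad u g" and u: "AE x in lborel. f x = u x" and g: "AE x in lborel. g0 x = g x"
    using weak_gradient_ex_wgrad[OF g0(1)] by metis
  have [measurable]: "u \<in> borel_measurable borel" "g \<in> borel_measurable borel"
    using w by (auto simp: wgrad_def locint_def)
  have "integrable lborel u" "integrable lborel g"
    by (rule lebesgue_integrable_representative[OF f _ u], simp)
       (rule lebesgue_integrable_representative[OF g0(2) _ g], simp)
  moreover have "AE x in lborel. u x = h (norm x)"
    using h u unfolding AE_completion_iff by eventually_elim simp
  ultimately show ?thesis using w u by (intro that[of u g]) (auto simp: radial_representative_def)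
qed

lemma radial_representative_grad: "radial_representative f u g \<Longrightarrow> AE x in lborel. weak_grad f x = g x"
  unfolding radial_representative_def using weak_grad_AE[of u g f] by blast

lemma radial_representative_abs:
  assumes "radial_representative f u g"
  shows "wgrad (\<lambda>y. \<bar>u y\<bar>) (\<lambda>y. sgn (u y) *\<^sub>R g y)" "integrable lborel (\<lambda>y. sgn (u y) *\<^sub>R g y)"
    "integrable lborel (\<lambda>y. \<bar>u y\<bar>)"
proof -
  have u: "wgrad u g" "integrable lborel u" "integrable lborel g" using assms by (auto simp: radial_representative_def)
  note [measurable] = borel_measurable_integrable[OF u(2), simplified]
  show "wgrad (\<lambda>y. \<bar>u y\<bar>) (\<lambda>y. sgn (u y) *\<^sub>R g y)" "integrable lborel (\<lambda>y. sgn (u y) *\<^sub>R g y)"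
    using wgrad_abs[OF u, of "\<lambda>y. sgn (u y)"] by (auto simp: sgn_if)
  show "integrable lborel (\<lambda>y. \<bar>u y\<bar>)" using u by simp
qed

lemma frac_avg_eq_frac_mean:
  fixes f u :: "'a::euclidean_space \<Rightarrow> real"
  assumes u: "integrable lborel u" and ae: "AE x in lborel. f x = u x" and r: "r > 0"
  shows "frac_avg \<beta> f x r = ennreal (frac_mean \<beta> (\<lambda>y. \<bar>u y\<bar>) r x)"
proof -
  note [measurable] = borel_measurable_integrable[OF u, simplified]
  have ae': "AE x in lebesgue. f x = u x" using ae by (rule AE_completion)
  have "(\<integral>\<^sup>+y\<in>ball x r. ennreal \<bar>f y\<bar> \<partial>lebesgue) = (\<integral>\<^sup>+y. ennreal (indicator (ball x r) y * \<bar>u y\<bar>) \<partial>lebesgue)"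
    using ae' by (intro nn_integral_cong_AE) (auto simp: indicator_def elim!: eventually_mono)
  also have "\<dots> = (\<integral>\<^sup>+y. ennreal (indicator (ball x r) y * \<bar>u y\<bar>) \<partial>lborel)"
    by (rule nn_integral_completion)
  also have "\<dots> = ennreal (LINT y|lborel. indicator (ball x r) y * \<bar>u y\<bar>)"
    by (intro nn_integral_eq_integral ball_mult_integrable integrable_abs u) auto
  finally have I: "(\<integral>\<^sup>+y\<in>ball x r. ennreal \<bar>f y\<bar> \<partial>lebesgue) = ennreal (LINT y|lborel. indicator (ball x r) y * \<bar>u y\<bar>)" .
  have "r powr \<beta> / measure lebesgue (ball x r) = r powr (\<beta> - DIM('a)) / unit_ball_vol DIM('a)"
    using r by (simp add: content_ball powr_diff powr_realpow)
  then show ?thesis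
    unfolding frac_avg_def I frac_mean_def
    by (subst ennreal_mult[symmetric]) (auto intro!: integral_nonneg_AE divide_nonneg_nonneg)
qed

lemma optimal_radius_max_ball:
  fixes f u :: "'a::euclidean_space \<Rightarrow> real"
  assumes u: "integrable lborel u" and ae: "AE x in lborel. f x = u x"
    and r: "optimal_radius \<beta> (\<lambda>y. \<bar>u y\<bar>) x r"
  shows "ball x r \<in> max_balls \<beta> f x" "frac_max_real \<beta> f x = frac_mean \<beta> (\<lambda>y. \<bar>u y\<bar>) r x"
proof -
  have r0: "r > 0" using r by (simp add: optimal_radius_def)
  have eq: "frac_max \<beta> f x = frac_avg \<beta> f x r"
    unfolding frac_max_def
  proof (rule antisym)
    show "(SUP r\<in>{0<..}. frac_avg \<beta> f x r) \<le> frac_avg \<beta> f x r"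
      using r r0 by (intro SUP_least) (auto simp: frac_avg_eq_frac_mean[OF u ae] optimal_radius_def intro: ennreal_leI)
    show "frac_avg \<beta> f x r \<le> (SUP r\<in>{0<..}. frac_avg \<beta> f x r)" using r0 by (intro SUP_upper) auto
  qed
  then show "ball x r \<in> max_balls \<beta> f x" using r0 by (auto simp: max_balls_def)
  show "frac_max_real \<beta> f x = frac_mean \<beta> (\<lambda>y. \<bar>u y\<bar>) r x"
    unfolding frac_max_real_def eq frac_avg_eq_frac_mean[OF u ae r0] by (simp add: frac_mean_nonneg)
qed

lemma radial_optimal_radius_exists:
  fixes f :: "real ^ 'n \<Rightarrow> real"
  assumes rep: "radial_representative f u g" and \<beta>: "0 < \<beta>" "\<beta> < 1" and x: "x \<noteq> 0"
  shows "\<exists>r. optimal_radius \<beta> (\<lambda>y. \<bar>u y\<bar>) x r"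
proof -
  obtain h where u: "wgrad u g" "integrable lborel u" "integrable lborel g" and rad: "AE x in lborel. u x = h (norm x)"
    using rep by (auto simp: radial_representative_def)
  have \<beta>d: "\<beta> < real DIM(real ^ 'n)" by (rule less_dimension[OF \<beta>(2)])
  let ?a = "norm x"
  let ?K = "2 ^ CARD('n) * (32 * (real CARD('n))\<^sup>2) / (?a ^ (CARD('n) - 1) * unit_ball_vol CARD('n))
     * ((LINT y|lborel. \<bar>u y\<bar>) + (LINT y|lborel. norm (g y)))"
  show ?thesis
  proof (rule optimal_radius_exists[OF integrable_abs[OF u(2)] _ \<beta>(1) \<beta>d])
    show "0 < ?a / 8" using x by simp
    show "0 \<le> ?K" by (intro mult_nonneg_nonneg divide_nonneg_nonneg add_nonneg_nonneg integral_nonneg_AE) auto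
    show "frac_mean \<beta> (\<lambda>y. \<bar>u y\<bar>) r x \<le> ?K * r powr \<beta>" if "0 < r" "r \<le> ?a / 8" for r
      using radial_frac_mean_bound[OF rad u, of ?a x r \<beta>] x that by (simp add: mult_ac)
  qed simp
qed

lemma radial_maximal_gradient:
  fixes f :: "real ^ 'n \<Rightarrow> real"
  assumes rep: "radial_representative f u g" and \<beta>: "0 < \<beta>" "\<beta> < 1"
  shows "weakly_differentiable (frac_max_real \<beta> f)"
    "weak_grad (frac_max_real \<beta> f) \<in> borel_measurable lebesgue"
    "AE x in lborel. \<forall>r. optimal_radius \<beta> (\<lambda>y. \<bar>u y\<bar>) x r \<longrightarrow>
       (\<forall>e\<in>Basis. weak_grad (frac_max_real \<beta> f) x \<bullet> e = frac_mean \<beta> (\<lambda>y. (sgn (u y) *\<^sub>R g y) \<bullet> e) r x)"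
proof -
  let ?F = "\<lambda>y. \<bar>u y\<bar>"
  let ?w = "\<lambda>y. sgn (u y) *\<^sub>R g y"
  let ?M = "frac_max_real \<beta> f"
  have u: "integrable lborel u" and ae: "AE x in lborel. f x = u x" using rep by (auto simp: radial_representative_def)
  note F = radial_representative_abs[OF rep]
  have \<beta>d: "\<beta> < real DIM(real ^ 'n)" by (rule less_dimension[OF \<beta>(2)])
  have "AE x in lborel. x \<noteq> (0 :: real ^ 'n)" by (rule AE_lborel_singleton)
  then have ex: "AE x in lborel. \<exists>r. optimal_radius \<beta> ?F x r"
    by eventually_elim (use radial_optimal_radius_exists[OF rep \<beta>] in auto)
  define M' where "M' x = lim (\<lambda>n. trunc_max \<beta> ?F n x)" for x
  have [measurable]: "trunc_max \<beta> ?F n \<in> borel_measurable borel" for n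
    by (intro borel_measurable_continuous_onI trunc_max_continuous[OF F(1,3,2) \<beta>d])
  have M'm: "M' \<in> borel_measurable borel" unfolding M'_def by measurable
  have M': "M' x = frac_mean \<beta> ?F r x" if r: "optimal_radius \<beta> ?F x r" for x r
  proof -
    have r0: "r > 0" using r by (simp add: optimal_radius_def)
    have "\<forall>\<^sub>F n in sequentially. trunc_max \<beta> ?F n x = frac_mean \<beta> ?F r x"
      using eventually_in_exhausting_interval[OF r0] by eventually_elim (rule optimal_radius_trunc_max[OF F(3) r])
    then show ?thesis unfolding M'_def by (intro limI tendsto_eventually)
  qed
  obtain G where G: "wgrad M' G"
    "AE x in lborel. \<forall>r. optimal_radius \<beta> ?F x r \<longrightarrow> (\<forall>e\<in>Basis. G x \<bullet> e = frac_mean \<beta> (\<lambda>y. ?w y \<bullet> e) r x)"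
    by (rule maximal_wgrad[OF F(1,3,2) _ \<beta>(1) \<beta>d ex M' M'm]) auto
  have MM': "AE x in lborel. ?M x = M' x"
    using ex by eventually_elim (use optimal_radius_max_ball(2)[OF u ae] M' in auto)
  then have "AE x in lborel. M' x = ?M x" by eventually_elim simp
  then have has: "?M has_weak_gradient G" using wgrad_imp_weak_gradient[OF G(1)] by simp
  then show "weakly_differentiable ?M" by (auto simp: weakly_differentiable_def)
  have "?M has_weak_gradient weak_grad ?M"
    unfolding weak_grad_def by (rule someI[of "\<lambda>g. ?M has_weak_gradient g", OF has])
  then show "weak_grad ?M \<in> borel_measurable lebesgue"
    by (intro locally_integrable_measurable) (simp add: has_weak_gradient_def)
  show "AE x in lborel. \<forall>r. optimal_radius \<beta> ?F x r \<longrightarrow> (\<forall>e\<in>Basis. weak_grad ?M x \<bullet> e = frac_mean \<beta> (\<lambda>y. ?w y \<bullet> e) r x)"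
    using weak_grad_AE[OF G(1) MM'] G(2) by eventually_elim simp
qed

lemma component_integral_le:
  fixes u :: "'a::euclidean_space \<Rightarrow> real" and g :: "'a \<Rightarrow> 'a"
  assumes g: "integrable lborel g" and "integrable lborel (\<lambda>y. sgn (u y) *\<^sub>R g y)" and e: "norm e = 1"
  shows "(LINT y|lborel. \<bar>(sgn (u y) *\<^sub>R g y) \<bullet> e\<bar>) \<le> (LINT y|lborel. norm (g y))"
proof (rule integral_mono)
  fix y
  have "\<bar>(sgn (u y) *\<^sub>R g y) \<bullet> e\<bar> \<le> norm (sgn (u y) *\<^sub>R g y) * norm e" by (rule Cauchy_Schwarz_ineq2)
  also have "\<dots> \<le> norm (g y)" using e by (auto simp: sgn_if)
  finally show "\<bar>(sgn (u y) *\<^sub>R g y) \<bullet> e\<bar> \<le> norm (g y)" .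
qed (intro integrable_abs integrable_inner_left integrable_norm assms)+

text \<open>Two bounds for the vector with the averages as components: the first is used for radii bounded
  below on a bounded set, the second, with its additional decay, for large radii.\<close>

lemma gradient_bounds:
  fixes u :: "real ^ 'n \<Rightarrow> real"
  assumes rep: "radial_representative f u g" and \<beta>: "0 < \<beta>" "\<beta> < 1" and r: "optimal_radius \<beta> (\<lambda>y. \<bar>u y\<bar>) x r"
    and z: "\<forall>e\<in>Basis. z \<bullet> e = frac_mean \<beta> (\<lambda>y. (sgn (u y) *\<^sub>R g y) \<bullet> e) r x"
  shows "norm z \<le> real CARD('n) * (r powr (\<beta> - CARD('n)) / unit_ball_vol CARD('n) * (LINT y|lborel. norm (g y)))"
    "norm z \<le> real CARD('n) * (2 * real CARD('n) * (r powr (\<beta> - CARD('n) - 1) / unit_ball_vol CARD('n) * (LINT y|lborel. \<bar>u y\<bar>)))"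
proof -
  note F = radial_representative_abs[OF rep]
  have g: "integrable lborel g" using rep by (auto simp: radial_representative_def)
  have r0: "r > 0" using r by (simp add: optimal_radius_def)
  have \<beta>d: "\<beta> < real DIM(real ^ 'n)" by (rule less_dimension[OF \<beta>(2)])
  show "norm z \<le> real CARD('n) * (r powr (\<beta> - CARD('n)) / unit_ball_vol CARD('n) * (LINT y|lborel. norm (g y)))"
  proof (rule norm_le_component_bound[of z, simplified])
    fix e :: "real ^ 'n" assume e: "e \<in> Basis"
    have "\<bar>z \<bullet> e\<bar> \<le> r powr (\<beta> - CARD('n)) / unit_ball_vol CARD('n) * (LINT y|lborel. \<bar>(sgn (u y) *\<^sub>R g y) \<bullet> e\<bar>)"
      using z e frac_mean_abs_le[OF integrable_inner_left[OF F(2)], of \<beta> e r x] by simp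
    also have "\<dots> \<le> r powr (\<beta> - CARD('n)) / unit_ball_vol CARD('n) * (LINT y|lborel. norm (g y))"
      using e by (intro mult_left_mono component_integral_le g F(2)) auto
    finally show "\<bar>z \<bullet> e\<bar> \<le> r powr (\<beta> - CARD('n)) / unit_ball_vol CARD('n) * (LINT y|lborel. norm (g y))" .
  qed
  show "norm z \<le> real CARD('n) * (2 * real CARD('n) * (r powr (\<beta> - CARD('n) - 1) / unit_ball_vol CARD('n) * (LINT y|lborel. \<bar>u y\<bar>)))"
  proof (rule norm_le_component_bound[of z, simplified])
    fix e :: "real ^ 'n" assume e: "e \<in> Basis"
    have "\<bar>z \<bullet> e\<bar> \<le> 2 * real CARD('n) / r * frac_mean \<beta> (\<lambda>y. \<bar>u y\<bar>) r x"
      using z e optimal_radius_slope_bound[OF F(1,3,2) _ \<beta>(1) \<beta>d r, of e] by simp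
    also have "\<dots> \<le> 2 * real CARD('n) / r * (r powr (\<beta> - CARD('n)) / unit_ball_vol CARD('n) * (LINT y|lborel. \<bar>u y\<bar>))"
      using frac_mean_abs_le[OF F(3), of \<beta> r x] r0 by (intro mult_left_mono) auto
    also have "r powr (\<beta> - CARD('n)) = r * r powr (\<beta> - CARD('n) - 1)"
      using r0 by (simp add: powr_mult_base)
    also have "2 * real CARD('n) / r * (r * r powr (\<beta> - CARD('n) - 1) / unit_ball_vol CARD('n) * (LINT y|lborel. \<bar>u y\<bar>))
       = 2 * real CARD('n) * (r powr (\<beta> - CARD('n) - 1) / unit_ball_vol CARD('n) * (LINT y|lborel. \<bar>u y\<bar>))"
      using r0 by simp
    finally show "\<bar>z \<bullet> e\<bar> \<le> 2 * real CARD('n) * (r powr (\<beta> - CARD('n) - 1) / unit_ball_vol CARD('n) * (LINT y|lborel. \<bar>u y\<bar>))" .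
  qed
qed

section \<open>Convergence of the gradients\<close>

lemma ball_exhaustion_tendsto:
  fixes k :: "'a::euclidean_space \<Rightarrow> real"
  assumes k: "integrable lborel k"
  shows "(\<lambda>n. LINT y|lborel. indicator (ball 0 (real n)) y * k y) \<longlonglongrightarrow> (LINT y|lborel. k y)"
proof (rule integral_dominated_convergence[where w="\<lambda>y. \<bar>k y\<bar>"])
  note [measurable] = borel_measurable_integrable[OF k, simplified]
  show "AE y in lborel. (\<lambda>n. indicator (ball 0 (real n)) y * k y) \<longlonglongrightarrow> k y"
  proof (intro AE_I2 tendsto_eventually)
    fix y :: 'a
    obtain N where N: "norm y < real N" using reals_Archimedean2 by blast
    show "\<forall>\<^sub>F n in sequentially. indicator (ball 0 (real n)) y * k y = k y"
      using eventually_ge_at_top[of N] by eventually_elim (use N in \<open>auto simp: indicator_def\<close>)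
  qed
  show "AE y in lborel. norm (indicator (ball 0 (real n)) y * k y) \<le> \<bar>k y\<bar>" for n
    by (intro AE_I2) (auto simp: indicator_def)
qed (use k in auto)

lemma AE_tendsto_of_geometric_L1:
  fixes U :: "nat \<Rightarrow> 'a::euclidean_space \<Rightarrow> real"
  assumes U: "\<And>k. integrable lborel (U k)" and u: "integrable lborel u"
    and le: "\<And>k. (LINT y|lborel. \<bar>U k y - u y\<bar>) \<le> (1/2) ^ k"
  shows "AE y in lborel. (\<lambda>k. U k y) \<longlonglongrightarrow> u y"
proof -
  note [measurable] = borel_measurable_integrable[OF u, simplified] borel_measurable_integrable[OF U, simplified]
  have "(\<integral>\<^sup>+y. (\<Sum>k. ennreal \<bar>U k y - u y\<bar>) \<partial>lborel) = (\<Sum>k. \<integral>\<^sup>+y. ennreal \<bar>U k y - u y\<bar> \<partial>lborel)"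
    by (rule nn_integral_suminf) measurable
  also have "\<dots> = (\<Sum>k. ennreal (LINT y|lborel. \<bar>U k y - u y\<bar>))"
    using U u by (intro suminf_cong nn_integral_eq_integral) auto
  also have "\<dots> \<le> (\<Sum>k. ennreal ((1/2) ^ k))"
    using le by (intro suminf_le ennreal_leI) auto
  also have "\<dots> < \<infinity>" by (subst suminf_ennreal2) (auto intro: summable_geometric)
  finally have "(\<integral>\<^sup>+y. (\<Sum>k. ennreal \<bar>U k y - u y\<bar>) \<partial>lborel) \<noteq> \<infinity>" by simp
  then have "AE y in lborel. (\<Sum>k. ennreal \<bar>U k y - u y\<bar>) \<noteq> \<infinity>"
    by (intro nn_integral_PInf_AE) auto
  then show ?thesis
  proof eventually_elim
    case (elim y)
    then have "summable (\<lambda>k. \<bar>U k y - u y\<bar>)" by (intro summable_suminf_not_top) auto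
    then have "(\<lambda>k. \<bar>U k y - u y\<bar>) \<longlonglongrightarrow> 0" by (rule summable_LIMSEQ_zero)
    then show ?case by (simp add: tendsto_rabs_zero_iff LIM_zero_iff)
  qed
qed

text \<open>Taking absolute values is continuous on gradients: where the limit function vanishes, so does
  its gradient, and elsewhere the signs converge.\<close>

lemma sgn_gradient_tendsto:
  fixes u :: "real ^ 'n \<Rightarrow> real"
  assumes rep: "radial_representative f u g" and U: "\<And>k. radial_representative (h k) (U k) (G k)"
    and leU: "\<And>k. (LINT y|lborel. \<bar>U k y - u y\<bar>) \<le> (1/2) ^ k"
    and limG: "(\<lambda>k. LINT y|lborel. norm (G k y - g y)) \<longlonglongrightarrow> 0"
  shows "(\<lambda>k. LINT y|lborel. norm (sgn (U k y) *\<^sub>R G k y - sgn (u y) *\<^sub>R g y)) \<longlonglongrightarrow> 0"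
proof -
  have i: "integrable lborel u" "integrable lborel g" "\<And>k. integrable lborel (U k)" "\<And>k. integrable lborel (G k)"
    and w: "wgrad u g"
    using rep U by (auto simp: radial_representative_def)
  note [measurable] = i[THEN borel_measurable_integrable, simplified]
  have "(\<lambda>k. LINT y|lborel. norm ((sgn (U k y) - sgn (u y)) *\<^sub>R g y)) \<longlonglongrightarrow> (LINT y|(lborel :: (real ^ 'n) measure). 0)"
  proof (rule integral_dominated_convergence[where w="\<lambda>y. 2 * norm (g y)"])
    show "AE y in lborel. (\<lambda>k. norm ((sgn (U k y) - sgn (u y)) *\<^sub>R g y)) \<longlonglongrightarrow> 0"
      using AE_tendsto_of_geometric_L1[OF i(3) i(1) leU] wgrad_zero_on_zero_set[OF w i(1,2)]
    proof eventually_elim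
      case (elim y)
      show ?case
      proof (cases "u y = 0")
        case False
        have "(\<lambda>k. norm ((sgn (U k y) - sgn (u y)) *\<^sub>R g y)) \<longlonglongrightarrow> norm ((sgn (u y) - sgn (u y)) *\<^sub>R g y)"
          using elim(1) False by (intro tendsto_intros)
        then show ?thesis by simp
      qed (use elim in simp)
    qed
    show "AE y in lborel. norm (norm ((sgn (U k y) - sgn (u y)) *\<^sub>R g y)) \<le> 2 * norm (g y)" for k
      by (intro AE_I2) (auto simp: sgn_if)
  qed (use i in auto)
  then have "(\<lambda>k. (LINT y|lborel. norm (G k y - g y)) + (LINT y|lborel. norm ((sgn (U k y) - sgn (u y)) *\<^sub>R g y))) \<longlonglongrightarrow> 0 + 0"
    by (intro tendsto_add limG) simp
  then have z: "(\<lambda>k. (LINT y|lborel. norm (G k y - g y)) + (LINT y|lborel. norm ((sgn (U k y) - sgn (u y)) *\<^sub>R g y))) \<longlonglongrightarrow> 0"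
    by simp
  show ?thesis
  proof (rule Lim_null_comparison[OF always_eventually[OF allI] z])
    fix k
    have i1: "integrable lborel (\<lambda>y. norm (G k y - g y))" using i by auto
    have i2: "integrable lborel (\<lambda>y. norm ((sgn (U k y) - sgn (u y)) *\<^sub>R g y))"
      by (rule Bochner_Integration.integrable_bound[of _ "\<lambda>y. 2 * norm (g y)"])
         (use i in \<open>auto simp: sgn_if intro!: AE_I2\<close>)
    have "(LINT y|lborel. norm (sgn (U k y) *\<^sub>R G k y - sgn (u y) *\<^sub>R g y))
      \<le> (LINT y|lborel. norm (G k y - g y) + norm ((sgn (U k y) - sgn (u y)) *\<^sub>R g y))"
    proof (rule integral_mono)
      show "integrable lborel (\<lambda>y. norm (sgn (U k y) *\<^sub>R G k y - sgn (u y) *\<^sub>R g y))"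
        using radial_representative_abs(2)[OF U, of k] radial_representative_abs(2)[OF rep] by (intro integrable_norm Bochner_Integration.integrable_diff)
      show "integrable lborel (\<lambda>y. norm (G k y - g y) + norm ((sgn (U k y) - sgn (u y)) *\<^sub>R g y))"
        by (intro Bochner_Integration.integrable_add i1 i2)
      fix y
      have "sgn (U k y) *\<^sub>R G k y - sgn (u y) *\<^sub>R g y = sgn (U k y) *\<^sub>R (G k y - g y) + (sgn (U k y) - sgn (u y)) *\<^sub>R g y"
        by (simp add: scaleR_diff_left scaleR_diff_right)
      also have "norm \<dots> \<le> norm (sgn (U k y) *\<^sub>R (G k y - g y)) + norm ((sgn (U k y) - sgn (u y)) *\<^sub>R g y)"
        by (rule norm_triangle_ineq)
      also have "norm (sgn (U k y) *\<^sub>R (G k y - g y)) \<le> norm (G k y - g y)" by (auto simp: sgn_if)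
      finally show "norm (sgn (U k y) *\<^sub>R G k y - sgn (u y) *\<^sub>R g y) \<le> norm (G k y - g y) + norm ((sgn (U k y) - sgn (u y)) *\<^sub>R g y)"
        by simp
    qed
    then show "norm (LINT y|lborel. norm (sgn (U k y) *\<^sub>R G k y - sgn (u y) *\<^sub>R g y))
      \<le> (LINT y|lborel. norm (G k y - g y)) + (LINT y|lborel. norm ((sgn (U k y) - sgn (u y)) *\<^sub>R g y))"
      using i1 i2 by (simp add: integral_nonneg_AE)
  qed
qed

text \<open>Near a limit that is not zero, the maximal functions are bounded below on bounded sets, whereas
  very small and very large balls have small averages.\<close>

lemma radii_bounds:
  fixes u :: "real ^ 'n \<Rightarrow> real"
  assumes \<beta>: "0 < \<beta>" "\<beta> < 1" and u: "integrable lborel u" and pos: "(LINT y|lborel. \<bar>u y\<bar>) > 0"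
    and U: "\<And>k. radial_representative (h k) (U k) (G k)"
    and lim: "(\<lambda>k. LINT y|lborel. \<bar>U k y - u y\<bar>) \<longlonglongrightarrow> 0"
    and bd: "\<And>k. (LINT y|lborel. \<bar>U k y\<bar>) + (LINT y|lborel. norm (G k y)) \<le> N"
    and a: "0 < a"
  obtains r0 R k0 where "r0 > 0"
    "\<And>k x r. k \<ge> k0 \<Longrightarrow> a \<le> norm x \<Longrightarrow> norm x \<le> X \<Longrightarrow> optimal_radius \<beta> (\<lambda>y. \<bar>U k y\<bar>) x r \<Longrightarrow> r0 \<le> r \<and> r \<le> R"
proof -
  have iU: "integrable lborel (U k)" and iG: "integrable lborel (G k)" and wU: "wgrad (U k) (G k)" for k
    using U[of k] by (auto simp: radial_representative_def)
  have ball: "integrable lborel (\<lambda>y. indicator (ball x r) y * \<bar>v y\<bar>)" if "integrable lborel v" for v :: "real ^ 'n \<Rightarrow> real" and x r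
    using that by (intro ball_mult_integrable integrable_abs) auto
  have \<beta>d: "\<beta> - real DIM(real ^ 'n) < 0" using less_dimension[OF \<beta>(2), where 'a="real ^ 'n"] by linarith
  let ?\<omega> = "unit_ball_vol DIM(real ^ 'n)"
  have \<omega>: "?\<omega> > 0" by simp
  have N0: "0 \<le> N" using bd[of 0] by (rule order_trans[rotated]) (auto intro!: add_nonneg_nonneg integral_nonneg_AE)
  have "\<forall>\<^sub>F n in sequentially. 0 < (LINT y|lborel. indicator (ball 0 (real n)) y * \<bar>u y\<bar>)"
    using ball_exhaustion_tendsto[OF integrable_abs[OF u]] pos by (intro order_tendstoD)
  then have "\<exists>n. 0 < (LINT y|lborel. indicator (ball 0 (real n)) y * \<bar>u y\<bar>)"
    by (rule eventually_happens'[OF sequentially_bot])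
  then obtain n where n: "0 < (LINT y|lborel. indicator (ball 0 (real n)) y * \<bar>u y\<bar>)" ..
  define \<kappa> where "\<kappa> = (LINT y|lborel. indicator (ball 0 (real n)) y * \<bar>u y\<bar>)"
  have \<kappa>: "\<kappa> > 0" using n by (simp add: \<kappa>_def)
  have "\<forall>\<^sub>F k in sequentially. (LINT y|lborel. \<bar>U k y - u y\<bar>) < \<kappa> / 2"
    using lim \<kappa> by (intro order_tendstoD) auto
  then obtain k0 where k0: "\<And>k. k \<ge> k0 \<Longrightarrow> (LINT y|lborel. \<bar>U k y - u y\<bar>) < \<kappa> / 2"
    by (auto simp: eventually_sequentially)
  \<comment> \<open>With this radius, every ball about a point of norm at most \<open>X\<close> contains \<open>B(0,n)\<close>, which
    carries the positive mass \<open>\<kappa>\<close> of \<open>u\<close>.\<close>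
  define s where "s = \<bar>X\<bar> + real n + 1"
  have s: "s > 0" by (simp add: s_def)
  define m where "m = s powr (\<beta> - DIM(real ^ 'n)) / ?\<omega> * (\<kappa> / 2)"
  have m: "m > 0" using s \<kappa> \<omega> by (simp add: m_def)
  have lower: "m \<le> frac_mean \<beta> (\<lambda>y. \<bar>U k y\<bar>) s x" if k: "k \<ge> k0" and x: "norm x \<le> X" for k x
  proof -
    have "\<kappa> = (LINT y|lborel. indicator (ball 0 (real n)) y * \<bar>u y\<bar>)" by (simp add: \<kappa>_def)
    also have "\<dots> \<le> (LINT y|lborel. \<bar>U k y - u y\<bar> + indicator (ball x s) y * \<bar>U k y\<bar>)"
    proof (rule integral_mono)
      show "integrable lborel (\<lambda>y. \<bar>U k y - u y\<bar> + indicator (ball x s) y * \<bar>U k y\<bar>)"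
        by (intro Bochner_Integration.integrable_add ball iU integrable_abs Bochner_Integration.integrable_diff u)
      fix y
      have "y \<in> ball x s" if "y \<in> ball 0 (real n)"
        using that x norm_triangle_ineq4[of x y] by (auto simp: dist_norm s_def)
      then show "indicator (ball 0 (real n)) y * \<bar>u y\<bar> \<le> \<bar>U k y - u y\<bar> + indicator (ball x s) y * \<bar>U k y\<bar>"
        by (auto simp: indicator_def)
    qed (rule ball[OF u])
    also have "\<dots> = (LINT y|lborel. \<bar>U k y - u y\<bar>) + (LINT y|lborel. indicator (ball x s) y * \<bar>U k y\<bar>)"
      using ball[OF iU, of x s k] iU[of k] u by (intro Bochner_Integration.integral_add) auto
    finally have "\<kappa> / 2 \<le> (LINT y|lborel. indicator (ball x s) y * \<bar>U k y\<bar>)" using k0[OF k] by linarith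
    then show ?thesis unfolding m_def frac_mean_def using \<omega> by (intro mult_left_mono) auto
  qed
  let ?c = "2 ^ CARD('n) * (32 * (real CARD('n))\<^sup>2) / (a ^ (CARD('n) - 1) * unit_ball_vol CARD('n))"
  have c0: "0 \<le> ?c" using a by simp
  obtain \<epsilon> where \<epsilon>: "\<epsilon> > 0" "\<And>r. 0 < r \<Longrightarrow> r \<le> \<epsilon> \<Longrightarrow> (?c * N) * r powr \<beta> < m"
    using small_radius[OF \<beta>(1) m, of "?c * N"] c0 N0 by (metis mult_nonneg_nonneg)
  obtain R where R: "R > 0" "\<And>r. R \<le> r \<Longrightarrow> r powr (\<beta> - DIM(real ^ 'n)) * (N / ?\<omega>) < m"
    using large_radius[OF \<beta>d m] by metis
  show ?thesis
  proof (rule that[of "min \<epsilon> (a / 8)" k0 R])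
    show "min \<epsilon> (a / 8) > 0" using \<epsilon> a by simp
    fix k r and x :: "real ^ 'n"
    assume k: "k \<ge> k0" and x: "a \<le> norm x" "norm x \<le> X" and r: "optimal_radius \<beta> (\<lambda>y. \<bar>U k y\<bar>) x r"
    have r0: "r > 0" using r by (simp add: optimal_radius_def)
    have mr: "m \<le> frac_mean \<beta> (\<lambda>y. \<bar>U k y\<bar>) r x"
      using lower[OF k x(2)] r s by (auto simp: optimal_radius_def intro: order_trans)
    have "\<not> r < min \<epsilon> (a / 8)"
    proof
      assume small: "r < min \<epsilon> (a / 8)"
      obtain hh where rad: "AE x in lborel. U k x = hh (norm x)" using U[of k] by (auto simp: radial_representative_def)
      have "frac_mean \<beta> (\<lambda>y. \<bar>U k y\<bar>) r x \<le> ?c * r powr \<beta> * ((LINT y|lborel. \<bar>U k y\<bar>) + (LINT y|lborel. norm (G k y)))"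
        by (rule radial_frac_mean_bound[OF rad wU iU iG a x(1) r0]) (use small in simp)
      also have "\<dots> \<le> ?c * r powr \<beta> * N" by (intro mult_left_mono bd mult_nonneg_nonneg c0) simp
      also have "\<dots> < m" using \<epsilon>(2)[OF r0] small by (simp add: mult_ac)
      finally show False using mr by simp
    qed
    moreover have "\<not> R < r"
    proof
      assume "R < r"
      have "frac_mean \<beta> (\<lambda>y. \<bar>U k y\<bar>) r x \<le> r powr (\<beta> - DIM(real ^ 'n)) / ?\<omega> * (LINT y|lborel. \<bar>U k y\<bar>)"
        using frac_mean_abs_le[OF integrable_abs[OF iU[of k]], of \<beta> r x] by simp
      also have "\<dots> \<le> r powr (\<beta> - DIM(real ^ 'n)) / ?\<omega> * N"
      proof (intro mult_left_mono)
        have "0 \<le> (LINT y|lborel. norm (G k y))" by (simp add: integral_nonneg_AE)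
        then show "(LINT y|lborel. \<bar>U k y\<bar>) \<le> N" using bd[of k] by linarith
      qed (use \<omega> in auto)
      also have "\<dots> < m" using R(2)[of r] \<open>R < r\<close> by simp
      finally show False using mr by simp
    qed
    ultimately show "min \<epsilon> (a / 8) \<le> r \<and> r \<le> R" by auto
  qed
qed

lemma tendsto_subseq_criterion:
  fixes X :: "nat \<Rightarrow> 'a::metric_space"
  assumes "\<And>s :: nat \<Rightarrow> nat. strict_mono s \<Longrightarrow> \<exists>t :: nat \<Rightarrow> nat. strict_mono t \<and> (\<lambda>n. X (s (t n))) \<longlonglongrightarrow> L"
  shows "X \<longlonglongrightarrow> L"
proof (rule ccontr)
  assume "\<not> X \<longlonglongrightarrow> L"
  then obtain e where e: "e > 0" "\<And>N. \<exists>n\<ge>N. e \<le> dist (X n) L"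
    unfolding lim_sequentially by (auto simp: not_less)
  then have "infinite {n. e \<le> dist (X n) L}" unfolding infinite_nat_iff_unbounded_le by auto
  from infinite_enumerate[OF this] obtain s :: "nat \<Rightarrow> nat"
    where s: "strict_mono s" "\<And>n. s n \<in> {n. e \<le> dist (X n) L}" by blast
  from assms[OF s(1)] obtain t where t: "strict_mono t" "(\<lambda>n. X (s (t n))) \<longlonglongrightarrow> L" by blast
  obtain n where "dist (X (s (t n))) L < e" using t(2) e(1) unfolding lim_sequentially by blast
  then show False using s(2)[of "t n"] by simp
qed

text \<open>Optimal radii for the approximating functions stay in a compact interval, and every limit of a
  subsequence of them is optimal for the limit function. Since the gradient of the limit is given
  by each of its optimal radii, all subsequences have the same limit.\<close>

lemma gradient_tendsto:
  fixes u :: "real ^ 'n \<Rightarrow> real"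
  assumes \<beta>: "0 < \<beta>" "\<beta> < 1" and rep: "radial_representative f u g" and pos: "(LINT y|lborel. \<bar>u y\<bar>) > 0"
    and U: "\<And>k. radial_representative (h k) (U k) (G k)"
    and lim: "(\<lambda>k. LINT y|lborel. \<bar>U k y - u y\<bar>) \<longlonglongrightarrow> 0"
    and limw: "(\<lambda>k. LINT y|lborel. norm (sgn (U k y) *\<^sub>R G k y - sgn (u y) *\<^sub>R g y)) \<longlonglongrightarrow> 0"
    and bd: "\<And>k. (LINT y|lborel. \<bar>U k y\<bar>) + (LINT y|lborel. norm (G k y)) \<le> N"
  shows "AE x in lborel. (\<lambda>k. weak_grad (frac_max_real \<beta> (h k)) x) \<longlonglongrightarrow> weak_grad (frac_max_real \<beta> f) x"
proof -
  let ?w = "\<lambda>y. sgn (u y) *\<^sub>R g y" and ?W = "\<lambda>k y. sgn (U k y) *\<^sub>R G k y"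
  have iu: "integrable lborel u" and iU: "integrable lborel (U k)" for k
    using rep U[of k] by (auto simp: radial_representative_def)
  note iw = radial_representative_abs(2)[OF rep] and iW = radial_representative_abs(2)[OF U]
  have lim': "(\<lambda>k. LINT y|lborel. \<bar>\<bar>U k y\<bar> - \<bar>u y\<bar>\<bar>) \<longlonglongrightarrow> 0"
  proof (rule Lim_null_comparison[OF always_eventually[OF allI] lim])
    fix k
    have "(LINT y|lborel. \<bar>\<bar>U k y\<bar> - \<bar>u y\<bar>\<bar>) \<le> (LINT y|lborel. \<bar>U k y - u y\<bar>)"
      using iu iU by (intro integral_mono) auto
    then show "norm (LINT y|lborel. \<bar>\<bar>U k y\<bar> - \<bar>u y\<bar>\<bar>) \<le> (LINT y|lborel. \<bar>U k y - u y\<bar>)"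
      by (simp add: integral_nonneg_AE)
  qed
  have limwe: "(\<lambda>k. LINT y|lborel. \<bar>?W k y \<bullet> e - ?w y \<bullet> e\<bar>) \<longlonglongrightarrow> 0" if e: "e \<in> Basis" for e
  proof (rule Lim_null_comparison[OF always_eventually[OF allI] limw])
    fix k
    have i: "integrable lborel (\<lambda>y. ?W k y - ?w y)" by (intro Bochner_Integration.integrable_diff iw iW)
    have "(LINT y|lborel. \<bar>?W k y \<bullet> e - ?w y \<bullet> e\<bar>) \<le> (LINT y|lborel. norm (?W k y - ?w y))"
      unfolding inner_diff_left[symmetric]
      using e by (intro integral_mono integrable_abs integrable_norm integrable_inner_left i) (auto simp: Basis_le_norm)
    then show "norm (LINT y|lborel. \<bar>?W k y \<bullet> e - ?w y \<bullet> e\<bar>) \<le> (LINT y|lborel. norm (?W k y - ?w y))"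
      by (simp add: integral_nonneg_AE)
  qed
  have "AE x in lborel. \<forall>k. \<forall>r. optimal_radius \<beta> (\<lambda>y. \<bar>U k y\<bar>) x r \<longrightarrow>
      (\<forall>e\<in>Basis. weak_grad (frac_max_real \<beta> (h k)) x \<bullet> e = frac_mean \<beta> (\<lambda>y. ?W k y \<bullet> e) r x)"
    unfolding AE_all_countable using radial_maximal_gradient(3)[OF U \<beta>] by blast
  then show ?thesis
    using radial_maximal_gradient(3)[OF rep \<beta>] AE_lborel_singleton[of 0]
  proof eventually_elim
    case (elim x)
    have nx: "0 < norm x" using elim(3) by simp
    have "\<forall>k. \<exists>r. optimal_radius \<beta> (\<lambda>y. \<bar>U k y\<bar>) x r" using radial_optimal_radius_exists[OF U \<beta> elim(3)] by blast
    from choice[OF this] obtain r where r: "\<And>k. optimal_radius \<beta> (\<lambda>y. \<bar>U k y\<bar>) x (r k)" by blast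
    obtain r0 R k0 where r0: "r0 > 0" and bnd: "\<And>k x' r. k \<ge> k0 \<Longrightarrow> norm x \<le> norm x' \<Longrightarrow> norm x' \<le> norm x \<Longrightarrow>
        optimal_radius \<beta> (\<lambda>y. \<bar>U k y\<bar>) x' r \<Longrightarrow> r0 \<le> r \<and> r \<le> R"
      by (rule radii_bounds[where X="norm x", OF \<beta> iu pos U lim bd nx], rule that) blast+
    have inI: "r k \<in> {r0..R}" if "k \<ge> k0" for k using bnd[OF that order_refl order_refl r] by simp
    have comp: "(\<lambda>k. weak_grad (frac_max_real \<beta> (h k)) x \<bullet> e) \<longlonglongrightarrow> weak_grad (frac_max_real \<beta> f) x \<bullet> e"
      if e: "e \<in> Basis" for e
    proof (rule tendsto_subseq_criterion)
      fix s :: "nat \<Rightarrow> nat" assume s: "strict_mono s"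
      have "\<forall>n. r (s (n + k0)) \<in> {r0..R}"
      proof
        fix n have "k0 \<le> s (n + k0)" using seq_suble[OF s, of "n + k0"] by linarith
        then show "r (s (n + k0)) \<in> {r0..R}" by (rule inI)
      qed
      from compact_Icc[of r0 R, unfolded compact_def, THEN spec, THEN mp, OF this]
      obtain rr t where t: "rr \<in> {r0..R}" "strict_mono t" "((\<lambda>n. r (s (n + k0))) \<circ> t) \<longlonglongrightarrow> rr"
        by blast
      define \<tau> where "\<tau> n = t n + k0" for n
      have \<tau>: "strict_mono \<tau>" using t(2) by (auto simp: \<tau>_def strict_mono_def)
      have s\<tau>: "strict_mono (\<lambda>n. s (\<tau> n))" using strict_mono_o[OF s \<tau>] by (simp add: o_def)
      have rl: "(\<lambda>n. r (s (\<tau> n))) \<longlonglongrightarrow> rr" using t(3) by (simp add: o_def \<tau>_def)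
      have rr: "rr > 0" using t(1) r0 by simp
      have "optimal_radius \<beta> (\<lambda>y. \<bar>u y\<bar>) x rr"
        by (rule optimal_radius_limit[where F'="\<lambda>n y. \<bar>U (s (\<tau> n)) y\<bar>" and x="\<lambda>_. x" and r="\<lambda>n. r (s (\<tau> n))"])
           (use iu iU r rl rr LIMSEQ_subseq_LIMSEQ[OF lim' s\<tau>] in \<open>auto simp: o_def\<close>)
      then have eq: "weak_grad (frac_max_real \<beta> f) x \<bullet> e = frac_mean \<beta> (\<lambda>y. ?w y \<bullet> e) rr x"
        using elim(2) e by blast
      have "(\<lambda>n. frac_mean \<beta> (\<lambda>y. ?W (s (\<tau> n)) y \<bullet> e) (r (s (\<tau> n))) x) \<longlonglongrightarrow> frac_mean \<beta> (\<lambda>y. ?w y \<bullet> e) rr x"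
        using LIMSEQ_subseq_LIMSEQ[OF limwe[OF e] s\<tau>]
        by (intro frac_mean_tendsto_L1[where x="\<lambda>_. x"] integrable_inner_left iw iW rl rr tendsto_const) (simp add: o_def)
      moreover have "weak_grad (frac_max_real \<beta> (h k)) x \<bullet> e = frac_mean \<beta> (\<lambda>y. ?W k y \<bullet> e) (r k) x" for k
        using elim(1) r e by blast
      ultimately have "(\<lambda>n. weak_grad (frac_max_real \<beta> (h (s (\<tau> n)))) x \<bullet> e) \<longlonglongrightarrow> weak_grad (frac_max_real \<beta> f) x \<bullet> e"
        by (simp add: eq)
      then show "\<exists>t. strict_mono t \<and> (\<lambda>n. weak_grad (frac_max_real \<beta> (h (s (t n)))) x \<bullet> e) \<longlonglongrightarrow> weak_grad (frac_max_real \<beta> f) x \<bullet> e"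
        using \<tau> by blast
    qed
    have "(\<lambda>k. \<Sum>e\<in>Basis. (weak_grad (frac_max_real \<beta> (h k)) x \<bullet> e) *\<^sub>R e)
      \<longlonglongrightarrow> (\<Sum>e\<in>Basis. (weak_grad (frac_max_real \<beta> f) x \<bullet> e) *\<^sub>R e)"
      by (intro tendsto_sum tendsto_scaleR comp tendsto_const)
    then show ?case by (simp add: euclidean_representation)
  qed
qed

lemma ennreal_le_suminf: "f j \<le> (\<Sum>j. f j)" for f :: "nat \<Rightarrow> ennreal"
  using sum_le_suminf[of f "{j}"] by simp

text \<open>Dyadic annuli give a geometric series.\<close>

lemma tail_power_integral_finite:
  fixes p A :: real
  assumes A: "A > 0" and p: "real DIM('a::euclidean_space) < p"
  shows "(\<integral>\<^sup>+(x::'a). indicator (- ball 0 A) x * ennreal (norm x powr (- p)) \<partial>lborel) < \<infinity>"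
proof -
  define d where "d = real DIM('a)"
  define \<theta> where "\<theta> = (2::real) powr (d - p)"
  have \<theta>: "0 \<le> \<theta>" "\<theta> < 1"
    using p powr_less_mono[of "d - p" 0 2] by (auto simp: \<theta>_def d_def)
  define K where "K = unit_ball_vol d * (2 * A) powr d * A powr (- p)"
  have "(\<integral>\<^sup>+(x::'a). indicator (- ball 0 A) x * ennreal (norm x powr (- p)) \<partial>lborel)
    \<le> (\<integral>\<^sup>+(x::'a). (\<Sum>j. indicator (ball 0 (A * 2 ^ Suc j)) x * ennreal ((A * 2 ^ j) powr (- p))) \<partial>lborel)"
  proof (intro nn_integral_mono)
    fix x :: 'a
    show "indicator (- ball 0 A) x * ennreal (norm x powr (- p))
      \<le> (\<Sum>j. indicator (ball 0 (A * 2 ^ Suc j)) x * ennreal ((A * 2 ^ j) powr (- p)))"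
    proof (cases "norm x < A")
      case False
      obtain m where "norm x / A < 2 ^ m" using real_arch_pow[of 2 "norm x / A"] by auto
      then have ex: "norm x < A * 2 ^ m" using A by (simp add: field_simps)
      define n where "n = (LEAST n. norm x < A * 2 ^ n)"
      have n: "norm x < A * 2 ^ n" unfolding n_def using ex by (rule LeastI)
      then have "n \<noteq> 0" using False by (cases n) auto
      then obtain j where j: "n = Suc j" by (cases n) auto
      have xj: "A * 2 ^ j \<le> norm x" using not_less_Least[of j "\<lambda>n. norm x < A * 2 ^ n"] j by (simp add: n_def[symmetric])
      have "0 < A * 2 ^ j" using A by simp
      then have "norm x powr (- p) \<le> (A * 2 ^ j) powr (- p)" using xj p by (intro powr_mono2') auto
      then have "indicator (- ball 0 A) x * ennreal (norm x powr (- p))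
         \<le> indicator (ball 0 (A * 2 ^ Suc j)) x * ennreal ((A * 2 ^ j) powr (- p))"
        using n j by (auto simp: indicator_def intro: ennreal_leI)
      also have "\<dots> \<le> (\<Sum>j. indicator (ball 0 (A * 2 ^ Suc j)) x * ennreal ((A * 2 ^ j) powr (- p)))"
        by (rule ennreal_le_suminf)
      finally show ?thesis .
    qed (simp add: indicator_def)
  qed
  also have "\<dots> = (\<Sum>j. \<integral>\<^sup>+(x::'a). indicator (ball 0 (A * 2 ^ Suc j)) x * ennreal ((A * 2 ^ j) powr (- p)) \<partial>lborel)"
    by (rule nn_integral_suminf) measurable
  also have "\<dots> = (\<Sum>j. ennreal (K * \<theta> ^ j))"
  proof (intro suminf_cong)
    fix j :: nat
    have "(\<integral>\<^sup>+(x::'a). indicator (ball 0 (A * 2 ^ Suc j)) x * ennreal ((A * 2 ^ j) powr (- p)) \<partial>lborel)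
      = ennreal (unit_ball_vol d * (A * 2 ^ Suc j) ^ DIM('a)) * ennreal ((A * 2 ^ j) powr (- p))"
      using A by (subst nn_integral_multc) (auto simp: emeasure_ball d_def)
    also have "\<dots> = ennreal (unit_ball_vol d * (A * 2 ^ Suc j) ^ DIM('a) * (A * 2 ^ j) powr (- p))"
      using A by (subst ennreal_mult[symmetric]) (auto simp: d_def)
    also have "unit_ball_vol d * (A * 2 ^ Suc j) ^ DIM('a) * (A * 2 ^ j) powr (- p) = K * \<theta> ^ j"
    proof -
      have 1: "(A * 2 ^ Suc j) ^ DIM('a) = (2 * A) powr d * 2 powr (real j * d)"
      proof -
        have e: "A * 2 ^ Suc j = (2 * A) * 2 powr (real j)" by (simp add: powr_realpow)
        have "(A * 2 ^ Suc j) ^ DIM('a) = (A * 2 ^ Suc j) powr d" using A by (simp add: d_def powr_realpow)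
        also have "\<dots> = ((2 * A) * 2 powr (real j)) powr d" by (simp only: e)
        also have "\<dots> = (2 * A) powr d * 2 powr (real j * d)"
          using A by (simp add: powr_mult powr_powr)
        finally show ?thesis .
      qed
      have 2: "(A * 2 ^ j) powr (- p) = A powr (- p) * 2 powr (real j * (- p))"
        using A by (simp add: powr_mult powr_powr powr_realpow[symmetric])
      have 3: "\<theta> ^ j = 2 powr (real j * d) * 2 powr (real j * (- p))"
        by (simp add: \<theta>_def powr_realpow[symmetric] powr_powr powr_add[symmetric] algebra_simps)
      show ?thesis unfolding 1 2 3 K_def by (simp add: mult_ac)
    qed
    finally show "(\<integral>\<^sup>+(x::'a). indicator (ball 0 (A * 2 ^ Suc j)) x * ennreal ((A * 2 ^ j) powr (- p)) \<partial>lborel) = ennreal (K * \<theta> ^ j)" .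
  qed
  also have "\<dots> < \<infinity>"
    using \<theta> A by (subst suminf_ennreal2) (auto intro!: summable_mult summable_geometric simp: K_def d_def)
  finally show ?thesis .
qed

section \<open>Continuity of the gradient of the maximal function\<close>

lemma ennreal_less_infinity: "ennreal x < \<infinity>"
  by simp

text \<open>Where \<open>a k \<le> b\<close> the difference is dominated by \<open>b\<close>, and elsewhere by \<open>a k\<close>. So dominated
  convergence covers everything except the part of \<open>a k\<close> on the exceptional sets, which is small
  by assumption.\<close>

lemma eventually_Lq_close:
  fixes a :: "nat \<Rightarrow> 'b \<Rightarrow> real" and b \<Phi> :: "'b \<Rightarrow> real"
  assumes [measurable]: "\<And>k. a k \<in> borel_measurable M" "b \<in> borel_measurable M" "\<Phi> \<in> borel_measurable M"
      "\<And>k. S k \<in> sets M"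
    and nonneg: "\<And>k x. 0 \<le> a k x" "\<And>x. 0 \<le> b x" and q: "q > 0"
    and conv: "AE x in M. (\<lambda>k. a k x) \<longlonglongrightarrow> b x"
    and dom: "AE x in M. \<forall>k\<ge>k0. x \<notin> S k \<longrightarrow> a k x powr q \<le> \<Phi> x"
    and \<Phi>: "(\<integral>\<^sup>+x. ennreal (\<Phi> x) \<partial>M) < \<infinity>" and b: "(\<integral>\<^sup>+x. ennreal (b x powr q) \<partial>M) < \<infinity>"
    and small: "\<And>k. k \<ge> k0 \<Longrightarrow> (\<integral>\<^sup>+x. ennreal (a k x powr q) * indicator (S k) x \<partial>M) \<le> ennreal \<tau>"
    and \<tau>: "\<tau> \<ge> 0" and \<eta>: "\<eta> > 0"
  shows "\<forall>\<^sub>F k in sequentially. (\<integral>\<^sup>+x. ennreal (\<bar>a k x - b x\<bar> powr q) \<partial>M) \<le> ennreal (\<tau> + \<eta>)"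
proof -
  define D where "D k x = min (ennreal (\<bar>a k x - b x\<bar> powr q)) (ennreal (\<Phi> x) + ennreal (b x powr q))" for k x
  have [measurable]: "D k \<in> borel_measurable M" for k unfolding D_def by measurable
  have "(\<lambda>k. \<integral>\<^sup>+x. D k x \<partial>M) \<longlonglongrightarrow> (\<integral>\<^sup>+x. 0 \<partial>M)"
  proof (rule nn_integral_dominated_convergence[where w="\<lambda>x. ennreal (\<Phi> x) + ennreal (b x powr q)"])
    show "(\<integral>\<^sup>+x. ennreal (\<Phi> x) + ennreal (b x powr q) \<partial>M) < \<infinity>"
      using \<Phi> b by (subst nn_integral_add) auto
    show "AE x in M. (\<lambda>k. D k x) \<longlonglongrightarrow> 0"
      using conv
    proof eventually_elim
      case (elim x)
      have "(\<lambda>k. \<bar>a k x - b x\<bar>) \<longlonglongrightarrow> \<bar>b x - b x\<bar>" by (intro tendsto_intros elim)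
      then have "(\<lambda>k. \<bar>a k x - b x\<bar> powr q) \<longlonglongrightarrow> \<bar>b x - b x\<bar> powr q"
        using q by (intro tendsto_powr' tendsto_const) auto
      then have "(\<lambda>k. ennreal (\<bar>a k x - b x\<bar> powr q)) \<longlonglongrightarrow> ennreal (\<bar>b x - b x\<bar> powr q)"
        by (rule tendsto_ennrealI)
      then have "(\<lambda>k. ennreal (\<bar>a k x - b x\<bar> powr q)) \<longlonglongrightarrow> 0" by simp
      then show ?case
        by (rule tendsto_sandwich[OF _ _ tendsto_const, rotated 2]) (auto simp: D_def)
    qed
  qed (auto simp: D_def)
  then have "\<forall>\<^sub>F k in sequentially. (\<integral>\<^sup>+x. D k x \<partial>M) < ennreal \<eta>"
    using \<eta> by (intro order_tendstoD) auto
  then show ?thesis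
    using eventually_ge_at_top[of k0]
  proof eventually_elim
    case (elim k)
    have "(\<integral>\<^sup>+x. ennreal (\<bar>a k x - b x\<bar> powr q) \<partial>M)
      \<le> (\<integral>\<^sup>+x. ennreal (a k x powr q) * indicator (S k) x + D k x \<partial>M)"
    proof (rule nn_integral_mono_AE)
      show "AE x in M. ennreal (\<bar>a k x - b x\<bar> powr q) \<le> ennreal (a k x powr q) * indicator (S k) x + D k x"
        using dom
      proof eventually_elim
        case (elim x)
        show ?case
        proof (cases "a k x \<le> b x")
          case True
          then have "\<bar>a k x - b x\<bar> powr q \<le> b x powr q" using nonneg q by (intro powr_mono2) auto
          then have "ennreal (\<bar>a k x - b x\<bar> powr q) \<le> D k x"
            unfolding D_def by (auto intro: ennreal_leI add_increasing)
          then show ?thesis by (rule add_increasing[OF zero_le])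
        next
          case False
          then have le: "\<bar>a k x - b x\<bar> powr q \<le> a k x powr q" using nonneg(1)[of k x] nonneg(2)[of x] q by (intro powr_mono2) auto
          show ?thesis
          proof (cases "x \<in> S k")
            case True
            then show ?thesis using le by (auto intro: ennreal_leI add_increasing2)
          next
            case False
            then have "\<bar>a k x - b x\<bar> powr q \<le> \<Phi> x" using elim \<open>k \<ge> k0\<close> le by force
            then have "ennreal (\<bar>a k x - b x\<bar> powr q) \<le> D k x"
              unfolding D_def by (auto intro: ennreal_leI add_increasing2)
            then show ?thesis by (rule add_increasing[OF zero_le])
          qed
        qed
      qed
    qed
    also have "\<dots> = (\<integral>\<^sup>+x. ennreal (a k x powr q) * indicator (S k) x \<partial>M) + (\<integral>\<^sup>+x. D k x \<partial>M)"
      by (rule nn_integral_add) measurable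
    also have "\<dots> \<le> ennreal \<tau> + ennreal \<eta>" using small[OF elim(2)] elim(1) by (intro add_mono) auto
    also have "\<dots> = ennreal (\<tau> + \<eta>)" using \<tau> \<eta> by simp
    finally show ?case .
  qed
qed

text \<open>The sets to which the two hypotheses of the theorem are applied. They are phrased through centre
  and radius, which makes them Borel.\<close>

definition inner_points :: "real \<Rightarrow> ('a::euclidean_space \<Rightarrow> real) \<Rightarrow> real \<Rightarrow> 'a set" where
  "inner_points \<beta> u \<rho> = {x. \<exists>r. optimal_radius \<beta> (\<lambda>y. \<bar>u y\<bar>) x r \<and> norm x + r \<le> \<rho>}"

definition outer_points :: "real \<Rightarrow> ('a::euclidean_space \<Rightarrow> real) \<Rightarrow> real \<Rightarrow> 'a set" where
  "outer_points \<beta> u R = {x. \<exists>r. optimal_radius \<beta> (\<lambda>y. \<bar>u y\<bar>) x r \<and> r + R \<le> norm x}"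

lemma inner_outer_points_borel:
  fixes u :: "'a::euclidean_space \<Rightarrow> real"
  assumes "integrable lborel u"
  shows "inner_points \<beta> u \<rho> \<in> sets borel" "outer_points \<beta> u R \<in> sets borel"
proof -
  have "{x. \<exists>r. optimal_radius \<beta> (\<lambda>y. \<bar>u y\<bar>) x r \<and> 0 \<le> (- 1) * norm x + (- 1) * r + \<rho>} \<in> sets borel"
    "{x. \<exists>r. optimal_radius \<beta> (\<lambda>y. \<bar>u y\<bar>) x r \<and> 0 \<le> 1 * norm x + (- 1) * r + (- R)} \<in> sets borel"
    by (intro optimal_radius_set_borel integrable_abs assms)+
  then show "inner_points \<beta> u \<rho> \<in> sets borel" "outer_points \<beta> u R \<in> sets borel"
    by (simp_all add: inner_points_def outer_points_def algebra_simps)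
qed

lemma inner_points_ball:
  assumes "integrable lborel u" "AE x in lborel. f x = u x" "x \<in> inner_points \<beta> u \<rho>"
  shows "\<exists>B\<in>max_balls \<beta> f x. B \<subseteq> ball 0 \<rho>"
proof -
  obtain r where r: "optimal_radius \<beta> (\<lambda>y. \<bar>u y\<bar>) x r" "norm x + r \<le> \<rho>" using assms(3) by (auto simp: inner_points_def)
  have "ball x r \<subseteq> ball 0 \<rho>"
  proof
    fix y assume "y \<in> ball x r"
    then show "y \<in> ball 0 \<rho>" using r(2) norm_triangle_ineq2[of y x] by (auto simp: dist_norm norm_minus_commute)
  qed
  then show ?thesis using optimal_radius_max_ball(1)[OF assms(1,2) r(1)] by blast
qed

lemma outer_points_ball:
  assumes "integrable lborel u" "AE x in lborel. f x = u x" "x \<in> outer_points \<beta> u R"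
  shows "\<exists>B\<in>max_balls \<beta> f x. B \<subseteq> - ball 0 R"
proof -
  obtain r where r: "optimal_radius \<beta> (\<lambda>y. \<bar>u y\<bar>) x r" "r + R \<le> norm x" using assms(3) by (auto simp: outer_points_def)
  have "ball x r \<subseteq> - ball 0 R"
  proof
    fix y assume "y \<in> ball x r"
    then show "y \<in> - ball 0 R" using r(2) norm_triangle_ineq2[of x y] by (auto simp: dist_norm)
  qed
  then show ?thesis using optimal_radius_max_ball(1)[OF assms(1,2) r(1)] by blast
qed

text \<open>Rewrites the right-hand sides of the two hypotheses in terms of the representative.\<close>

lemma set_integral_weak_grad:
  assumes rep: "radial_representative f u g" and [measurable]: "S \<in> sets borel"
  shows "(LINT x:S|lebesgue. norm (weak_grad f x)) = (LINT y|lborel. indicator S y * norm (g y))"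
proof -
  have [measurable]: "g \<in> borel_measurable borel" using rep by (auto simp: radial_representative_def wgrad_def locint_def)
  have "(LINT x|lebesgue. indicator S x *\<^sub>R norm (weak_grad f x)) = (LINT y|lborel. indicator S y * norm (g y))"
    by (rule lebesgue_integral_representative) (use radial_representative_grad[OF rep] in auto)
  then show ?thesis by (simp add: set_lebesgue_integral_def)
qed

text \<open>Away from the inner and the outer points the gradients are dominated: on bounded sets the
  optimal radii are bounded below, and at a point far out they are at least half its distance to
  the origin, where the bound with the additional decay is integrable.\<close>

lemma gradient_dominated:
  fixes u :: "real ^ 'n \<Rightarrow> real"
  assumes \<beta>: "0 < \<beta>" "\<beta> < 1" and q: "q = real CARD('n) / (real CARD('n) - \<beta>)"
    and u: "integrable lborel u" and pos: "(LINT y|lborel. \<bar>u y\<bar>) > 0"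
    and U: "\<And>k. radial_representative (h k) (U k) (G k)"
    and lim: "(\<lambda>k. LINT y|lborel. \<bar>U k y - u y\<bar>) \<longlonglongrightarrow> 0"
    and bd: "\<And>k. (LINT y|lborel. \<bar>U k y\<bar>) + (LINT y|lborel. norm (G k y)) \<le> N"
    and \<rho>: "0 < \<rho>" and R: "0 < R"
  obtains \<Phi> k0 where "\<Phi> \<in> borel_measurable borel" "(\<integral>\<^sup>+x. ennreal (\<Phi> x) \<partial>lborel) < \<infinity>"
    "AE x in lborel. \<forall>k\<ge>k0. x \<notin> inner_points \<beta> (U k) \<rho> \<union> outer_points \<beta> (U k) R \<longrightarrow>
       norm (weak_grad (frac_max_real \<beta> (h k)) x) powr q \<le> \<Phi> x"
proof -
  define d where "d = real CARD('n)"
  define \<omega> where "\<omega> = unit_ball_vol d"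
  have \<omega>: "\<omega> > 0" by (simp add: \<omega>_def d_def)
  have d\<beta>: "\<beta> < d" using less_dimension[OF \<beta>(2), where 'a="real ^ 'n"] by (simp add: d_def)
  have d0: "d > 0" using d\<beta> \<beta> by linarith
  have q0: "q > 0" using d\<beta> d0 by (simp add: q d_def)
  have intpos: "0 \<le> (LINT y|lborel. norm (G k y))" "0 \<le> (LINT y|lborel. \<bar>U k y\<bar>)" for k by (simp_all add: integral_nonneg_AE)
  have bdG: "(LINT y|lborel. norm (G k y)) \<le> N" and bdU: "(LINT y|lborel. \<bar>U k y\<bar>) \<le> N" for k
    using bd[of k] intpos[of k] by linarith+
  have N0: "0 \<le> N" using bdG[of 0] intpos(1)[of 0] by linarith
  have \<rho>2: "0 < \<rho> / 2" using \<rho> by simp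
  obtain r0 R' k0 where r0: "r0 > 0" and rb: "\<And>k x r. k \<ge> k0 \<Longrightarrow> \<rho> / 2 \<le> norm x \<Longrightarrow> norm x \<le> 2 * R \<Longrightarrow>
      optimal_radius \<beta> (\<lambda>y. \<bar>U k y\<bar>) x r \<Longrightarrow> r0 \<le> r \<and> r \<le> R'"
    by (rule radii_bounds[where X="2 * R", OF \<beta> u pos U lim bd \<rho>2], rule that) blast+
  define r1 where "r1 = min r0 (\<rho> / 2)"
  have r1: "r1 > 0" using r0 \<rho> by (simp add: r1_def)
  define e where "e = \<beta> - d - 1"
  have e: "e < 0" using d\<beta> by (simp add: e_def)
  define p where "p = - (e * q)"
  \<comment> \<open>The decay is integrable at infinity because \<open>q\<close> is larger than \<open>d / (d + 1 - \<beta>)\<close>.\<close>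
  have p: "d < p"
  proof -
    have "d * (d - \<beta>) < d * (d + 1 - \<beta>)" using d0 by (intro mult_strict_left_mono) auto
    then show ?thesis using d\<beta> by (simp add: p_def e_def q d_def[symmetric] field_simps)
  qed
  define C2 where "C2 = d * (r1 powr (\<beta> - d) / \<omega> * N)"
  define C1 where "C1 = d * (2 * d * ((1/2) powr e / \<omega> * N))"
  have C0: "0 \<le> C1" "0 \<le> C2" using d0 \<omega> N0 by (auto simp: C1_def C2_def)
  define \<Phi> where "\<Phi> x = indicator (ball 0 (2 * R)) x * C2 powr q + indicator (- ball 0 (2 * R)) x * (C1 powr q * norm x powr (- p))"
    for x :: "real ^ 'n"
  show ?thesis
  proof (rule that[of \<Phi> k0])
    show "\<Phi> \<in> borel_measurable borel" unfolding \<Phi>_def by measurable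
    have "(\<integral>\<^sup>+x. ennreal (\<Phi> x) \<partial>lborel)
      = (\<integral>\<^sup>+(x :: real ^ 'n). ennreal (C2 powr q) * indicator (ball 0 (2 * R)) x
          + ennreal (C1 powr q) * (indicator (- ball 0 (2 * R)) x * ennreal (norm x powr (- p))) \<partial>lborel)"
      by (intro nn_integral_cong) (auto simp: \<Phi>_def indicator_def ennreal_mult)
    also have "\<dots> = ennreal (C2 powr q) * emeasure lborel (ball (0 :: real ^ 'n) (2 * R))
        + ennreal (C1 powr q) * (\<integral>\<^sup>+(x :: real ^ 'n). indicator (- ball 0 (2 * R)) x * ennreal (norm x powr (- p)) \<partial>lborel)"
      by (subst nn_integral_add) (auto simp: nn_integral_cmult)
    also have "\<dots> < \<infinity>"
      using tail_power_integral_finite[of "2 * R" p, where 'a="real ^ 'n"] R p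
      by (auto simp: emeasure_ball d_def ennreal_mult_less_top)
    finally show "(\<integral>\<^sup>+x. ennreal (\<Phi> x) \<partial>lborel) < \<infinity>" .
    have "AE x in lborel. \<forall>k. \<forall>r. optimal_radius \<beta> (\<lambda>y. \<bar>U k y\<bar>) x r \<longrightarrow>
      (\<forall>e\<in>Basis. weak_grad (frac_max_real \<beta> (h k)) x \<bullet> e = frac_mean \<beta> (\<lambda>y. (sgn (U k y) *\<^sub>R G k y) \<bullet> e) r x)"
      unfolding AE_all_countable using radial_maximal_gradient(3)[OF U \<beta>] by blast
    then show "AE x in lborel. \<forall>k\<ge>k0. x \<notin> inner_points \<beta> (U k) \<rho> \<union> outer_points \<beta> (U k) R \<longrightarrow>
       norm (weak_grad (frac_max_real \<beta> (h k)) x) powr q \<le> \<Phi> x"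
      using AE_lborel_singleton[of 0]
    proof eventually_elim
      case (elim x)
      show ?case
      proof (intro allI impI)
        fix k assume k: "k \<ge> k0" and x: "x \<notin> inner_points \<beta> (U k) \<rho> \<union> outer_points \<beta> (U k) R"
        define z where "z = weak_grad (frac_max_real \<beta> (h k)) x"
        obtain r where r: "optimal_radius \<beta> (\<lambda>y. \<bar>U k y\<bar>) x r" using radial_optimal_radius_exists[OF U \<beta> elim(2)] by blast
        have z: "\<forall>e\<in>Basis. z \<bullet> e = frac_mean \<beta> (\<lambda>y. (sgn (U k y) *\<^sub>R G k y) \<bullet> e) r x"
          using elim(1) r by (auto simp: z_def)
        note gb = gradient_bounds[OF U \<beta> r z, folded d_def, folded \<omega>_def]
        have rpos: "r > 0" using r by (simp add: optimal_radius_def)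
        have in1: "\<rho> < norm x + r" and out1: "norm x < r + R"
          using x r by (force simp: inner_points_def outer_points_def)+
        show "norm (weak_grad (frac_max_real \<beta> (h k)) x) powr q \<le> \<Phi> x"
        proof (cases "norm x < 2 * R")
          case True
          have "r1 \<le> r"
          proof (cases "r < \<rho> / 2")
            case r: True
            then show ?thesis using rb[OF k _ _ \<open>optimal_radius \<beta> (\<lambda>y. \<bar>U k y\<bar>) x r\<close>] in1 True by (auto simp: r1_def)
          qed (auto simp: r1_def)
          then have "r powr (\<beta> - d) \<le> r1 powr (\<beta> - d)" using r1 d\<beta> by (intro powr_mono2') auto
          then have "d * (r powr (\<beta> - d) / \<omega> * (LINT y|lborel. norm (G k y))) \<le> C2"
            unfolding C2_def using d0 \<omega> bdG intpos by (intro mult_left_mono mult_mono divide_right_mono) auto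
          then have "norm z \<le> C2" using gb(1) by linarith
          then have "norm z powr q \<le> C2 powr q" using q0 by (intro powr_mono2) auto
          then show ?thesis using True by (simp add: \<Phi>_def z_def indicator_def)
        next
          case False
          then have xr: "norm x * (1/2) \<le> r" using out1 by simp
          have x0: "0 < norm x" using elim(2) by simp
          have "r powr e \<le> (norm x * (1/2)) powr e" using xr x0 e by (intro powr_mono2') auto
          also have "\<dots> = norm x powr e * (1/2) powr e" by (rule powr_mult)
          finally have "d * (2 * d * (r powr e / \<omega> * (LINT y|lborel. \<bar>U k y\<bar>)))
              \<le> d * (2 * d * ((norm x powr e * (1/2) powr e) / \<omega> * N))"
            using d0 \<omega> bdU intpos by (intro mult_left_mono mult_mono divide_right_mono) auto
          also have "\<dots> = C1 * norm x powr e" by (simp add: C1_def)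
          finally have "norm z \<le> C1 * norm x powr e" using gb(2) by (simp add: e_def)
          then have "norm z powr q \<le> (C1 * norm x powr e) powr q" using q0 by (intro powr_mono2) auto
          also have "\<dots> = C1 powr q * norm x powr (- p)" using C0 by (simp add: powr_mult powr_powr p_def)
          finally show ?thesis using False by (simp add: \<Phi>_def z_def indicator_def)
        qed
      qed
    qed
  qed
qed

text \<open>The first hypothesis with \<open>\<rho> \<longlonglongrightarrow> \<infinity>\<close>: every point other than the origin has an optimal ball, and
  this ball lies in some ball about the origin.\<close>

lemma gradient_Lq_bound:
  fixes f u :: "real ^ 'n \<Rightarrow> real"
  assumes \<beta>: "0 < \<beta>" "\<beta> < 1" and rep: "radial_representative f u g" and q0: "0 < q"
    and inner: "\<And>\<rho> H. \<lbrakk>\<rho> > 0; H \<in> sets lebesgue; \<forall>x\<in>H. \<exists>B\<in>max_balls \<beta> f x. B \<subseteq> ball 0 \<rho>\<rbrakk>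
      \<Longrightarrow> (\<integral>\<^sup>+x\<in>H. ennreal (norm (weak_grad (frac_max_real \<beta> f) x) powr q) \<partial>lebesgue)
          \<le> ennreal (C * (LINT x:ball 0 (2 * \<rho>)|lebesgue. norm (weak_grad f x)) powr q)"
  shows "(\<integral>\<^sup>+x. ennreal (norm (weak_grad (frac_max_real \<beta> f) x) powr q) \<partial>lebesgue)
    \<le> ennreal (max C 0 * (LINT y|lborel. norm (g y)) powr q)"
proof -
  let ?a = "\<lambda>x. ennreal (norm (weak_grad (frac_max_real \<beta> f) x) powr q)"
  have u: "integrable lborel u" "AE x in lborel. f x = u x" and g: "integrable lborel g"
    using rep by (auto simp: radial_representative_def)
  have [measurable]: "weak_grad (frac_max_real \<beta> f) \<in> borel_measurable lebesgue"
    by (rule radial_maximal_gradient(2)[OF rep \<beta>])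
  define H where "H n = inner_points \<beta> u (real (Suc n))" for n
  have Hs [measurable]: "H n \<in> sets lebesgue" for n
    using inner_outer_points_borel(1)[OF u(1)] by (auto simp: H_def)
  have ne: "AE x in lebesgue. x \<noteq> (0 :: real ^ 'n)" by (intro AE_completion AE_lborel_singleton)
  have "AE x in lebesgue. ?a x \<le> liminf (\<lambda>n. ?a x * indicator (H n) x)"
    using ne
  proof eventually_elim
    case (elim x)
    obtain r where r: "optimal_radius \<beta> (\<lambda>y. \<bar>u y\<bar>) x r" using radial_optimal_radius_exists[OF rep \<beta> elim] by blast
    obtain m where m: "norm x + r \<le> real m" using real_arch_simple by blast
    have "\<forall>\<^sub>F n in sequentially. ?a x * indicator (H n) x = ?a x"
      using eventually_ge_at_top[of m]
    proof eventually_elim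
      case (elim n)
      then have "x \<in> H n" using r m unfolding H_def inner_points_def by force
      then show ?case by simp
    qed
    then have "(\<lambda>n. ?a x * indicator (H n) x) \<longlonglongrightarrow> ?a x" by (rule tendsto_eventually)
    then show ?case by (simp add: lim_imp_Liminf)
  qed
  then have "(\<integral>\<^sup>+x. ?a x \<partial>lebesgue) \<le> (\<integral>\<^sup>+x. liminf (\<lambda>n. ?a x * indicator (H n) x) \<partial>lebesgue)"
    by (rule nn_integral_mono_AE)
  also have "\<dots> \<le> liminf (\<lambda>n. \<integral>\<^sup>+x. ?a x * indicator (H n) x \<partial>lebesgue)"
    by (rule nn_integral_liminf) measurable
  also have "\<dots> \<le> ennreal (max C 0 * (LINT y|lborel. norm (g y)) powr q)"
  proof (rule Liminf_le, simp, intro always_eventually allI)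
    fix n
    have Y: "0 \<le> (LINT y|lborel. indicator (ball 0 (2 * real (Suc n))) y * norm (g y))"
      by (simp add: integral_nonneg_AE)
    have "(\<integral>\<^sup>+x\<in>H n. ?a x \<partial>lebesgue) \<le> ennreal (C * (LINT x:ball 0 (2 * real (Suc n))|lebesgue. norm (weak_grad f x)) powr q)"
      using inner_points_ball[OF u] by (intro inner Hs) (auto simp: H_def)
    also have "\<dots> \<le> ennreal (max C 0 * (LINT y|lborel. norm (g y)) powr q)"
      unfolding set_integral_weak_grad[OF rep ball_in_borel]
    proof (intro ennreal_leI mult_mono powr_mono2)
      show "(LINT y|lborel. indicator (ball 0 (2 * real (Suc n))) y * norm (g y)) \<le> (LINT y|lborel. norm (g y))"
        by (intro integral_mono ball_mult_integrable integrable_norm g) (auto simp: indicator_def)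
    qed (use q0 Y in auto)
    finally show "(\<integral>\<^sup>+x. ?a x * indicator (H n) x \<partial>lebesgue) \<le> ennreal (max C 0 * (LINT y|lborel. norm (g y)) powr q)" .
  qed
  finally show ?thesis .
qed

lemma W11_norm_diff:
  assumes "radial_representative f u g" "radial_representative h U G"
  shows "W11_norm (\<lambda>x. h x - f x) = (LINT y|lborel. \<bar>U y - u y\<bar>) + (LINT y|lborel. norm (G y - g y))"
proof -
  have w: "wgrad u g" "wgrad U G" and ae: "AE x in lborel. f x = u x" "AE x in lborel. h x = U x"
    using assms by (auto simp: radial_representative_def)
  have [measurable]: "u \<in> borel_measurable borel" "U \<in> borel_measurable borel"
    "g \<in> borel_measurable borel" "G \<in> borel_measurable borel"
    using w by (auto simp: wgrad_def locint_def)
  have d: "AE x in lborel. h x - f x = U x - u x" using ae by eventually_elim simp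
  have dg: "AE x in lborel. weak_grad (\<lambda>x. h x - f x) x = G x - g x"
    by (rule weak_grad_AE[OF wgrad_diff[OF w(2,1)] d])
  have "(LINT x|lebesgue. \<bar>h x - f x\<bar>) = (LINT y|lborel. \<bar>U y - u y\<bar>)"
    by (rule lebesgue_integral_representative) (use d in auto)
  moreover have "(LINT x|lebesgue. norm (weak_grad (\<lambda>x. h x - f x) x)) = (LINT y|lborel. norm (G y - g y))"
    by (rule lebesgue_integral_representative) (use dg in auto)
  ultimately show ?thesis by (simp add: W11_norm_def)
qed

text \<open>The geometric rate provides almost everywhere convergence of the functions, which the gradients
  of the absolute values need. Splitting into inner, outer and remaining points leaves an error of
  \<open>\<epsilon> / 3\<close> for each. If \<open>f = 0\<close>, the bound for the whole space applies directly.\<close>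

lemma gradient_Lq_convergence:
  fixes f :: "real ^ 'n \<Rightarrow> real" and h :: "nat \<Rightarrow> real ^ 'n \<Rightarrow> real" and \<beta> q C \<epsilon> :: real
  assumes \<beta>: "0 < \<beta>" "\<beta> < 1" and q: "q = real CARD('n) / (real CARD('n) - \<beta>)"
    and inner: "\<And>(f :: real ^ 'n \<Rightarrow> real) \<rho> H.
      \<lbrakk>f \<in> W11_rad; \<rho> > 0; H \<in> sets lebesgue; \<forall>x\<in>H. \<exists>B\<in>max_balls \<beta> f x. B \<subseteq> ball 0 \<rho>\<rbrakk>
      \<Longrightarrow> (\<integral>\<^sup>+x\<in>H. ennreal (norm (weak_grad (frac_max_real \<beta> f) x) powr q) \<partial>lebesgue)
          \<le> ennreal (C * (LINT x:ball 0 (2 * \<rho>)|lebesgue. norm (weak_grad f x)) powr q)"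
    and outer: "\<And>(f :: real ^ 'n \<Rightarrow> real) \<rho> G.
      \<lbrakk>f \<in> W11_rad; \<rho> > 0; G \<in> sets lebesgue; \<forall>x\<in>G. \<exists>B\<in>max_balls \<beta> f x. B \<subseteq> - ball 0 \<rho>\<rbrakk>
      \<Longrightarrow> (\<integral>\<^sup>+x\<in>G. ennreal (norm (weak_grad (frac_max_real \<beta> f) x) powr q) \<partial>lebesgue)
          \<le> ennreal (C * (LINT x:- ball 0 (\<rho> / 2)|lebesgue. norm (weak_grad f x)) powr q)"
    and f: "f \<in> W11_rad" and h: "\<And>k. h k \<in> W11_rad"
    and close: "\<And>k. W11_norm (\<lambda>x. h k x - f x) < (1/2) ^ k" and \<epsilon>: "\<epsilon> > 0"
  shows "\<exists>k. (\<integral>\<^sup>+x. ennreal (\<bar>norm (weak_grad (frac_max_real \<beta> (h k)) x) - norm (weak_grad (frac_max_real \<beta> f) x)\<bar> powr q) \<partial>lebesgue) \<le> ennreal \<epsilon>"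
proof -
  obtain u g where rep: "radial_representative f u g" using radial_representative_exists[OF f] by metis
  have "\<forall>k. \<exists>p. radial_representative (h k) (fst p) (snd p)"
  proof
    fix k obtain U G where "radial_representative (h k) U G" using radial_representative_exists[OF h[of k]] by metis
    then show "\<exists>p. radial_representative (h k) (fst p) (snd p)" by (intro exI[of _ "(U, G)"]) simp
  qed
  from choice[OF this] obtain P where P: "\<And>k. radial_representative (h k) (fst (P k)) (snd (P k))" by blast
  define U where "U k = fst (P k)" for k
  define G where "G k = snd (P k)" for k
  have U: "radial_representative (h k) (U k) (G k)" for k using P by (simp add: U_def G_def)
  have u: "integrable lborel u" "AE x in lborel. f x = u x" and g: "integrable lborel g" and w: "wgrad u g"
    using rep by (auto simp: radial_representative_def)
  have iU: "integrable lborel (U k)" "AE x in lborel. h k x = U k x" and iG: "integrable lborel (G k)" for k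
    using U[of k] by (auto simp: radial_representative_def)
  have d\<beta>: "\<beta> < real CARD('n)" using less_dimension[OF \<beta>(2), where 'a="real ^ 'n"] by simp
  have q0: "0 < q" using d\<beta> \<beta> by (simp add: q)
  have sum: "(LINT y|lborel. \<bar>U k y - u y\<bar>) + (LINT y|lborel. norm (G k y - g y)) < (1/2) ^ k" for k
    using close[of k] W11_norm_diff[OF rep U[of k]] by simp
  have nn: "0 \<le> (LINT y|lborel. \<bar>U k y - u y\<bar>)" "0 \<le> (LINT y|lborel. norm (G k y - g y))" for k
    by (simp_all add: integral_nonneg_AE)
  have leU: "(LINT y|lborel. \<bar>U k y - u y\<bar>) \<le> (1/2) ^ k" and leG: "(LINT y|lborel. norm (G k y - g y)) \<le> (1/2) ^ k" for k
    using sum[of k] nn[of k] by linarith+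
  have pow0: "(\<lambda>k. (1/2 :: real) ^ k) \<longlonglongrightarrow> 0" by (rule LIMSEQ_power_zero) simp
  have limU: "(\<lambda>k. LINT y|lborel. \<bar>U k y - u y\<bar>) \<longlonglongrightarrow> 0"
    by (rule Lim_null_comparison[OF always_eventually[OF allI] pow0]) (use leU nn in simp)
  have limG: "(\<lambda>k. LINT y|lborel. norm (G k y - g y)) \<longlonglongrightarrow> 0"
    by (rule Lim_null_comparison[OF always_eventually[OF allI] pow0]) (use leG nn in simp)
  have region: "(LINT y|lborel. indicator S y * norm (G k y)) \<le> (LINT y|lborel. indicator S y * norm (g y)) + (1/2) ^ k"
    if S: "S \<in> sets borel" for S k
  proof -
    have i: "integrable lborel (\<lambda>y. indicator S y * norm (g y))" "integrable lborel (\<lambda>y. norm (G k y - g y))"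
      by (rule ball_mult_integrable[OF integrable_norm[OF g] S])
        (intro integrable_norm Bochner_Integration.integrable_diff iG g)
    have "(LINT y|lborel. indicator S y * norm (G k y)) \<le> (LINT y|lborel. indicator S y * norm (g y) + norm (G k y - g y))"
    proof (intro integral_mono ball_mult_integrable integrable_norm iG S Bochner_Integration.integrable_add i)
      fix y show "indicator S y * norm (G k y) \<le> indicator S y * norm (g y) + norm (G k y - g y)"
        using norm_triangle_sub[of "G k y" "g y"] by (auto simp: indicator_def)
    qed (use g iG[of k] in auto)
    also have "\<dots> = (LINT y|lborel. indicator S y * norm (g y)) + (LINT y|lborel. norm (G k y - g y))"
      by (rule Bochner_Integration.integral_add[OF i])
    finally show ?thesis using leG[of k] by linarith
  qed
  define N where "N = (LINT y|lborel. \<bar>u y\<bar>) + (LINT y|lborel. norm (g y)) + 1"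
  have bd: "(LINT y|lborel. \<bar>U k y\<bar>) + (LINT y|lborel. norm (G k y)) \<le> N" for k
  proof -
    have "(LINT y|lborel. \<bar>U k y\<bar>) \<le> (LINT y|lborel. \<bar>u y\<bar> + \<bar>U k y - u y\<bar>)"
      using u iU[of k] by (intro integral_mono) auto
    also have "\<dots> = (LINT y|lborel. \<bar>u y\<bar>) + (LINT y|lborel. \<bar>U k y - u y\<bar>)" using u iU[of k] by simp
    finally have 1: "(LINT y|lborel. \<bar>U k y\<bar>) \<le> (LINT y|lborel. \<bar>u y\<bar>) + (LINT y|lborel. \<bar>U k y - u y\<bar>)" .
    have "(LINT y|lborel. norm (G k y)) \<le> (LINT y|lborel. norm (g y) + norm (G k y - g y))"
      using g iG[of k] by (intro integral_mono) (auto intro: norm_triangle_sub)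
    also have "\<dots> = (LINT y|lborel. norm (g y)) + (LINT y|lborel. norm (G k y - g y))" using g iG[of k] by simp
    finally have 2: "(LINT y|lborel. norm (G k y)) \<le> (LINT y|lborel. norm (g y)) + (LINT y|lborel. norm (G k y - g y))" .
    have "(1/2 :: real) ^ k \<le> 1" by (simp add: power_le_one)
    then show ?thesis using 1 2 sum[of k] by (simp add: N_def)
  qed
  define C' where "C' = max C 0"
  have C': "0 \<le> C'" "C \<le> C'" by (auto simp: C'_def)
  have \<epsilon>3: "0 < \<epsilon> / 3" using \<epsilon> by simp
  obtain \<eta>0 where \<eta>0: "\<eta>0 > 0" "\<And>r. 0 < r \<Longrightarrow> r \<le> \<eta>0 \<Longrightarrow> C' * r powr q < \<epsilon> / 3"
    using small_radius[OF q0 \<epsilon>3 C'(1)] by metis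
  have bound: "ennreal (C * Y powr q) \<le> ennreal (\<epsilon> / 3)" if Y: "0 \<le> Y" "Y \<le> \<eta>0" for Y
  proof (rule ennreal_leI)
    have "C * Y powr q \<le> C' * \<eta>0 powr q" using Y q0 C' by (intro mult_mono powr_mono2) auto
    then show "C * Y powr q \<le> \<epsilon> / 3" using \<eta>0(2)[of \<eta>0] \<eta>0(1) by linarith
  qed
  \<comment> \<open>Half for the gradient of \<open>f\<close> on a region and half for its distance to the gradient of \<open>h k\<close>.\<close>
  define \<eta> where "\<eta> = \<eta>0 / 2"
  have \<eta>: "\<eta> > 0" using \<eta>0 by (simp add: \<eta>_def)
  have "\<forall>\<^sub>F k in sequentially. (1/2 :: real) ^ k < \<eta>" using pow0 \<eta> by (intro order_tendstoD) auto
  then obtain k1 where k1: "\<And>k. k \<ge> k1 \<Longrightarrow> (1/2 :: real) ^ k < \<eta>" by (auto simp: eventually_sequentially)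
  let ?a = "\<lambda>k x. norm (weak_grad (frac_max_real \<beta> (h k)) x)"
  let ?b = "\<lambda>x. norm (weak_grad (frac_max_real \<beta> f) x)"
  have am [measurable]: "(\<lambda>x. ?a k x) \<in> borel_measurable lebesgue" for k
    using radial_maximal_gradient(2)[OF U \<beta>] by (intro measurable_compose[OF _ borel_measurable_norm]) auto
  have bm [measurable]: "(\<lambda>x. ?b x) \<in> borel_measurable lebesgue"
    using radial_maximal_gradient(2)[OF rep \<beta>] by (intro measurable_compose[OF _ borel_measurable_norm]) auto
  have bq: "(\<integral>\<^sup>+x. ennreal (?b x powr q) \<partial>lebesgue) \<le> ennreal (C' * (LINT y|lborel. norm (g y)) powr q)"
    unfolding C'_def by (rule gradient_Lq_bound[OF \<beta> rep q0 inner[OF f]])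
  show ?thesis
  proof (cases "(LINT y|lborel. \<bar>u y\<bar>) > 0")
    case pos: True
    have "(\<lambda>n. LINT y|lborel. indicator (ball 0 (2 * (1 / real (Suc n)))) y * norm (g y))
      \<longlonglongrightarrow> (LINT y|lborel. indicator (ball 0 0) y * norm (g y))"
    proof (rule ball_integral_tendsto[OF integrable_norm[OF g] _ tendsto_const])
      have "(\<lambda>n. 2 * (1 / real (Suc n))) \<longlonglongrightarrow> 2 * 0"
        using LIMSEQ_Suc[OF lim_1_over_n[where 'a=real]] by (intro tendsto_mult tendsto_const) simp
      then show "(\<lambda>n. 2 * (1 / real (Suc n))) \<longlonglongrightarrow> 0" by simp
    qed
    then have "\<forall>\<^sub>F n in sequentially. (LINT y|lborel. indicator (ball 0 (2 * (1 / real (Suc n)))) y * norm (g y)) < \<eta>"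
      using \<eta> by (intro order_tendstoD) auto
    then have "\<exists>n. (LINT y|lborel. indicator (ball 0 (2 * (1 / real (Suc n)))) y * norm (g y)) < \<eta>"
      by (rule eventually_happens'[OF sequentially_bot])
    then obtain n where "(LINT y|lborel. indicator (ball 0 (2 * (1 / real (Suc n)))) y * norm (g y)) < \<eta>" ..
    then obtain \<rho> where \<rho>: "0 < \<rho>" "(LINT y|lborel. indicator (ball 0 (2 * \<rho>)) y * norm (g y)) < \<eta>"
      by (metis of_nat_0_less_iff zero_less_Suc zero_less_divide_1_iff)
    have "\<forall>\<^sub>F n in sequentially. (LINT y|lborel. norm (g y)) - \<eta> < (LINT y|lborel. indicator (ball 0 (real n)) y * norm (g y))"
      using ball_exhaustion_tendsto[OF integrable_norm[OF g]] \<eta> by (intro order_tendstoD) auto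
    then have "\<forall>\<^sub>F n in sequentially. n \<ge> 1 \<and> (LINT y|lborel. norm (g y)) - \<eta> < (LINT y|lborel. indicator (ball 0 (real n)) y * norm (g y))"
      using eventually_ge_at_top[of 1] by eventually_elim auto
    then have "\<exists>n. n \<ge> 1 \<and> (LINT y|lborel. norm (g y)) - \<eta> < (LINT y|lborel. indicator (ball 0 (real n)) y * norm (g y))"
      by (rule eventually_happens'[OF sequentially_bot])
    then obtain n2 :: nat where n2: "n2 \<ge> 1"
      "(LINT y|lborel. norm (g y)) - \<eta> < (LINT y|lborel. indicator (ball 0 (real n2)) y * norm (g y))" by blast
    define R where "R = 2 * real n2"
    have R: "R > 0" "R / 2 = real n2" using n2 by (auto simp: R_def)
    have Rg: "(LINT y|lborel. indicator (- ball 0 (R / 2)) y * norm (g y)) < \<eta>"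
    proof -
      have "(LINT y|lborel. indicator (- ball 0 (R / 2)) y * norm (g y))
          = (LINT y|lborel. norm (g y) - indicator (ball 0 (real n2)) y * norm (g y))"
        by (intro Bochner_Integration.integral_cong) (auto simp: indicator_def R)
      also have "\<dots> = (LINT y|lborel. norm (g y)) - (LINT y|lborel. indicator (ball 0 (real n2)) y * norm (g y))"
        by (intro Bochner_Integration.integral_diff integrable_norm g ball_mult_integrable) auto
      finally show ?thesis using n2 by simp
    qed
    obtain \<Phi> k0 where \<Phi>: "\<Phi> \<in> borel_measurable borel" "(\<integral>\<^sup>+x. ennreal (\<Phi> x) \<partial>lborel) < \<infinity>"
      and dom: "AE x in lborel. \<forall>k\<ge>k0. x \<notin> inner_points \<beta> (U k) \<rho> \<union> outer_points \<beta> (U k) R \<longrightarrow> ?a k x powr q \<le> \<Phi> x"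
      by (rule gradient_dominated[OF \<beta> q u(1) pos U limU bd \<rho>(1) R(1)])
    define S where "S k = inner_points \<beta> (U k) \<rho> \<union> outer_points \<beta> (U k) R" for k
    have Sb: "inner_points \<beta> (U k) \<rho> \<in> sets lebesgue" "outer_points \<beta> (U k) R \<in> sets lebesgue" for k
      using inner_outer_points_borel[OF iU(1)] by auto
    note [measurable] = Sb
    have small: "(\<integral>\<^sup>+x. ennreal (?a k x powr q) * indicator (S k) x \<partial>lebesgue) \<le> ennreal (2 * \<epsilon> / 3)"
      if k: "k \<ge> max k0 k1" for k
    proof -
      have kk: "(1/2 :: real) ^ k < \<eta>" using k1 k by simp
      have "(\<integral>\<^sup>+x. ennreal (?a k x powr q) * indicator (S k) x \<partial>lebesgue)
        \<le> (\<integral>\<^sup>+x. ennreal (?a k x powr q) * indicator (inner_points \<beta> (U k) \<rho>) x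
             + ennreal (?a k x powr q) * indicator (outer_points \<beta> (U k) R) x \<partial>lebesgue)"
        by (intro nn_integral_mono) (auto simp: S_def indicator_def)
      also have "\<dots> = (\<integral>\<^sup>+x\<in>inner_points \<beta> (U k) \<rho>. ennreal (?a k x powr q) \<partial>lebesgue)
          + (\<integral>\<^sup>+x\<in>outer_points \<beta> (U k) R. ennreal (?a k x powr q) \<partial>lebesgue)"
        by (rule nn_integral_add) measurable
      also have "\<dots> \<le> ennreal (\<epsilon> / 3) + ennreal (\<epsilon> / 3)"
      proof (rule add_mono)
        have "(\<integral>\<^sup>+x\<in>inner_points \<beta> (U k) \<rho>. ennreal (?a k x powr q) \<partial>lebesgue)
           \<le> ennreal (C * (LINT x:ball 0 (2 * \<rho>)|lebesgue. norm (weak_grad (h k) x)) powr q)"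
          using inner_points_ball[OF iU] by (intro inner h \<rho> Sb) blast
        also have "\<dots> \<le> ennreal (\<epsilon> / 3)"
          unfolding set_integral_weak_grad[OF U ball_in_borel]
          using region[OF ball_in_borel, of 0 "2 * \<rho>" k] \<rho>(2) kk by (intro bound) (auto simp: \<eta>_def integral_nonneg_AE)
        finally show "(\<integral>\<^sup>+x\<in>inner_points \<beta> (U k) \<rho>. ennreal (?a k x powr q) \<partial>lebesgue) \<le> ennreal (\<epsilon> / 3)" .
        have cb: "- ball (0 :: real ^ 'n) (R / 2) \<in> sets borel" by simp
        have "(\<integral>\<^sup>+x\<in>outer_points \<beta> (U k) R. ennreal (?a k x powr q) \<partial>lebesgue)
           \<le> ennreal (C * (LINT x:- ball 0 (R / 2)|lebesgue. norm (weak_grad (h k) x)) powr q)"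
          using outer_points_ball[OF iU] by (intro outer h R Sb) blast
        also have "\<dots> \<le> ennreal (\<epsilon> / 3)"
          unfolding set_integral_weak_grad[OF U cb]
          using region[OF cb, of k] Rg kk by (intro bound) (auto simp: \<eta>_def integral_nonneg_AE)
        finally show "(\<integral>\<^sup>+x\<in>outer_points \<beta> (U k) R. ennreal (?a k x powr q) \<partial>lebesgue) \<le> ennreal (\<epsilon> / 3)" .
      qed
      also have "\<dots> = ennreal (2 * \<epsilon> / 3)" using \<epsilon> by (simp add: ennreal_plus[symmetric] del: ennreal_plus)
      finally show ?thesis .
    qed
    have "\<forall>\<^sub>F k in sequentially. (\<integral>\<^sup>+x. ennreal (\<bar>?a k x - ?b x\<bar> powr q) \<partial>lebesgue) \<le> ennreal (2 * \<epsilon> / 3 + \<epsilon> / 3)"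
    proof (rule eventually_Lq_close[where ?k0.0="max k0 k1" and S=S and \<Phi>=\<Phi>])
      show "\<Phi> \<in> borel_measurable lebesgue" using \<Phi>(1) by (intro measurable_completion) simp
      show "S k \<in> sets lebesgue" for k unfolding S_def by (intro sets.Un Sb)
      show "AE x in lebesgue. (\<lambda>k. ?a k x) \<longlonglongrightarrow> ?b x"
        using gradient_tendsto[OF \<beta> rep pos U limU sgn_gradient_tendsto[OF rep U leU limG] bd]
        by (intro AE_completion) (auto intro: tendsto_norm elim!: eventually_mono)
      show "AE x in lebesgue. \<forall>k\<ge>max k0 k1. x \<notin> S k \<longrightarrow> ?a k x powr q \<le> \<Phi> x"
        using dom by (intro AE_completion) (auto simp: S_def elim!: eventually_mono)
      show "(\<integral>\<^sup>+x. ennreal (\<Phi> x) \<partial>lebesgue) < \<infinity>" using \<Phi>(2) by (simp only: nn_integral_completion)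
      show "(\<integral>\<^sup>+x. ennreal (?b x powr q) \<partial>lebesgue) < \<infinity>" using bq by (rule le_less_trans[OF _ ennreal_less_infinity])
    qed (use small \<epsilon> q0 in auto)
    then have "\<exists>k. (\<integral>\<^sup>+x. ennreal (\<bar>?a k x - ?b x\<bar> powr q) \<partial>lebesgue) \<le> ennreal (2 * \<epsilon> / 3 + \<epsilon> / 3)"
      by (rule eventually_happens'[OF sequentially_bot])
    then show ?thesis by simp
  next
    case False
    then have "(LINT y|lborel. \<bar>u y\<bar>) = 0" by (simp add: integral_nonneg_AE order_antisym not_less)
    then have "AE y in lborel. u y = 0" using u by (subst (asm) integral_nonneg_eq_0_iff_AE) auto
    then have "AE y in lborel. g y = 0" using wgrad_zero_on_zero_set[OF w u(1) g] by eventually_elim simp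
    then have g0: "(LINT y|lborel. norm (g y)) = 0" using g by (subst integral_nonneg_eq_0_iff_AE) auto
    then have "(\<integral>\<^sup>+x. ennreal (?b x powr q) \<partial>lebesgue) = 0" using bq q0 by simp
    then have "AE x in lebesgue. ennreal (?b x powr q) = 0" by (subst (asm) nn_integral_0_iff_AE) auto
    then have b0: "AE x in lebesgue. ?b x = 0" by eventually_elim (simp add: ennreal_eq_0_iff)
    let ?k = k1
    have "(\<integral>\<^sup>+x. ennreal (\<bar>?a ?k x - ?b x\<bar> powr q) \<partial>lebesgue) = (\<integral>\<^sup>+x. ennreal (?a ?k x powr q) \<partial>lebesgue)"
      using b0 by (intro nn_integral_cong_AE) (auto elim!: eventually_mono)
    also have "\<dots> \<le> ennreal (C' * (LINT y|lborel. norm (G ?k y)) powr q)"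
      unfolding C'_def by (rule gradient_Lq_bound[OF \<beta> U q0 inner[OF h]])
    also have "\<dots> \<le> ennreal \<epsilon>"
    proof (rule ennreal_leI)
      have "(LINT y|lborel. norm (G ?k y)) \<le> \<eta>0"
        using region[of UNIV ?k] g0 k1[of ?k] \<eta> by (simp add: \<eta>_def)
      then have "C' * (LINT y|lborel. norm (G ?k y)) powr q \<le> C' * \<eta>0 powr q"
        using C' q0 by (intro mult_left_mono powr_mono2) (auto simp: integral_nonneg_AE)
      then show "C' * (LINT y|lborel. norm (G ?k y)) powr q \<le> \<epsilon>" using \<eta>0(2)[of \<eta>0] \<eta>0(1) \<epsilon> by linarith
    qed
    finally show ?thesis by blast
  qed
qed

theorem theorem25:
  fixes \<beta> q C :: real
  assumes "0 < \<beta>" and "\<beta> < 1"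
    and "q = real CARD('n::finite) / (real CARD('n) - \<beta>)"
    and inner: "\<And>(f :: real ^ 'n \<Rightarrow> real) \<rho> H.
      \<lbrakk>f \<in> W11_rad; \<rho> > 0; H \<in> sets lebesgue;
       \<forall>x\<in>H. \<exists>B\<in>max_balls \<beta> f x. B \<subseteq> ball 0 \<rho>\<rbrakk>
      \<Longrightarrow> (\<integral>\<^sup>+x\<in>H. ennreal (norm (weak_grad (frac_max_real \<beta> f) x) powr q) \<partial>lebesgue)
          \<le> ennreal (C * (LINT x:ball 0 (2 * \<rho>)|lebesgue. norm (weak_grad f x)) powr q)"
    and outer: "\<And>(f :: real ^ 'n \<Rightarrow> real) \<rho> G.
      \<lbrakk>f \<in> W11_rad; \<rho> > 0; G \<in> sets lebesgue;
       \<forall>x\<in>G. \<exists>B\<in>max_balls \<beta> f x. B \<subseteq> - ball 0 \<rho>\<rbrakk>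
      \<Longrightarrow> (\<integral>\<^sup>+x\<in>G. ennreal (norm (weak_grad (frac_max_real \<beta> f) x) powr q) \<partial>lebesgue)
          \<le> ennreal (C * (LINT x:- ball 0 (\<rho> / 2)|lebesgue. norm (weak_grad f x)) powr q)"
  shows "(\<forall>f \<in> (W11_rad :: (real ^ 'n \<Rightarrow> real) set).
            weakly_differentiable (frac_max_real \<beta> f) \<and>
            (\<lambda>x. norm (weak_grad (frac_max_real \<beta> f) x)) \<in> Lp_space q) \<and>
         (\<forall>f \<in> (W11_rad :: (real ^ 'n \<Rightarrow> real) set). \<forall>\<epsilon>>0. \<exists>\<delta>>0. \<forall>g\<in>W11_rad.
            W11_norm (\<lambda>x. g x - f x) < \<delta> \<longrightarrow>
            Lp_norm q (\<lambda>x. norm (weak_grad (frac_max_real \<beta> g) x)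
                          - norm (weak_grad (frac_max_real \<beta> f) x)) < \<epsilon>)"
proof -
  have "\<beta> < real CARD('n)" using less_dimension[OF assms(2), where 'a="real ^ 'n"] by simp
  then have q0: "0 < q" using assms(1) by (simp add: assms(3))
  have meas: "(\<lambda>x. norm (weak_grad (frac_max_real \<beta> f) x)) \<in> borel_measurable lebesgue"
    if f: "f \<in> W11_rad" for f :: "real ^ 'n \<Rightarrow> real"
  proof -
    obtain u g where rep: "radial_representative f u g" using radial_representative_exists[OF f] by metis
    show ?thesis
      by (rule measurable_compose[OF radial_maximal_gradient(2)[OF rep assms(1,2)] borel_measurable_norm])
  qed
  show ?thesis
  proof (intro conjI ballI allI impI)
    fix f :: "real ^ 'n \<Rightarrow> real" assume f: "f \<in> W11_rad"
    obtain u g where rep: "radial_representative f u g" using radial_representative_exists[OF f] by metis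
    show "weakly_differentiable (frac_max_real \<beta> f)" by (rule radial_maximal_gradient(1)[OF rep assms(1,2)])
    have m: "(\<lambda>x. norm (weak_grad (frac_max_real \<beta> f) x) powr q) \<in> borel_measurable lebesgue"
      using meas[OF f] by measurable
    have "(\<integral>\<^sup>+x. ennreal (norm (weak_grad (frac_max_real \<beta> f) x) powr q) \<partial>lebesgue) < \<infinity>"
      using gradient_Lq_bound[OF assms(1,2) rep q0 inner[OF f]] by (rule le_less_trans[OF _ ennreal_less_infinity])
    then have "integrable lebesgue (\<lambda>x. norm (weak_grad (frac_max_real \<beta> f) x) powr q)"
      by (intro integrableI_nonneg m) auto
    then show "(\<lambda>x. norm (weak_grad (frac_max_real \<beta> f) x)) \<in> Lp_space q"
      using meas[OF f] by (simp add: Lp_space_def)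
  next
    fix f :: "real ^ 'n \<Rightarrow> real" and \<epsilon> :: real assume f: "f \<in> W11_rad" and \<epsilon>: "0 < \<epsilon>"
    let ?d = "\<lambda>g x. norm (weak_grad (frac_max_real \<beta> g) x) - norm (weak_grad (frac_max_real \<beta> f) x)"
    show "\<exists>\<delta>>0. \<forall>g\<in>W11_rad. W11_norm (\<lambda>x. g x - f x) < \<delta> \<longrightarrow> Lp_norm q (?d g) < \<epsilon>"
    proof (rule ccontr)
      assume neg: "\<not> (\<exists>\<delta>>0. \<forall>g\<in>W11_rad. W11_norm (\<lambda>x. g x - f x) < \<delta> \<longrightarrow> Lp_norm q (?d g) < \<epsilon>)"
      have "\<forall>k::nat. \<exists>g. g \<in> W11_rad \<and> W11_norm (\<lambda>x. g x - f x) < (1/2) ^ k \<and> \<epsilon> \<le> Lp_norm q (?d g)"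
      proof
        fix k :: nat
        have "(0::real) < (1/2) ^ k" by simp
        then show "\<exists>g. g \<in> W11_rad \<and> W11_norm (\<lambda>x. g x - f x) < (1/2) ^ k \<and> \<epsilon> \<le> Lp_norm q (?d g)"
          using neg not_less by blast
      qed
      from choice[OF this] obtain h :: "nat \<Rightarrow> real ^ 'n \<Rightarrow> real" where
        h: "\<And>k. h k \<in> W11_rad" "\<And>k. W11_norm (\<lambda>x. h k x - f x) < (1/2) ^ k" "\<And>k. \<epsilon> \<le> Lp_norm q (?d (h k))"
        by blast
      \<comment> \<open>So that the norm is at most \<open>\<epsilon> / 2\<close>.\<close>
      define \<tau> where "\<tau> = (\<epsilon> / 2) powr q"
      have \<tau>: "\<tau> > 0" using \<epsilon> by (simp add: \<tau>_def)
      obtain k where k: "(\<integral>\<^sup>+x. ennreal (\<bar>?d (h k) x\<bar> powr q) \<partial>lebesgue) \<le> ennreal \<tau>"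
        using gradient_Lq_convergence[OF assms(1-3) inner outer f h(1,2) \<tau>] by blast
      have m: "(\<lambda>x. \<bar>?d (h k) x\<bar> powr q) \<in> borel_measurable lebesgue"
        using meas[OF f] meas[OF h(1)[of k]] by measurable
      have "(LINT x|lebesgue. \<bar>?d (h k) x\<bar> powr q) = enn2real (\<integral>\<^sup>+x. ennreal (\<bar>?d (h k) x\<bar> powr q) \<partial>lebesgue)"
        by (rule integral_eq_nn_integral[OF m]) simp
      also have "\<dots> \<le> \<tau>" using enn2real_mono[OF k] \<tau> by simp
      finally have "Lp_norm q (?d (h k)) \<le> \<tau> powr (1 / q)"
        unfolding Lp_norm_def using q0 by (intro powr_mono2) (auto simp: integral_nonneg_AE)
      also have "\<dots> = \<epsilon> / 2" using q0 \<epsilon> by (simp add: \<tau>_def powr_powr)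
      finally show False using h(3)[of k] \<epsilon> by simp
    qed
  qed
qed

end
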